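(* With the notation of the context, consider a target with unknown contour ($\mathbf m,\mathbf n$ unknown), so that the hybrid Cramér–Rao bound $\mathbf C(\mathring d,\mathring\phi,\varphi)$ is the upper-left $3\times3$ block of $\mathbf J(\boldsymbol\gamma)^{-1}$. Assume $Z=M\cos^2\mathring\phi>0$. Fix all parameters other than $\mathring d$ and let $\mathring d\to\infty$. Then, entrywise, $$\mathbf C(\mathring d,\mathring\phi,\varphi)=\Big(\frac{2E}{N_0}\Big)^{-1}\mathbf U+o(\mathring d^{4}),\qquad \mathbf U=\begin{bmatrix}C^{-1}&0&-D^{-1}\\0&Z^{-1}&Z^{-1}\\-D^{-1}&Z^{-1}&Z^{-1}+F^{-1}\end{bmatrix},$$ where $$C=L-H-\frac{(A-J)^2}{B-I},\qquad D=A-J-\frac{(L-H)(B-I)}{A-J},\qquad F=B-I-\frac{(A-J)^2}{L-H},$$ $$H=\mathbf c^{\mathsf T}\mathbf T_{22}^{-1}\mathbf c,\qquad I=\mathbf q^{\mathsf T}\mathbf T_{22}^{-1}\mathbf q,\qquad J=\mathbf c^{\mathsf T}\mathbf T_{22}^{-1}\mathbf q$$ ($D^{-1}$ being read as $0$ when $A-J=0$).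
   Context: Contour. Fix $Q\ge 1$, $\mathbf m=[a_1,\dots,a_Q]^{\mathsf T}$, $\mathbf n=[b_1,\dots,b_Q]^{\mathsf T}\in\mathbb R^Q$ with $a_1,b_1>0$. For $u\in[0,2\pi]$ let $\boldsymbol\sigma(u)=[\cos u,\dots,\cos Qu]^{\mathsf T}$, $\boldsymbol\varsigma(u)=[\sin u,\dots,\sin Qu]^{\mathsf T}$, $\boldsymbol\rho(u)=[\boldsymbol\sigma^{\mathsf T}\mathbf m,\ \boldsymbol\varsigma^{\mathsf T}\mathbf n]^{\mathsf T}\in\mathbb R^2$, and assume $\dot{\boldsymbol\rho}(u)\ne0$ for all $u$ (dot is $\partial/\partial u$). For $\mathring d>0$ and angles $\mathring\phi,\varphi$ let $\mathbf p=\mathring d[\cos\mathring\phi,\sin\mathring\phi]^{\mathsf T}$, $\mathbf R=\begin{bmatrix}\cos\varphi&-\sin\varphi\\ \sin\varphi&\cos\varphi\end{bmatrix}$, $\mathbf r(u)=\mathbf p+\mathbf R\boldsymbol\rho(u)$ (nonzero for all $u$ when $\mathring d$ is large). Let $d(u)=\|\mathbf r(u)\|$, $\phi(u)$ the polar angle of $\mathbf r(u)$, $\beta(u)$ the polar angle of $\dot{\mathbf r}(u)$. For $\mathbf x\in\mathbb R^2$, $\mathbf x_\perp=\left(\begin{smallmatrix}0&-1\\1&0\end{smallmatrix}\right)\mathbf x$. Parameter vector: $\boldsymbol\gamma=[\mathring d,\mathring\phi,\varphi,a_1,\dots,a_Q,b_1,\dots,b_Q]^{\mathsf T}\in\mathbb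 R^{2Q+3}$; derivatives with respect to $\boldsymbol\gamma$ are at fixed $u$, with angles on locally smooth branches. Set $\boldsymbol\mu=\partial d/\partial\boldsymbol\gamma$, $\boldsymbol\eta=\partial\phi/\partial\boldsymbol\gamma$, $\boldsymbol\xi=\boldsymbol\eta-\partial\beta/\partial\boldsymbol\gamma$ (functions of $u$). Let $\overline{\sin}\,x=\max(\sin x,0)$, $\alpha\ge0$ a constant (for $\alpha=0$, $(\overline{\sin}\,x)^0$ means $1$ if $\sin x>0$, else $0$), $w=(\overline{\sin}(\phi-\beta))^{\alpha+1}$, $v=(\overline{\sin}(\phi-\beta))^{\alpha}\cos(\phi-\beta)$. Star product: $\langle f_1,f_2\rangle_\star=\int_0^{2\pi}f_1f_2\|\dot{\mathbf r}(u)\|du$, $\|f\|_\star=\langle f,f\rangle_\star^{1/2}$; for vector functions $\langle\mathbf f_1,\mathbf f_2\rangle_\star=\int_0^{2\pi}\mathbf f_1\mathbf f_2^{\mathsf T}\|\dot{\mathbf r}\|du$. $\operatorname{P}_w^\perp(\mathbf f)=\mathbf f-\langle\mathbf f,w\rangle_\star\|w\|_\star^{-2}w$. Constants: $N\ge1$ (antennas), $N_0>0$, $B_{\mathrm{RMS}}>0$, $c>0$, $L=(4\pi B_{\mathrm{RMS}}/c)^2$, $M=\pi^2(N^2-1)/12$; the gain is $g=\sqrt G/\mathring d^2$ with $G>0$ a constant independent of $\mathring d$; received energy $E=g^2N\|w\|_\star^2$. Effective Fisher information matrix: $$\mathbf J(\boldsymbol\gamma)=\frac1{\|w\|_\star^2}\frac{2E}{N_0}\Big[L\langle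 w\boldsymbol\mu,w\boldsymbol\mu\rangle_\star+M\langle w\cos\phi\,\boldsymbol\eta,w\cos\phi\,\boldsymbol\eta\rangle_\star+(\alpha+1)^2\langle\operatorname{P}_w^\perp(v\boldsymbol\xi),\operatorname{P}_w^\perp(v\boldsymbol\xi)\rangle_\star\Big].$$ Further quantities (all depending on $\mathring d$ through $w,v$): $\bar w=w/\|w\|_\star$, $\bar{\mathbf p}=\mathbf p/\|\mathbf p\|$, $\bar{\mathbf p}_\perp=\mathbf p_\perp/\|\mathbf p_\perp\|$ (Euclidean norms), $$A=L\langle\bar w,\bar w\,\bar{\mathbf p}_\perp^{\mathsf T}\mathbf R\boldsymbol\rho\rangle_\star,\qquad B=L\|\bar w\,\bar{\mathbf p}_\perp^{\mathsf T}\mathbf R\boldsymbol\rho\|_\star^2+(\alpha+1)^2\|\operatorname{P}_w^\perp(v)\|_\star^2/\|w\|_\star^2,$$ $$\mathbf s=\begin{bmatrix}([1\ 0]\mathbf R^{\mathsf T}\bar{\mathbf p})\,\boldsymbol\sigma\\ ([0\ 1]\mathbf R^{\mathsf T}\bar{\mathbf p})\,\boldsymbol\varsigma\end{bmatrix},\qquad \mathbf t=\operatorname{P}_w^\perp\!\left(v\,\|\dot{\boldsymbol\rho}\|^{-2}\begin{bmatrix}(\dot{\boldsymbol\varsigma}^{\mathsf T}\mathbf n)\,\dot{\boldsymbol\sigma}\\ -(\dot{\boldsymbol\sigma}^{\mathsf T}\mathbf m)\,\dot{\boldsymbol\varsigma}\end{bmatrix}\right),$$ $$\mathbf T_{22}=L\langle\bar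 w\,\mathbf s,\bar w\,\mathbf s\rangle_\star+(\alpha+1)^2\langle\mathbf t,\mathbf t\rangle_\star/\|w\|_\star^2,\qquad \mathbf c=L\langle\bar w\,\mathbf s,\bar w\rangle_\star,$$ $$\mathbf q=L\langle\bar w\,\mathbf s,\bar w\,\bar{\mathbf p}_\perp^{\mathsf T}\mathbf R\boldsymbol\rho\rangle_\star+(\alpha+1)^2\langle\mathbf t,\operatorname{P}_w^\perp(v)\rangle_\star/\|w\|_\star^2 .$$ *)

theory Defs
  imports "HOL-Analysis.Analysis" "HOL-Library.Landau_Symbols"
begin

text \<open>
  A finite linearly ordered type \<open>'q\<close> indexes the harmonics, so that \<open>Q = CARD('q)\<close>. The
  \<open>k\<close>-th element of \<open>'q\<close> carries the frequency \<open>k \<in> {1..Q}\<close>, and \<open>Min UNIV\<close> is the first harmonic.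
\<close>

definition harmonic :: "'q::{finite,linorder} \<Rightarrow> nat" where
  "harmonic k = card {..k}"

lemma harmonic_less: "k < l \<Longrightarrow> harmonic k < harmonic (l::'q::{finite,linorder})"
  unfolding harmonic_def by (rule psubset_card_mono) auto

lemma bij_betw_harmonic:
  "bij_betw (harmonic :: 'q::{finite,linorder} \<Rightarrow> nat) UNIV {1..CARD('q)}"
proof -
  have inj: "inj (harmonic :: 'q \<Rightarrow> nat)"
    by (rule injI) (metis harmonic_less less_irrefl linorder_neqE)
  have "harmonic k \<in> {1..CARD('q)}" for k :: 'q
    unfolding harmonic_def by (auto simp: Suc_le_eq card_gt_0_iff intro!: card_mono)
  then have "range (harmonic :: 'q \<Rightarrow> nat) \<subseteq> {1..CARD('q)}" by blast
  moreover have "card (range (harmonic :: 'q \<Rightarrow> nat)) = card {1..CARD('q)}"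
    using card_image[OF inj] by simp
  ultimately have "range (harmonic :: 'q \<Rightarrow> nat) = {1..CARD('q)}"
    by (intro card_subset_eq) auto
  with inj show ?thesis by (simp add: bij_betw_def)
qed

lemma harmonic_Min: "harmonic (Min UNIV :: 'q::{finite,linorder}) = 1"
proof -
  have "{..Min UNIV} = {Min UNIV :: 'q}" by (auto intro: antisym)
  then show ?thesis by (simp add: harmonic_def)
qed

definition cos_vec :: "real \<Rightarrow> real ^ 'q::{finite,linorder}" where
  "cos_vec u = (\<chi> k. cos (real (harmonic k) * u))"

definition sin_vec :: "real \<Rightarrow> real ^ 'q::{finite,linorder}" where
  "sin_vec u = (\<chi> k. sin (real (harmonic k) * u))"

definition contour :: "real ^ 'q::{finite,linorder} \<Rightarrow> real ^ 'q::{finite,linorder} \<Rightarrow> real \<Rightarrow> real ^ 2" where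
  "contour m n u = vector [cos_vec u \<bullet> m, sin_vec u \<bullet> n]"

abbreviation dot :: "(real \<Rightarrow> 'v::real_normed_vector) \<Rightarrow> real \<Rightarrow> 'v" where
  "dot f u \<equiv> vector_derivative f (at u)"

definition rot :: "real \<Rightarrow> real ^ 2 ^ 2" where
  "rot a = vector [vector [cos a, - sin a], vector [sin a, cos a]]"

definition perp :: "real ^ 2 \<Rightarrow> real ^ 2" where
  "perp x = (vector [vector [0, - 1], vector [1, 0]] :: real ^ 2 ^ 2) *v x"

text \<open>
  The index type \<open>3 + 'q + 'q\<close> has \<open>2 * Q + 3\<close> elements: \<open>Inl 1\<close>, \<open>Inl 2\<close>, \<open>Inl 3\<close> are the distance
  of the reference point, its bearing and the orientation of the target; \<open>Inr (Inl k)\<close> and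
  \<open>Inr (Inr k)\<close> are the coefficients of the harmonic \<open>k\<close> in the first and second coordinate.
\<close>

type_synonym 'q param = "real ^ (3 + 'q + 'q)"

definition params ::
  "real \<Rightarrow> real \<Rightarrow> real \<Rightarrow> real ^ 'q::finite \<Rightarrow> real ^ 'q::finite \<Rightarrow> 'q::finite param" where
  "params d0 \<phi>0 \<psi> m n = (\<chi> i. case i of
      Inl j \<Rightarrow> (vector [d0, \<phi>0, \<psi>] :: real ^ 3) $ j
    | Inr (Inl k) \<Rightarrow> m $ k
    | Inr (Inr k) \<Rightarrow> n $ k)"

definition coef_m :: "'q::finite param \<Rightarrow> real ^ 'q::finite" where
  "coef_m \<gamma> = (\<chi> k. \<gamma> $ Inr (Inl k))"

definition coef_n :: "'q::finite param \<Rightarrow> real ^ 'q::finite" where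
  "coef_n \<gamma> = (\<chi> k. \<gamma> $ Inr (Inr k))"

definition centre :: "'q::finite param \<Rightarrow> real ^ 2" where
  "centre \<gamma> = \<gamma> $ Inl 1 *\<^sub>R vector [cos (\<gamma> $ Inl 2), sin (\<gamma> $ Inl 2)]"

definition R_mat :: "'q::finite param \<Rightarrow> real ^ 2 ^ 2" where
  "R_mat \<gamma> = rot (\<gamma> $ Inl 3)"

definition rho :: "'q::{finite,linorder} param \<Rightarrow> real \<Rightarrow> real ^ 2" where
  "rho \<gamma> = contour (coef_m \<gamma>) (coef_n \<gamma>)"

definition pos :: "'q::{finite,linorder} param \<Rightarrow> real \<Rightarrow> real ^ 2" where
  "pos \<gamma> u = centre \<gamma> + R_mat \<gamma> *v rho \<gamma> u"

definition polar_angle :: "real ^ 2 \<Rightarrow> real" where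
  "polar_angle x = Arg (Complex (x $ 1) (x $ 2))"

definition dist_at :: "'q::{finite,linorder} param \<Rightarrow> real \<Rightarrow> real" where
  "dist_at \<gamma> u = norm (pos \<gamma> u)"

definition phi :: "'q::{finite,linorder} param \<Rightarrow> real \<Rightarrow> real" where
  "phi \<gamma> u = polar_angle (pos \<gamma> u)"

definition beta :: "'q::{finite,linorder} param \<Rightarrow> real \<Rightarrow> real" where
  "beta \<gamma> u = polar_angle (dot (pos \<gamma>) u)"

definition gradient :: "('v::real_inner \<Rightarrow> real) \<Rightarrow> 'v \<Rightarrow> 'v" where
  "gradient f x = (THE D. GDERIV f x :> D)"

text \<open>
  The principal value of the angle jumps across the negative real axis, so the gradient of a polar angle is
  taken along an arbitrary branch of the angle near the point; it does not depend on the branch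
  by the lemma that follows.
\<close>

definition angle_gradient :: "('v::real_inner \<Rightarrow> real ^ 2) \<Rightarrow> 'v \<Rightarrow> 'v" where
  "angle_gradient f x = (THE D. \<exists>\<theta>.
      (\<forall>\<^sub>F y in nhds x. f y = norm (f y) *\<^sub>R vector [cos (\<theta> y), sin (\<theta> y)]) \<and>
      GDERIV \<theta> x :> D)"

lemma angle_gradient_eqI:
  fixes f :: "'v::real_inner \<Rightarrow> real ^ 2"
  assumes nz: "\<forall>\<^sub>F y in nhds x. f y \<noteq> 0"
    and br: "\<forall>\<^sub>F y in nhds x. f y = norm (f y) *\<^sub>R vector [cos (\<theta> y), sin (\<theta> y)]"
    and der: "GDERIV \<theta> x :> D"
  shows "angle_gradient f x = D"
  unfolding angle_gradient_def
proof (rule the_equality)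
  show "\<exists>\<theta>. (\<forall>\<^sub>F y in nhds x. f y = norm (f y) *\<^sub>R vector [cos (\<theta> y), sin (\<theta> y)]) \<and>
      GDERIV \<theta> x :> D"
    using br der by blast
next
  fix D' assume "\<exists>\<theta>. (\<forall>\<^sub>F y in nhds x. f y = norm (f y) *\<^sub>R vector [cos (\<theta> y), sin (\<theta> y)]) \<and>
      GDERIV \<theta> x :> D'"
  then obtain \<theta>' where
    br': "\<forall>\<^sub>F y in nhds x. f y = norm (f y) *\<^sub>R vector [cos (\<theta>' y), sin (\<theta>' y)]"
    and der': "GDERIV \<theta>' x :> D'" by blast
  have ev: "\<forall>\<^sub>F y in nhds x. cos (\<theta>' y) = cos (\<theta> y) \<and> sin (\<theta>' y) = sin (\<theta> y)"
    using nz br br'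
  proof eventually_elim
    case (elim y)
    then have "norm (f y) *\<^sub>R (vector [cos (\<theta>' y), sin (\<theta>' y)] :: real ^ 2)
        = norm (f y) *\<^sub>R vector [cos (\<theta> y), sin (\<theta> y)]" by metis
    then have "(vector [cos (\<theta>' y), sin (\<theta>' y)] :: real ^ 2) = vector [cos (\<theta> y), sin (\<theta> y)]"
      using elim(1) unfolding real_vector.scale_cancel_left by simp
    then show ?case by (metis vector_2(1) vector_2(2))
  qed
  define h where "h = (\<lambda>y. sin (\<theta>' y - \<theta> y))"
  have at: "cos (\<theta>' x) = cos (\<theta> x) \<and> sin (\<theta>' x) = sin (\<theta> x)"
    using eventually_nhds_x_imp_x[OF ev] .
  have "cos (\<theta>' x - \<theta> x) = 1" using at by (simp add: cos_diff flip: power2_eq_square)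
  moreover have "GDERIV h x :> (cos (\<theta>' x - \<theta> x) *\<^sub>R (D' - D))"
    unfolding h_def
    by (rule GDERIV_DERIV_compose[OF GDERIV_diff[OF der' der]]) (rule DERIV_sin)
  ultimately have "(h has_derivative (\<lambda>v. v \<bullet> (D' - D))) (at x)"
    by (simp add: gderiv_def)
  moreover have "(h has_derivative (\<lambda>v. 0)) (at x)"
  proof (rule has_derivative_transform_eventually[OF has_derivative_const])
    have "\<forall>\<^sub>F y in nhds x. 0 = h y"
      using ev by eventually_elim (simp add: h_def sin_diff)
    then show "\<forall>\<^sub>F y in at x. 0 = h y" "0 = h x"
      by (auto simp: eventually_at_filter elim: eventually_mono dest: eventually_nhds_x_imp_x)
  qed simp
  ultimately have "(\<lambda>v. v \<bullet> (D' - D)) = (\<lambda>v. 0)" by (rule has_derivative_unique)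
  then have "(D' - D) \<bullet> (D' - D) = 0" by meson
  then show "D' = D" by simp
qed

definition grad_dist :: "'q::{finite,linorder} param \<Rightarrow> real \<Rightarrow> 'q::{finite,linorder} param" where
  "grad_dist \<gamma> u = gradient (\<lambda>\<gamma>'. dist_at \<gamma>' u) \<gamma>"

definition grad_phi :: "'q::{finite,linorder} param \<Rightarrow> real \<Rightarrow> 'q::{finite,linorder} param" where
  "grad_phi \<gamma> u = angle_gradient (\<lambda>\<gamma>'. pos \<gamma>' u) \<gamma>"

definition grad_beta :: "'q::{finite,linorder} param \<Rightarrow> real \<Rightarrow> 'q::{finite,linorder} param" where
  "grad_beta \<gamma> u = angle_gradient (\<lambda>\<gamma>'. dot (pos \<gamma>') u) \<gamma>"

definition grad_aspect :: "'q::{finite,linorder} param \<Rightarrow> real \<Rightarrow> 'q::{finite,linorder} param" where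
  "grad_aspect \<gamma> u = grad_phi \<gamma> u - grad_beta \<gamma> u"

text \<open>\<open>0 powr 0 = 0\<close>, so \<open>sin_pos x powr 0\<close> is \<open>1\<close> if \<open>sin x > 0\<close> and \<open>0\<close> otherwise.\<close>

definition sin_pos :: "real \<Rightarrow> real" where
  "sin_pos x = max (sin x) 0"

definition wt_w :: "real \<Rightarrow> 'q::{finite,linorder} param \<Rightarrow> real \<Rightarrow> real" where
  "wt_w \<alpha> \<gamma> u = sin_pos (phi \<gamma> u - beta \<gamma> u) powr (\<alpha> + 1)"

definition wt_v :: "real \<Rightarrow> 'q::{finite,linorder} param \<Rightarrow> real \<Rightarrow> real" where
  "wt_v \<alpha> \<gamma> u = sin_pos (phi \<gamma> u - beta \<gamma> u) powr \<alpha> * cos (phi \<gamma> u - beta \<gamma> u)"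

definition star :: "'q::{finite,linorder} param \<Rightarrow> (real \<Rightarrow> real) \<Rightarrow> (real \<Rightarrow> real) \<Rightarrow> real" where
  "star \<gamma> f g = integral {0..2 * pi} (\<lambda>u. f u * g u * norm (dot (pos \<gamma>) u))"

definition star_norm :: "'q::{finite,linorder} param \<Rightarrow> (real \<Rightarrow> real) \<Rightarrow> real" where
  "star_norm \<gamma> f = sqrt (star \<gamma> f f)"

definition star_vec ::
  "'q::{finite,linorder} param \<Rightarrow> (real \<Rightarrow> real ^ 'i) \<Rightarrow> (real \<Rightarrow> real) \<Rightarrow> real ^ 'i" where
  "star_vec \<gamma> f g = (\<chi> i. star \<gamma> (\<lambda>u. f u $ i) g)"

definition star_mat ::
  "'q::{finite,linorder} param \<Rightarrow> (real \<Rightarrow> real ^ 'i) \<Rightarrow> (real \<Rightarrow> real ^ 'j) \<Rightarrow> real ^ 'j ^ 'i" where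
  "star_mat \<gamma> f g = (\<chi> i j. star \<gamma> (\<lambda>u. f u $ i) (\<lambda>u. g u $ j))"

definition proj_perp ::
  "'q::{finite,linorder} param \<Rightarrow> (real \<Rightarrow> real) \<Rightarrow> (real \<Rightarrow> real) \<Rightarrow> real \<Rightarrow> real" where
  "proj_perp \<gamma> w f u = f u - star \<gamma> f w / (star_norm \<gamma> w)\<^sup>2 * w u"

definition proj_perp_vec ::
  "'q::{finite,linorder} param \<Rightarrow> (real \<Rightarrow> real) \<Rightarrow> (real \<Rightarrow> real ^ 'i) \<Rightarrow> real \<Rightarrow> real ^ 'i" where
  "proj_perp_vec \<gamma> w f u = f u - (w u / (star_norm \<gamma> w)\<^sup>2) *\<^sub>R star_vec \<gamma> f w"

definition L_const :: "real \<Rightarrow> real \<Rightarrow> real" where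
  "L_const B\<^sub>R\<^sub>M\<^sub>S c = (4 * pi * B\<^sub>R\<^sub>M\<^sub>S / c)\<^sup>2"

definition M_const :: "nat \<Rightarrow> real" where
  "M_const N = pi\<^sup>2 * ((real N)\<^sup>2 - 1) / 12"

text \<open>In the definitions below, \<open>L\<close> and \<open>M\<close> stand for the values of the two constants above.\<close>

definition gain :: "real \<Rightarrow> 'q::finite param \<Rightarrow> real" where
  "gain G \<gamma> = sqrt G / (\<gamma> $ Inl 1)\<^sup>2"

definition energy :: "real \<Rightarrow> nat \<Rightarrow> real \<Rightarrow> 'q::{finite,linorder} param \<Rightarrow> real" where
  "energy G N \<alpha> \<gamma> = (gain G \<gamma>)\<^sup>2 * real N * (star_norm \<gamma> (wt_w \<alpha> \<gamma>))\<^sup>2"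

definition fim ::
  "real \<Rightarrow> real \<Rightarrow> real \<Rightarrow> real \<Rightarrow> real \<Rightarrow> 'q::{finite,linorder} param
     \<Rightarrow> real ^ (3 + 'q + 'q) ^ (3 + 'q + 'q)" where
  "fim L M E N\<^sub>0 \<alpha> \<gamma> =
     (let w = wt_w \<alpha> \<gamma>; v = wt_v \<alpha> \<gamma>;
          f\<^sub>\<mu> = (\<lambda>u. w u *\<^sub>R grad_dist \<gamma> u);
          f\<^sub>\<eta> = (\<lambda>u. (w u * cos (phi \<gamma> u)) *\<^sub>R grad_phi \<gamma> u);
          f\<^sub>\<xi> = proj_perp_vec \<gamma> w (\<lambda>u. v u *\<^sub>R grad_aspect \<gamma> u)
      in (1 / (star_norm \<gamma> w)\<^sup>2 * (2 * E / N\<^sub>0)) *\<^sub>R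
           (L *\<^sub>R star_mat \<gamma> f\<^sub>\<mu> f\<^sub>\<mu> + M *\<^sub>R star_mat \<gamma> f\<^sub>\<eta> f\<^sub>\<eta>
             + (\<alpha> + 1)\<^sup>2 *\<^sub>R star_mat \<gamma> f\<^sub>\<xi> f\<^sub>\<xi>))"

definition hcrb :: "real ^ (3 + 'q::finite + 'q) ^ (3 + 'q + 'q) \<Rightarrow> real ^ 3 ^ 3" where
  "hcrb J = (\<chi> i j. matrix_inv J $ Inl i $ Inl j)"

definition w_bar :: "real \<Rightarrow> 'q::{finite,linorder} param \<Rightarrow> real \<Rightarrow> real" where
  "w_bar \<alpha> \<gamma> u = wt_w \<alpha> \<gamma> u / star_norm \<gamma> (wt_w \<alpha> \<gamma>)"

definition p_bar :: "'q::finite param \<Rightarrow> real ^ 2" where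
  "p_bar \<gamma> = centre \<gamma> /\<^sub>R norm (centre \<gamma>)"

definition p_bar_perp :: "'q::finite param \<Rightarrow> real ^ 2" where
  "p_bar_perp \<gamma> = perp (centre \<gamma>) /\<^sub>R norm (perp (centre \<gamma>))"

definition wpR_rho :: "real \<Rightarrow> 'q::{finite,linorder} param \<Rightarrow> real \<Rightarrow> real" where
  "wpR_rho \<alpha> \<gamma> u = w_bar \<alpha> \<gamma> u * (p_bar_perp \<gamma> \<bullet> (R_mat \<gamma> *v rho \<gamma> u))"

definition A_qty :: "real \<Rightarrow> real \<Rightarrow> 'q::{finite,linorder} param \<Rightarrow> real" where
  "A_qty L \<alpha> \<gamma> = L * star \<gamma> (w_bar \<alpha> \<gamma>) (wpR_rho \<alpha> \<gamma>)"

definition B_qty :: "real \<Rightarrow> real \<Rightarrow> 'q::{finite,linorder} param \<Rightarrow> real" where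
  "B_qty L \<alpha> \<gamma> = L * (star_norm \<gamma> (wpR_rho \<alpha> \<gamma>))\<^sup>2
     + (\<alpha> + 1)\<^sup>2 * (star_norm \<gamma> (proj_perp \<gamma> (wt_w \<alpha> \<gamma>) (wt_v \<alpha> \<gamma>)))\<^sup>2
         / (star_norm \<gamma> (wt_w \<alpha> \<gamma>))\<^sup>2"

definition s_vec :: "'q::{finite,linorder} param \<Rightarrow> real \<Rightarrow> real ^ ('q + 'q)" where
  "s_vec \<gamma> u = (\<chi> j. case j of
      Inl k \<Rightarrow> (transpose (R_mat \<gamma>) *v p_bar \<gamma>) $ 1 * cos_vec u $ k
    | Inr k \<Rightarrow> (transpose (R_mat \<gamma>) *v p_bar \<gamma>) $ 2 * sin_vec u $ k)"

definition t_vec :: "real \<Rightarrow> 'q::{finite,linorder} param \<Rightarrow> real \<Rightarrow> real ^ ('q + 'q)" where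
  "t_vec \<alpha> \<gamma> = proj_perp_vec \<gamma> (wt_w \<alpha> \<gamma>) (\<lambda>u.
     (wt_v \<alpha> \<gamma> u / (norm (dot (rho \<gamma>) u))\<^sup>2) *\<^sub>R (\<chi> j. case j of
        Inl k \<Rightarrow> (dot sin_vec u \<bullet> coef_n \<gamma>) * dot cos_vec u $ k
      | Inr k \<Rightarrow> - (dot cos_vec u \<bullet> coef_m \<gamma>) * dot sin_vec u $ k))"

definition ws_vec :: "real \<Rightarrow> 'q::{finite,linorder} param \<Rightarrow> real \<Rightarrow> real ^ ('q + 'q)" where
  "ws_vec \<alpha> \<gamma> u = w_bar \<alpha> \<gamma> u *\<^sub>R s_vec \<gamma> u"

definition T22 :: "real \<Rightarrow> real \<Rightarrow> 'q::{finite,linorder} param \<Rightarrow> real ^ ('q + 'q) ^ ('q + 'q)" where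
  "T22 L \<alpha> \<gamma> = L *\<^sub>R star_mat \<gamma> (ws_vec \<alpha> \<gamma>) (ws_vec \<alpha> \<gamma>)
     + ((\<alpha> + 1)\<^sup>2 / (star_norm \<gamma> (wt_w \<alpha> \<gamma>))\<^sup>2) *\<^sub>R star_mat \<gamma> (t_vec \<alpha> \<gamma>) (t_vec \<alpha> \<gamma>)"

definition c_vec :: "real \<Rightarrow> real \<Rightarrow> 'q::{finite,linorder} param \<Rightarrow> real ^ ('q + 'q)" where
  "c_vec L \<alpha> \<gamma> = L *\<^sub>R star_vec \<gamma> (ws_vec \<alpha> \<gamma>) (w_bar \<alpha> \<gamma>)"

definition q_vec :: "real \<Rightarrow> real \<Rightarrow> 'q::{finite,linorder} param \<Rightarrow> real ^ ('q + 'q)" where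
  "q_vec L \<alpha> \<gamma> = L *\<^sub>R star_vec \<gamma> (ws_vec \<alpha> \<gamma>) (wpR_rho \<alpha> \<gamma>)
     + ((\<alpha> + 1)\<^sup>2 / (star_norm \<gamma> (wt_w \<alpha> \<gamma>))\<^sup>2) *\<^sub>R
         star_vec \<gamma> (t_vec \<alpha> \<gamma>) (proj_perp \<gamma> (wt_w \<alpha> \<gamma>) (wt_v \<alpha> \<gamma>))"

definition H_qty :: "real \<Rightarrow> real \<Rightarrow> 'q::{finite,linorder} param \<Rightarrow> real" where
  "H_qty L \<alpha> \<gamma> = c_vec L \<alpha> \<gamma> \<bullet> (matrix_inv (T22 L \<alpha> \<gamma>) *v c_vec L \<alpha> \<gamma>)"

definition I_qty :: "real \<Rightarrow> real \<Rightarrow> 'q::{finite,linorder} param \<Rightarrow> real" where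
  "I_qty L \<alpha> \<gamma> = q_vec L \<alpha> \<gamma> \<bullet> (matrix_inv (T22 L \<alpha> \<gamma>) *v q_vec L \<alpha> \<gamma>)"

definition J_qty :: "real \<Rightarrow> real \<Rightarrow> 'q::{finite,linorder} param \<Rightarrow> real" where
  "J_qty L \<alpha> \<gamma> = c_vec L \<alpha> \<gamma> \<bullet> (matrix_inv (T22 L \<alpha> \<gamma>) *v q_vec L \<alpha> \<gamma>)"

definition C_qty :: "real \<Rightarrow> real \<Rightarrow> 'q::{finite,linorder} param \<Rightarrow> real" where
  "C_qty L \<alpha> \<gamma> = L - H_qty L \<alpha> \<gamma>
     - (A_qty L \<alpha> \<gamma> - J_qty L \<alpha> \<gamma>)\<^sup>2 / (B_qty L \<alpha> \<gamma> - I_qty L \<alpha> \<gamma>)"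

definition D_qty :: "real \<Rightarrow> real \<Rightarrow> 'q::{finite,linorder} param \<Rightarrow> real" where
  "D_qty L \<alpha> \<gamma> = A_qty L \<alpha> \<gamma> - J_qty L \<alpha> \<gamma>
     - (L - H_qty L \<alpha> \<gamma>) * (B_qty L \<alpha> \<gamma> - I_qty L \<alpha> \<gamma>) / (A_qty L \<alpha> \<gamma> - J_qty L \<alpha> \<gamma>)"

definition D_inv :: "real \<Rightarrow> real \<Rightarrow> 'q::{finite,linorder} param \<Rightarrow> real" where
  "D_inv L \<alpha> \<gamma> = (if A_qty L \<alpha> \<gamma> - J_qty L \<alpha> \<gamma> = 0 then 0 else inverse (D_qty L \<alpha> \<gamma>))"

definition F_qty :: "real \<Rightarrow> real \<Rightarrow> 'q::{finite,linorder} param \<Rightarrow> real" where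
  "F_qty L \<alpha> \<gamma> = B_qty L \<alpha> \<gamma> - I_qty L \<alpha> \<gamma>
     - (A_qty L \<alpha> \<gamma> - J_qty L \<alpha> \<gamma>)\<^sup>2 / (L - H_qty L \<alpha> \<gamma>)"

definition U_mat :: "real \<Rightarrow> real \<Rightarrow> real \<Rightarrow> 'q::{finite,linorder} param \<Rightarrow> real ^ 3 ^ 3" where
  "U_mat L Z \<alpha> \<gamma> = vector
     [vector [inverse (C_qty L \<alpha> \<gamma>), 0, - D_inv L \<alpha> \<gamma>],
      vector [0, inverse Z, inverse Z],
      vector [- D_inv L \<alpha> \<gamma>, inverse Z, inverse Z + inverse (F_qty L \<alpha> \<gamma>)]]"

end

theory Submission
  imports Defs "HOL-Complex_Analysis.Conformal_Mappings" "HOL-Real_Asymp.Real_Asymp"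
begin

text \<open>
  In the orthonormal frame of the bearing \<open>\<phi>0\<close> the position is \<open>(d + e, h)\<close> with \<open>e\<close>, \<open>h\<close> independent
  of the distance \<open>d\<close> of the reference point, so all gradients are polynomials in \<open>d / R\<close>, \<open>1 / R\<close> and bounded functions that do not
  depend on \<open>d\<close>, where \<open>R\<close> is the distance to the contour point. By bounded convergence the
  information matrix divided by \<open>2 E / N\<^sub>0\<close> tends entrywise to a limit, and the blocks \<open>A\<close>, \<open>B\<close>,
  \<open>c\<close>, \<open>q\<close>, \<open>T22\<close> tend to the blocks of that limit. Inversion being continuous at an invertible matrix, it remains to
  invert the limit by Schur complements, which gives \<open>U\<close>, and to show that it is positive
  definite.

  A null vector of the limit yields a deformation of the contour that leaves the projection onto the
  line of sight fixed and changes the weighted aspect angle by a multiple of the weight, on the illuminated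
  part of the contour. Both conditions are identities between trigonometric polynomials, so they extend to the whole
  contour; at a point where the velocity is transverse to the line of sight the multiple
  is seen to vanish, and then the deformation is an infinitesimal rotation. A rotation turns the cosine series
  of the first coordinate into a sine series, so it is trivial.
\<close>

section \<open>Inverse matrices\<close>

text \<open>\<open>U_mat\<close> itself varies with the distance through the weights, so nothing is
  expanded in powers of the distance: the inverse of the normalised information matrix and
  \<open>U_mat\<close> are shown to have the same limit. As \<open>2 * E / N\<^sub>0\<close> decays
  like the inverse fourth power of the distance, restoring it turns a difference tending to 0 into
  the required error, without any rate of convergence.

  The obstacle in the passage to the limit is the weight \<open>wt_v\<close>. For \<alpha> = 0 it
  jumps at the edge of the illuminated part, so pointwise convergence can fail where the limiting
  sine vanishes. Those points are zeros of a nontrivial entire function, hence finitely many in one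
  period.

  The assumption on \<open>Z\<close> is what removes the last degeneracy: a joint rotation of
  bearing and orientation changes neither the ranges nor the aspect angles, and only the antenna
  term with \<open>cos \<phi>0\<close> detects it.\<close>

lemma matrix_mul_matrix_inv:
  fixes A :: "real^'n^'n"
  assumes "invertible A"
  shows "A ** matrix_inv A = mat 1" "matrix_inv A ** A = mat 1"
proof -
  have "A ** matrix_inv A = mat 1 \<and> matrix_inv A ** A = mat 1"
    unfolding matrix_inv_def by (rule someI_ex) (use assms in \<open>simp add: invertible_def\<close>)
  then show "A ** matrix_inv A = mat 1" "matrix_inv A ** A = mat 1" by auto
qed

lemma matrix_inv_mult_vec_eqI:
  fixes A :: "real^'n^'n"
  assumes "invertible A" "A *v x = b"
  shows "matrix_inv A *v b = x"
  using assms by (metis matrix_mul_matrix_inv(2) matrix_vector_mul_assoc matrix_vector_mul_lid)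

lemma matrix_inv_nth_eqI:
  fixes A :: "real^'n^'n"
  assumes "invertible A" "A *v x = axis j 1"
  shows "matrix_inv A $ i $ j = x $ i"
proof -
  have "x = column j (matrix_inv A)"
    using matrix_inv_mult_vec_eqI[OF assms] by (simp add: matrix_vector_mult_basis)
  then show ?thesis by (simp add: column_def)
qed

lemma scaleR_matrix_mult:
  fixes A :: "real^'n^'m" and B :: "real^'k^'n"
  shows "(a *\<^sub>R A) ** (b *\<^sub>R B) = (a * b) *\<^sub>R (A ** B)"
  by (simp add: vec_eq_iff matrix_matrix_mult_def sum_distrib_left mult_ac)

lemma matrix_inv_scaleR:
  fixes A :: "real^'n^'n"
  assumes "invertible A" "k \<noteq> 0"
  shows "invertible (k *\<^sub>R A)" "matrix_inv (k *\<^sub>R A) = inverse k *\<^sub>R matrix_inv A"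
proof -
  have 1: "(k *\<^sub>R A) ** (inverse k *\<^sub>R matrix_inv A) = mat 1"
    using assms by (simp add: scaleR_matrix_mult matrix_mul_matrix_inv)
  have 2: "(inverse k *\<^sub>R matrix_inv A) ** (k *\<^sub>R A) = mat 1"
    using 1 by (simp add: matrix_left_right_inverse)
  show 3: "invertible (k *\<^sub>R A)" using 1 2 by (auto simp: invertible_def)
  show "matrix_inv (k *\<^sub>R A) = inverse k *\<^sub>R matrix_inv A"
    by (metis 1 3 matrix_mul_assoc matrix_mul_lid matrix_mul_matrix_inv(2) matrix_mul_rid)
qed

lemma invertible_of_pos_def:
  fixes A :: "real^'n^'n"
  assumes "\<And>x. x \<noteq> 0 \<Longrightarrow> x \<bullet> (A *v x) > 0"
  shows "invertible A"
  unfolding invertible_left_inverse matrix_left_invertible_ker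
  using assms by fastforce

lemma tendsto_det:
  fixes A :: "'b \<Rightarrow> real^'n^'n"
  assumes "\<And>i j. ((\<lambda>d. A d $ i $ j) \<longlongrightarrow> A0 $ i $ j) F"
  shows "((\<lambda>d. det (A d)) \<longlongrightarrow> det A0) F"
  unfolding det_def by (intro tendsto_intros assms)

text \<open>Cramer's rule for \<open>A *v x = axis j 1\<close>. As a quotient of determinants, each
  entry of the inverse depends continuously on the entries of \<open>A\<close>.\<close>

lemma matrix_inv_nth:
  fixes A :: "real^'n^'n"
  assumes "invertible A"
  shows "matrix_inv A $ i $ j =
    det (\<chi> k l. if l = i then (axis j 1 :: real^'n) $ k else A $ k $ l) / det A"
proof -
  have "A *v (\<chi> i. det (\<chi> k l. if l = i then (axis j 1 :: real^'n) $ k else A $ k $ l) / det A) = axis j 1"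
    using assms by (subst cramer) (simp_all add: invertible_det_nz)
  from matrix_inv_nth_eqI[OF assms this] show ?thesis by simp
qed

lemma tendsto_matrix_inv:
  fixes A :: "'b \<Rightarrow> real^'n^'n"
  assumes lim: "\<And>i j. ((\<lambda>d. A d $ i $ j) \<longlongrightarrow> A0 $ i $ j) F" and inv: "invertible A0"
  shows "eventually (\<lambda>d. invertible (A d)) F"
    and "((\<lambda>d. matrix_inv (A d) $ i $ j) \<longlongrightarrow> matrix_inv A0 $ i $ j) F"
proof -
  have det: "((\<lambda>d. det (A d)) \<longlongrightarrow> det A0) F" by (rule tendsto_det[OF lim])
  have nz: "det A0 \<noteq> 0" using inv by (simp add: invertible_det_nz)
  show ev: "eventually (\<lambda>d. invertible (A d)) F"
    using tendsto_imp_eventually_ne[OF det nz] by (simp add: invertible_det_nz)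
  have "((\<lambda>d. det (\<chi> k l. if l = i then (axis j 1 :: real^'n) $ k else A d $ k $ l) / det (A d)) \<longlongrightarrow>
    matrix_inv A0 $ i $ j) F"
    unfolding matrix_inv_nth[OF inv]
  proof (intro tendsto_divide det nz tendsto_det)
    fix k l
    show "((\<lambda>d. (\<chi> k l. if l = i then (axis j 1 :: real^'n) $ k else A d $ k $ l) $ k $ l) \<longlongrightarrow>
      (\<chi> k l. if l = i then (axis j 1 :: real^'n) $ k else A0 $ k $ l) $ k $ l) F"
      using lim[of k l] by (cases "l = i") simp_all
  qed
  then show "((\<lambda>d. matrix_inv (A d) $ i $ j) \<longlongrightarrow> matrix_inv A0 $ i $ j) F"
    by (rule Lim_transform_eventually) (use ev in eventually_elim, simp add: matrix_inv_nth)
qed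

section \<open>Schur complement for the pose parameters and the shape coefficients\<close>

lemma sum_3_Plus:
  fixes f :: "3 + 'r::finite \<Rightarrow> 'a::comm_monoid_add"
  shows "(\<Sum>i\<in>UNIV. f i) = f (Inl 1) + f (Inl 2) + f (Inl 3) + (\<Sum>k\<in>UNIV. f (Inr k))"
  by (simp add: UNIV_Plus_UNIV[symmetric] sum.Plus sum_3 o_def del: UNIV_Plus_UNIV)

definition join :: "real \<Rightarrow> real \<Rightarrow> real \<Rightarrow> real^'r \<Rightarrow> real^(3 + 'r::finite)" where
  "join x1 x2 x3 z = (\<chi> i. case i of Inl j \<Rightarrow> (vector [x1, x2, x3] :: real^3) $ j | Inr k \<Rightarrow> z $ k)"

lemma join_nth [simp]:
  "join x1 x2 x3 z $ Inl 1 = x1" "join x1 x2 x3 z $ Inl 2 = x2" "join x1 x2 x3 z $ Inl 3 = x3"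
  "join x1 x2 x3 z $ Inr k = z $ k"
  by (simp_all add: join_def)

lemma join_eq_0_iff: "join x1 x2 x3 z = 0 \<longleftrightarrow> x1 = 0 \<and> x2 = 0 \<and> x3 = 0 \<and> z = 0"
  by (auto simp: vec_eq_iff split_sum_all forall_3)

lemma join_mult:
  fixes K :: "real^(3 + 'r::finite)^(3 + 'r)"
  shows "(K *v join x1 x2 x3 z) $ i = K $ i $ Inl 1 * x1 + K $ i $ Inl 2 * x2 + K $ i $ Inl 3 * x3
    + (\<chi> k. K $ i $ Inr k) \<bullet> z"
  by (simp add: matrix_vector_mult_def sum_3_Plus inner_vec_def)

lemma inner_join: "join x1 x2 x3 z \<bullet> v = x1 * v $ Inl 1 + x2 * v $ Inl 2 + x3 * v $ Inl 3 + z \<bullet> (\<chi> k. v $ Inr k)"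
  by (simp add: inner_vec_def sum_3_Plus)

text \<open>The second and third parameters enter only through their difference, apart from the additional
  information \<open>Z\<close> about the second one.\<close>

locale block_matrix =
  fixes K :: "real^(3 + 'r::finite)^(3 + 'r)" and L A B Z :: real and c q :: "real^'r" and T :: "real^'r^'r"
  assumes pos_def: "\<And>x. x \<noteq> 0 \<Longrightarrow> x \<bullet> (K *v x) > 0"
    and row1: "K $ Inl 1 $ Inl 1 = L" "K $ Inl 1 $ Inl 2 = A" "K $ Inl 1 $ Inl 3 = - A" "(\<chi> k. K $ Inl 1 $ Inr k) = c"
    and row2: "K $ Inl 2 $ Inl 1 = A" "K $ Inl 2 $ Inl 2 = B + Z" "K $ Inl 2 $ Inl 3 = - B" "(\<chi> k. K $ Inl 2 $ Inr k) = q"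
    and row3: "K $ Inl 3 $ Inl 1 = - A" "K $ Inl 3 $ Inl 2 = - B" "K $ Inl 3 $ Inl 3 = B" "(\<chi> k. K $ Inl 3 $ Inr k) = - q"
    and rows: "K $ Inr k $ Inl 1 = c $ k" "K $ Inr k $ Inl 2 = q $ k" "K $ Inr k $ Inl 3 = - q $ k"
    and T: "(\<chi> k l. K $ Inr k $ Inr l) = T" and T_sym: "transpose T = T" and Z: "Z > 0"
begin

lemma mult_join:
  "(K *v join x1 x2 x3 z) $ Inl 1 = L * x1 + A * (x2 - x3) + c \<bullet> z"
  "(K *v join x1 x2 x3 z) $ Inl 2 = A * x1 + B * (x2 - x3) + q \<bullet> z + Z * x2"
  "(K *v join x1 x2 x3 z) $ Inl 3 = - (A * x1 + B * (x2 - x3) + q \<bullet> z)"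
  "(K *v join x1 x2 x3 z) $ Inr k = (x1 *\<^sub>R c + (x2 - x3) *\<^sub>R q + T *v z) $ k"
proof -
  have "(\<chi> l. K $ Inr k $ Inr l) = T $ k" using T by (auto simp: vec_eq_iff)
  then show "(K *v join x1 x2 x3 z) $ Inr k = (x1 *\<^sub>R c + (x2 - x3) *\<^sub>R q + T *v z) $ k"
    unfolding join_mult by (simp add: rows matrix_vector_mult_def inner_vec_def algebra_simps)
qed (simp_all add: join_mult row1 row2 row3 algebra_simps)

lemma T_pos_def: "z \<noteq> 0 \<Longrightarrow> z \<bullet> (T *v z) > 0"
  using pos_def[of "join 0 0 0 z"] by (simp add: join_eq_0_iff inner_join mult_join)

lemma T_inv: "invertible T"
  by (rule invertible_of_pos_def) (rule T_pos_def)

definition "cTc = c \<bullet> (matrix_inv T *v c)"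
definition "qTq = q \<bullet> (matrix_inv T *v q)"
definition "cTq = c \<bullet> (matrix_inv T *v q)"

text \<open>The inverse of a symmetric matrix is symmetric: \<open>T\<close> is inserted next to
  \<open>q\<close> and moved across the inner product.\<close>

lemma cTq_sym: "q \<bullet> (matrix_inv T *v c) = cTq"
proof -
  have "q \<bullet> (matrix_inv T *v c) = (T *v (matrix_inv T *v q)) \<bullet> (matrix_inv T *v c)"
    by (simp add: matrix_vector_mul_assoc matrix_mul_matrix_inv T_inv)
  also have "\<dots> = (matrix_inv T *v q) \<bullet> (T *v (matrix_inv T *v c))"
    by (metis T_sym dot_lmul_matrix inner_commute vector_transpose_matrix)
  also have "\<dots> = cTq"
    by (simp add: matrix_vector_mul_assoc matrix_mul_matrix_inv T_inv cTq_def inner_commute)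
  finally show ?thesis .
qed

text \<open>For a prescribed head, this is the tail that annihilates the last block of
  \<open>K *v join x1 x2 x3 z\<close>. Only \<open>y = x2 - x3\<close> enters, because the tail is
  coupled to the two angles through their difference.\<close>

definition "reduce x1 y = - (matrix_inv T *v (x1 *\<^sub>R c + y *\<^sub>R q))"

lemma reduce:
  "x1 *\<^sub>R c + y *\<^sub>R q + T *v reduce x1 y = 0"
  "c \<bullet> reduce x1 y = - (cTc * x1 + cTq * y)"
  "q \<bullet> reduce x1 y = - (cTq * x1 + qTq * y)"
proof -
  have "T *v reduce x1 y = - (x1 *\<^sub>R c + y *\<^sub>R q)"
    unfolding reduce_def linear_neg[OF matrix_vector_mul_linear] matrix_vector_mul_assoc
    by (simp add: matrix_mul_matrix_inv T_inv)
  then show "x1 *\<^sub>R c + y *\<^sub>R q + T *v reduce x1 y = 0" by simp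
  show "c \<bullet> reduce x1 y = - (cTc * x1 + cTq * y)"
    by (simp add: reduce_def matrix_vector_right_distrib matrix_vector_mult_scaleR inner_add_right
        cTc_def cTq_def algebra_simps)
  show "q \<bullet> reduce x1 y = - (cTq * x1 + qTq * y)"
    by (simp add: reduce_def matrix_vector_right_distrib matrix_vector_mult_scaleR inner_add_right
        qTq_def cTq_sym algebra_simps)
qed

text \<open>What remains on the head is the Schur complement of \<open>T\<close> acting on
  \<open>x1\<close> and \<open>x2 - x3\<close>. Rows 2 and 3 carry its second component with
  opposite signs, and \<open>Z\<close> acts on \<open>x2\<close> alone.\<close>

lemma mult_join_reduce:
  "K *v join x1 x2 x3 (reduce x1 (x2 - x3)) = join ((L - cTc) * x1 + (A - cTq) * (x2 - x3))
     ((A - cTq) * x1 + (B - qTq) * (x2 - x3) + Z * x2) (- ((A - cTq) * x1 + (B - qTq) * (x2 - x3))) 0"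
proof -
  have "(x1 *\<^sub>R c + (x2 - x3) *\<^sub>R q + T *v reduce x1 (x2 - x3)) $ k = 0" for k
    by (simp only: reduce(1) zero_index)
  then show ?thesis
    unfolding vec_eq_iff split_sum_all forall_3 mult_join reduce(2,3) join_nth
    by (simp add: algebra_simps)
qed

text \<open>The head \<open>x1, 0, - y\<close> has difference \<open>y\<close> and kills the
  \<open>Z\<close> term, so the form of \<open>K\<close> at the reduced vector is exactly the form
  of the Schur complement.\<close>

lemma schur_pos:
  assumes "x1 \<noteq> 0 \<or> y \<noteq> 0"
  shows "(L - cTc) * x1\<^sup>2 + 2 * (A - cTq) * x1 * y + (B - qTq) * y\<^sup>2 > 0"
proof -
  have "join x1 0 (- y) (reduce x1 (0 - (- y))) \<noteq> 0"
    using assms by (auto simp: join_eq_0_iff)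
  from pos_def[OF this] show ?thesis
    unfolding mult_join_reduce
    by (simp add: inner_join power2_eq_square algebra_simps flip: zero_vec_def)
qed

lemma schur_nonzero:
  "L - cTc > 0" "B - qTq > 0" "(L - cTc) * (B - qTq) - (A - cTq)\<^sup>2 > 0"
proof -
  show 1: "L - cTc > 0" using schur_pos[of 1 0] by simp
  show "B - qTq > 0" using schur_pos[of 0 1] by simp
  \<comment> \<open>The test vector is orthogonal to the first row of the Schur complement, so the
    form collapses to \<open>L - cTc\<close> times the determinant.\<close>
  have "0 < (L - cTc) * (A - cTq)\<^sup>2 - 2 * (A - cTq)\<^sup>2 * (L - cTc) + (B - qTq) * (L - cTc)\<^sup>2"
    using schur_pos[of "- (A - cTq)" "L - cTc"] 1 by (simp add: power2_eq_square algebra_simps)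
  also have "\<dots> = (L - cTc) * ((L - cTc) * (B - qTq) - (A - cTq)\<^sup>2)"
    by (simp add: power2_eq_square algebra_simps)
  finally show "(L - cTc) * (B - qTq) - (A - cTq)\<^sup>2 > 0" using 1 by (simp add: zero_less_mult_iff)
qed

definition "schur_det = (L - cTc) * (B - qTq) - (A - cTq)\<^sup>2"

lemma K_inv: "invertible K"
  by (rule invertible_of_pos_def) (rule pos_def)

text \<open>With the reduced tail, rows 2 and 3 add up to \<open>Z * x2\<close>, and the rest is a 2
  by 2 system for \<open>x1\<close> and \<open>x2 - x3\<close> with determinant
  \<open>schur_det\<close>. Its solutions \<open>c1\<close>, \<open>c2\<close>, \<open>c3\<close>
  give the three columns.\<close>

lemma inverse_block:
  "matrix_inv K $ Inl a $ Inl b = (vector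
     [vector [(B - qTq) / schur_det, 0, (A - cTq) / schur_det],
      vector [0, inverse Z, inverse Z],
      vector [(A - cTq) / schur_det, inverse Z, inverse Z + (L - cTc) / schur_det]] :: real^3^3) $ a $ b"
proof -
  have schur_det: "schur_det > 0" using schur_nonzero by (simp add: schur_det_def)
  have D: "(L - cTc) * (B - qTq) = schur_det + (A - cTq)\<^sup>2" by (simp add: schur_det_def)
  have col: "matrix_inv K $ Inl a $ Inl b = join x1 x2 x3 (reduce x1 (x2 - x3)) $ Inl a"
    if "K *v join x1 x2 x3 (reduce x1 (x2 - x3)) = axis (Inl b) 1" for x1 x2 x3 a b
    by (rule matrix_inv_nth_eqI[OF K_inv that])
  have c1: "K *v join x1 x2 x3 (reduce x1 (x2 - x3)) = axis (Inl 1) 1"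
    if "x1 = (B - qTq) / schur_det" "x2 = 0" "x3 = (A - cTq) / schur_det" for x1 x2 x3
  proof -
    have "(L - cTc) * x1 + (A - cTq) * (x2 - x3) = ((L - cTc) * (B - qTq) - (A - cTq)\<^sup>2) / schur_det"
      "(A - cTq) * x1 + (B - qTq) * (x2 - x3) = 0"
      unfolding that using schur_det by (simp_all add: field_simps power2_eq_square)
    then show ?thesis
      using that(2) schur_det unfolding mult_join_reduce D
      by (simp add: vec_eq_iff split_sum_all forall_3 axis_def)
  qed
  have c2: "K *v join x1 x2 x3 (reduce x1 (x2 - x3)) = axis (Inl 2) 1"
    if "x1 = 0" "x2 = inverse Z" "x3 = inverse Z" for x1 x2 x3
    using that Z unfolding mult_join_reduce
    by (simp add: vec_eq_iff split_sum_all forall_3 axis_def)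
  have c3: "K *v join x1 x2 x3 (reduce x1 (x2 - x3)) = axis (Inl 3) 1"
    if "x1 = (A - cTq) / schur_det" "x2 = inverse Z" "x3 = inverse Z + (L - cTc) / schur_det" for x1 x2 x3
  proof -
    have "(L - cTc) * x1 + (A - cTq) * (x2 - x3) = 0"
      "(A - cTq) * x1 + (B - qTq) * (x2 - x3) = - ((L - cTc) * (B - qTq) - (A - cTq)\<^sup>2) / schur_det"
      unfolding that using schur_det by (simp_all add: field_simps power2_eq_square)
    then show ?thesis
      using that(2) schur_det Z unfolding mult_join_reduce D
      by (simp add: vec_eq_iff split_sum_all forall_3 axis_def)
  qed
  show ?thesis
    using exhaust_3[of a] exhaust_3[of b]
      col[OF c1[OF refl refl refl]] col[OF c2[OF refl refl refl]] col[OF c3[OF refl refl refl]]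
    by auto
qed

end

section \<open>Trigonometric polynomials and rigidity of the contour\<close>

text \<open>Restrictions of entire functions are stable under the ring operations, and they give
  trigonometric polynomials the identity theorem on the real line.\<close>

definition entire_real :: "(real \<Rightarrow> real) \<Rightarrow> bool" where
  "entire_real f \<longleftrightarrow> (\<exists>F. F holomorphic_on UNIV \<and> (\<forall>u. F (complex_of_real u) = complex_of_real (f u)))"

lemma entire_realI:
  "F holomorphic_on UNIV \<Longrightarrow> (\<And>u. F (complex_of_real u) = complex_of_real (f u)) \<Longrightarrow> entire_real f"
  by (auto simp: entire_real_def)

named_theorems entire_real_intros

lemma entire_real_const [entire_real_intros]: "entire_real (\<lambda>u. c)"
  by (rule entire_realI[of "\<lambda>z. of_real c"]) auto

lemma entire_real_cos [entire_real_intros]: "entire_real (\<lambda>u. cos (c * u))"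
  by (rule entire_realI[of "\<lambda>z. cos (of_real c * z)"]) (auto intro!: holomorphic_intros simp: cos_of_real simp flip: of_real_mult)

lemma entire_real_sin [entire_real_intros]: "entire_real (\<lambda>u. sin (c * u))"
  by (rule entire_realI[of "\<lambda>z. sin (of_real c * z)"]) (auto intro!: holomorphic_intros simp: sin_of_real simp flip: of_real_mult)

lemma entire_real_add [entire_real_intros]:
  assumes "entire_real f" "entire_real g" shows "entire_real (\<lambda>u. f u + g u)"
proof -
  obtain F G where "F holomorphic_on UNIV" "G holomorphic_on UNIV"
    "\<And>u. F (complex_of_real u) = f u" "\<And>u. G (complex_of_real u) = g u"
    using assms unfolding entire_real_def by metis
  then show ?thesis by (intro entire_realI[of "\<lambda>z. F z + G z"]) (auto intro: holomorphic_intros)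
qed

lemma entire_real_mult [entire_real_intros]:
  assumes "entire_real f" "entire_real g" shows "entire_real (\<lambda>u. f u * g u)"
proof -
  obtain F G where "F holomorphic_on UNIV" "G holomorphic_on UNIV"
    "\<And>u. F (complex_of_real u) = f u" "\<And>u. G (complex_of_real u) = g u"
    using assms unfolding entire_real_def by metis
  then show ?thesis by (intro entire_realI[of "\<lambda>z. F z * G z"]) (auto intro: holomorphic_intros)
qed

lemma entire_real_uminus [entire_real_intros]:
  "entire_real f \<Longrightarrow> entire_real (\<lambda>u. - f u)"
  using entire_real_mult[OF entire_real_const[of "-1"]] by simp

lemma entire_real_diff [entire_real_intros]:
  "entire_real f \<Longrightarrow> entire_real g \<Longrightarrow> entire_real (\<lambda>u. f u - g u)"
  using entire_real_add[of f "\<lambda>u. - g u"] by (simp add: entire_real_uminus)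

lemma entire_real_sum [entire_real_intros]:
  "(\<And>k. k \<in> A \<Longrightarrow> entire_real (f k)) \<Longrightarrow> entire_real (\<lambda>u. \<Sum>k\<in>A. f k u)"
  by (induction A rule: infinite_finite_induct) (auto intro: entire_real_intros)

text \<open>Infinitely many zeros in a compact interval accumulate, so the entire extension vanishes
  identically.\<close>

lemma entire_real_eq_0:
  assumes f: "entire_real f" and inf: "infinite {u \<in> {a..b}. f u = 0}"
  shows "f u = 0"
proof -
  obtain F where F: "F holomorphic_on UNIV" "\<And>u. F (complex_of_real u) = f u"
    using f unfolding entire_real_def by metis
  define U where "U = complex_of_real ` {u \<in> {a..b}. f u = 0}"
  have "infinite U" unfolding U_def using inf by (subst finite_image_iff) (auto simp: inj_on_def)
  moreover have "compact (complex_of_real ` {a..b})"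
    by (intro compact_continuous_image continuous_intros) auto
  moreover have "U \<subseteq> complex_of_real ` {a..b}" by (auto simp: U_def)
  ultimately obtain \<xi> where "\<xi> islimpt U"
    using Heine_Borel_imp_Bolzano_Weierstrass by blast
  then have "F (complex_of_real u) = 0"
    by (rule analytic_continuation[OF F(1), rotated 4]) (auto simp: U_def F)
  then show ?thesis by (simp add: F)
qed

lemma entire_real_finite_zeros:
  "entire_real f \<Longrightarrow> f u \<noteq> 0 \<Longrightarrow> finite {u \<in> {a..b}. f u = 0}"
  using entire_real_eq_0 by blast

text \<open>There are no zero divisors: the first factor has finitely many zeros in the unit
  interval, so the second vanishes at infinitely many points there.\<close>

lemma entire_real_mult_eq_0:
  assumes "entire_real f" "entire_real g" "\<And>u. f u * g u = 0" "f v \<noteq> 0"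
  shows "g u = 0"
proof -
  have "{u \<in> {0..1}. g u = 0} \<supseteq> {0..1} - {u \<in> {0..1}. f u = 0}" using assms(3) by auto
  moreover have "infinite ({0..1} - {u \<in> {0..1}. f u = 0})"
    using entire_real_finite_zeros[OF assms(1,4)] by (intro Diff_infinite_finite) (auto simp: infinite_Icc)
  ultimately have "infinite {u \<in> {0..1}. g u = 0}" using finite_subset by blast
  then show ?thesis by (rule entire_real_eq_0[OF assms(2)])
qed

section \<open>Orthogonality of the harmonics\<close>

lemma has_integral_cos_int:
  "((\<lambda>u. cos (real_of_int j * u)) has_integral (if j = 0 then 2 * pi else 0)) {0..2 * pi}"
proof (cases "j = 0")
  case True
  then show ?thesis using has_integral_const_real[of "1::real" 0 "2 * pi"] by simp
next
  case False
  have "((\<lambda>u. cos (real_of_int j * u)) has_integral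
      (sin (real_of_int j * (2 * pi)) / j - sin (real_of_int j * 0) / j)) {0..2 * pi}"
    by (rule fundamental_theorem_of_calculus)
      (use False in \<open>auto intro!: derivative_eq_intros simp flip: has_real_derivative_iff_has_vector_derivative\<close>)
  moreover have "sin (real_of_int j * (2 * pi)) = 0"
    using sin_int_2pin[of j] by (simp add: mult_ac)
  ultimately show ?thesis using False by simp
qed

lemma has_integral_sin_int:
  "((\<lambda>u. sin (real_of_int j * u)) has_integral 0) {0..2 * pi}"
proof (cases "j = 0")
  case False
  have "((\<lambda>u. sin (real_of_int j * u)) has_integral
      (- cos (real_of_int j * (2 * pi)) / j - (- cos (real_of_int j * 0) / j))) {0..2 * pi}"
    by (rule fundamental_theorem_of_calculus)
      (use False in \<open>auto intro!: derivative_eq_intros simp flip: has_real_derivative_iff_has_vector_derivative\<close>)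
  moreover have "cos (real_of_int j * (2 * pi)) = 1"
    using cos_int_2pin[of j] by (simp add: mult_ac)
  ultimately show ?thesis using False by simp
qed simp

lemma harmonic_pos: "harmonic k > 0"
  by (auto simp: harmonic_def card_gt_0_iff)

lemma harmonic_nonzero [simp]: "harmonic k \<noteq> 0"
  using harmonic_pos[of k] by simp

lemma harmonic_eq_iff [simp]: "harmonic k = harmonic l \<longleftrightarrow> k = l"
  by (metis harmonic_less less_irrefl linorder_neqE)

lemma has_integral_harmonics:
  "((\<lambda>u. cos (real (harmonic k) * u) * cos (real (harmonic l) * u)) has_integral (if k = l then pi else 0)) {0..2*pi}"
  "((\<lambda>u. sin (real (harmonic k) * u) * sin (real (harmonic l) * u)) has_integral (if k = l then pi else 0)) {0..2*pi}"
  "((\<lambda>u. sin (real (harmonic k) * u) * cos (real (harmonic l) * u)) has_integral 0) {0..2*pi}"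
proof -
  let ?d = "int (harmonic k) - int (harmonic l)" and ?s = "int (harmonic k) + int (harmonic l)"
  have s: "?s \<noteq> 0" using harmonic_pos[of k] by simp
  have d: "?d = 0 \<longleftrightarrow> k = l" by simp
  have e1: "(\<lambda>u. cos (real (harmonic k) * u) * cos (real (harmonic l) * u)) =
      (\<lambda>u. (1/2) * (cos (real_of_int ?d * u) + cos (real_of_int ?s * u)))"
    and e2: "(\<lambda>u. sin (real (harmonic k) * u) * sin (real (harmonic l) * u)) =
      (\<lambda>u. (1/2) * (cos (real_of_int ?d * u) - cos (real_of_int ?s * u)))"
    and e3: "(\<lambda>u. sin (real (harmonic k) * u) * cos (real (harmonic l) * u)) =
      (\<lambda>u. (1/2) * (sin (real_of_int ?s * u) + sin (real_of_int ?d * u)))"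
    by (simp_all add: fun_eq_iff cos_times_cos sin_times_sin sin_times_cos left_diff_distrib distrib_right
        add_divide_distrib diff_divide_distrib)
  show "((\<lambda>u. cos (real (harmonic k) * u) * cos (real (harmonic l) * u)) has_integral (if k = l then pi else 0)) {0..2*pi}"
    using has_integral_mult_right[OF has_integral_add[OF has_integral_cos_int[of ?d] has_integral_cos_int[of ?s]], of "1/2"] s
    unfolding e1 d by (simp split: if_splits)
  show "((\<lambda>u. sin (real (harmonic k) * u) * sin (real (harmonic l) * u)) has_integral (if k = l then pi else 0)) {0..2*pi}"
    using has_integral_mult_right[OF has_integral_diff[OF has_integral_cos_int[of ?d] has_integral_cos_int[of ?s]], of "1/2"] s
    unfolding e2 d by (simp split: if_splits)
  show "((\<lambda>u. sin (real (harmonic k) * u) * cos (real (harmonic l) * u)) has_integral 0) {0..2*pi}"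
    using has_integral_mult_right[OF has_integral_add[OF has_integral_sin_int[of ?s] has_integral_sin_int[of ?d]], of "1/2"]
    unfolding e3 by simp
qed

text \<open>Integration against each harmonic over a period isolates its coefficient: the
  frequencies are distinct, and being positive they are orthogonal to the constant, which is read
  off at 0 afterwards.\<close>

lemma harmonics_independent:
  fixes a b :: "real ^ 'q::{finite,linorder}"
  assumes eq: "\<And>u. cos_vec u \<bullet> a + sin_vec u \<bullet> b + c = 0"
  shows "a = 0" "b = 0" "c = 0"
proof -
  have H1: "((\<lambda>u. cos (real (harmonic (l::'q)) * u)) has_integral 0) {0..2*pi}" for l
    using has_integral_cos_int[of "int (harmonic l)"] harmonic_pos[of l] by simp
  have H2: "((\<lambda>u. sin (real (harmonic (l::'q)) * u)) has_integral 0) {0..2*pi}" for l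
    using has_integral_sin_int[of "int (harmonic l)"] by simp
  have eq': "(\<Sum>k\<in>UNIV. a $ k * cos (real (harmonic k) * u)) +
      (\<Sum>k\<in>UNIV. b $ k * sin (real (harmonic k) * u)) + c = 0" for u
    using eq[of u] by (simp add: inner_vec_def cos_vec_def sin_vec_def mult.commute)
  have a: "a $ l = 0" for l
  proof -
    have "((\<lambda>u. (\<Sum>k\<in>UNIV. a $ k * (cos (real (harmonic k) * u) * cos (real (harmonic l) * u))) +
        (\<Sum>k\<in>UNIV. b $ k * (sin (real (harmonic k) * u) * cos (real (harmonic l) * u))) +
        c * cos (real (harmonic l) * u)) has_integral
        ((\<Sum>k\<in>UNIV. a $ k * (if k = l then pi else 0)) + (\<Sum>k\<in>(UNIV::'q set). b $ k * 0) + c * 0)) {0..2*pi}"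
      by (intro has_integral_add has_integral_sum has_integral_mult_right has_integral_harmonics H1) auto
    moreover have "(\<Sum>k\<in>UNIV. a $ k * (cos (real (harmonic k) * u) * cos (real (harmonic l) * u))) +
        (\<Sum>k\<in>UNIV. b $ k * (sin (real (harmonic k) * u) * cos (real (harmonic l) * u))) +
        c * cos (real (harmonic l) * u) = 0" for u
      using arg_cong[OF eq'[of u], of "\<lambda>x. x * cos (real (harmonic l) * u)"]
      by (simp only: distrib_right sum_distrib_right mult.assoc mult_zero_left)
    ultimately have "(\<Sum>k\<in>UNIV. a $ k * (if k = l then pi else 0)) = 0"
      using has_integral_unique[OF _ has_integral_0] by fastforce
    then show ?thesis by (simp add: if_distrib sum.delta cong: if_cong)
  qed
  have b: "b $ l = 0" for l
  proof -
    have sc: "((\<lambda>u. cos (real (harmonic (k::'q)) * u) * sin (real (harmonic l) * u)) has_integral 0) {0..2*pi}" for k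
      using has_integral_harmonics(3)[of l k] by (simp add: mult.commute)
    have "((\<lambda>u. (\<Sum>k\<in>UNIV. a $ k * (cos (real (harmonic k) * u) * sin (real (harmonic l) * u))) +
        (\<Sum>k\<in>UNIV. b $ k * (sin (real (harmonic k) * u) * sin (real (harmonic l) * u))) +
        c * sin (real (harmonic l) * u)) has_integral
        ((\<Sum>k\<in>(UNIV::'q set). a $ k * 0) + (\<Sum>k\<in>UNIV. b $ k * (if k = l then pi else 0)) + c * 0)) {0..2*pi}"
      by (intro has_integral_add has_integral_sum has_integral_mult_right has_integral_harmonics sc H2) auto
    moreover have "(\<Sum>k\<in>UNIV. a $ k * (cos (real (harmonic k) * u) * sin (real (harmonic l) * u))) +
        (\<Sum>k\<in>UNIV. b $ k * (sin (real (harmonic k) * u) * sin (real (harmonic l) * u))) +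
        c * sin (real (harmonic l) * u) = 0" for u
      using arg_cong[OF eq'[of u], of "\<lambda>x. x * sin (real (harmonic l) * u)"]
      by (simp only: distrib_right sum_distrib_right mult.assoc mult_zero_left)
    ultimately have "(\<Sum>k\<in>UNIV. b $ k * (if k = l then pi else 0)) = 0"
      using has_integral_unique[OF _ has_integral_0] by fastforce
    then show ?thesis by (simp add: if_distrib sum.delta cong: if_cong)
  qed
  show "a = 0" "b = 0" using a b by (auto simp: vec_eq_iff)
  with eq[of 0] show "c = 0" by simp
qed

definition dcos_vec :: "real \<Rightarrow> real ^ 'q::{finite,linorder}" where
  "dcos_vec u = (\<chi> k. - (real (harmonic k) * sin (real (harmonic k) * u)))"

definition dsin_vec :: "real \<Rightarrow> real ^ 'q::{finite,linorder}" where
  "dsin_vec u = (\<chi> k. real (harmonic k) * cos (real (harmonic k) * u))"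

text \<open>Differentiation exchanges sines and cosines and multiplies by nonzero frequencies, so
  independence is inherited after rescaling the coefficients.\<close>

lemma dharmonics_independent:
  fixes a b :: "real ^ 'q::{finite,linorder}"
  assumes eq: "\<And>u. dcos_vec u \<bullet> a + dsin_vec u \<bullet> b = 0"
  shows "a = 0" "b = 0"
proof -
  have "cos_vec u \<bullet> (\<chi> k. real (harmonic k) * b $ k) + sin_vec u \<bullet> (\<chi> k. - (real (harmonic k) * a $ k)) + 0 = 0" for u
    using eq[of u] by (simp add: inner_vec_def cos_vec_def sin_vec_def dcos_vec_def dsin_vec_def mult_ac)
  from harmonics_independent(1,2)[OF this] show "a = 0" "b = 0"
    by (simp_all add: vec_eq_iff)
qed

lemma vec_eq_sum_axis: "(\<chi> k. f k) = (\<Sum>k\<in>UNIV. f k *\<^sub>R (axis k 1 :: real^'n))"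
  by (simp add: vec_eq_iff axis_def if_distrib sum.delta cong: if_cong)

lemma has_vector_derivative_cos_vec: "(cos_vec has_vector_derivative dcos_vec u) (at u)"
  and has_vector_derivative_sin_vec: "(sin_vec has_vector_derivative dsin_vec u) (at u)"
  unfolding cos_vec_def[abs_def] sin_vec_def[abs_def] dcos_vec_def dsin_vec_def vec_eq_sum_axis
  by (auto intro!: derivative_eq_intros sum.cong simp: algebra_simps)

lemma DERIV_inner_harmonics [derivative_intros]:
  "((\<lambda>u. cos_vec u \<bullet> a) has_real_derivative dcos_vec u \<bullet> a) (at u)"
  "((\<lambda>u. sin_vec u \<bullet> a) has_real_derivative dsin_vec u \<bullet> a) (at u)"
  using bounded_linear.has_vector_derivative[OF bounded_linear_inner_left has_vector_derivative_cos_vec, of a u]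
    bounded_linear.has_vector_derivative[OF bounded_linear_inner_left has_vector_derivative_sin_vec, of a u]
  by (simp_all add: has_real_derivative_iff_has_vector_derivative)

lemma entire_real_harmonics [entire_real_intros]:
  "entire_real (\<lambda>u. cos_vec u \<bullet> a)" "entire_real (\<lambda>u. sin_vec u \<bullet> a)"
  "entire_real (\<lambda>u. dcos_vec u \<bullet> a)" "entire_real (\<lambda>u. dsin_vec u \<bullet> a)"
  by (auto simp: inner_vec_def cos_vec_def sin_vec_def dcos_vec_def dsin_vec_def intro!: entire_real_intros)

section \<open>The contour in coordinates along and across the line of sight\<close>

lemma harmonics_periodic:
  "cos_vec (2 * pi) = cos_vec 0" "sin_vec (2 * pi) = sin_vec 0"
  by (simp_all add: cos_vec_def sin_vec_def vec_eq_iff)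
   (metis cos_2npi sin_2npi mult.assoc mult.commute)+

text \<open>\<open>(f1, f2)\<close> is the direction of the line of sight seen from the target. In
  this frame \<open>e\<close> and \<open>h\<close> are the coordinates of the contour along and
  across the line of sight, \<open>de\<close> and \<open>dh\<close> those of its velocity.\<close>

locale contour_frame =
  fixes m n :: "real ^ 'q::{finite,linorder}" and f1 f2 :: real
  assumes m_pos: "m $ Min UNIV > 0" and n_pos: "n $ Min UNIV > 0"
    and regular: "\<And>u. u \<in> {0..2 * pi} \<Longrightarrow> dcos_vec u \<bullet> m \<noteq> 0 \<or> dsin_vec u \<bullet> n \<noteq> 0"
    and unit: "f1\<^sup>2 + f2\<^sup>2 = 1"
begin

abbreviation "X u \<equiv> dcos_vec u \<bullet> m"
abbreviation "Y u \<equiv> dsin_vec u \<bullet> n"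

definition "e u = f1 * (cos_vec u \<bullet> m) + f2 * (sin_vec u \<bullet> n)"
definition "h u = - f2 * (cos_vec u \<bullet> m) + f1 * (sin_vec u \<bullet> n)"
definition "de u = f1 * X u + f2 * Y u"
definition "dh u = - f2 * X u + f1 * Y u"
definition "speed u = sqrt ((X u)\<^sup>2 + (Y u)\<^sup>2)"

lemma DERIV_e: "(e has_real_derivative de u) (at u)"
  and DERIV_h: "(h has_real_derivative dh u) (at u)"
  unfolding e_def[abs_def] h_def[abs_def] de_def dh_def
  by (auto intro!: derivative_eq_intros)

lemma speed_sq: "(speed u)\<^sup>2 = (X u)\<^sup>2 + (Y u)\<^sup>2"
  by (simp add: speed_def)

lemma frame_identity: "(f1 * x + f2 * y)\<^sup>2 + (- f2 * x + f1 * y)\<^sup>2 = x\<^sup>2 + y\<^sup>2"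
proof -
  have "(f1 * x + f2 * y)\<^sup>2 + (- f2 * x + f1 * y)\<^sup>2 = (f1\<^sup>2 + f2\<^sup>2) * (x\<^sup>2 + y\<^sup>2)"
    by (simp add: power2_eq_square algebra_simps)
  then show ?thesis by (simp add: unit)
qed

lemma speed_sq': "(speed u)\<^sup>2 = (de u)\<^sup>2 + (dh u)\<^sup>2"
  unfolding speed_sq de_def dh_def frame_identity ..

lemma speed_pos: "u \<in> {0..2 * pi} \<Longrightarrow> speed u > 0"
  using regular[of u] by (auto simp: speed_def sum_power2_gt_zero_iff)

lemma entire_real_frame [entire_real_intros]:
  "entire_real e" "entire_real h" "entire_real de" "entire_real dh" "entire_real (\<lambda>u. (speed u)\<^sup>2)"
  unfolding e_def[abs_def] h_def[abs_def] de_def[abs_def] dh_def[abs_def] speed_sq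
  unfolding power2_eq_square
  by (intro entire_real_intros)+

lemma m_nonzero: "m \<noteq> 0" and n_nonzero: "n \<noteq> 0"
  using m_pos n_pos by auto

lemma de_nonzero: "\<exists>u. de u \<noteq> 0"
proof (rule ccontr)
  assume "\<not> ?thesis"
  then have "dcos_vec u \<bullet> (f1 *\<^sub>R m) + dsin_vec u \<bullet> (f2 *\<^sub>R n) = 0" for u
    by (simp add: de_def)
  from dharmonics_independent[OF this] show False using m_nonzero n_nonzero unit by auto
qed

lemma dh_nonzero: "\<exists>u. dh u \<noteq> 0"
proof (rule ccontr)
  assume "\<not> ?thesis"
  then have "dcos_vec u \<bullet> (- f2 *\<^sub>R m) + dsin_vec u \<bullet> (f1 *\<^sub>R n) = 0" for u
    by (simp add: dh_def)
  from dharmonics_independent[OF this] show False using m_nonzero n_nonzero unit by auto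
qed

lemma finite_dh_zeros: "finite {u \<in> {0..2 * pi}. dh u = 0}"
  using dh_nonzero entire_real_finite_zeros entire_real_frame by blast

text \<open>The limiting sine of the aspect angle is \<open>- dh u / speed u\<close>, so this says
  that part of the contour is illuminated. If \<open>dh\<close> were nonnegative, the periodic
  function \<open>h\<close> would be monotone with equal end values, hence constant, whereas
  \<open>dh\<close> is not identically zero.\<close>

lemma dh_negative: "\<exists>u \<in> {0<..<2 * pi}. dh u < 0"
proof (rule ccontr)
  assume neg: "\<not> ?thesis"
  have cont: "continuous_on S dh" for S
    unfolding dh_def[abs_def] inner_vec_def dcos_vec_def dsin_vec_def by (auto intro!: continuous_intros)
  have "infinite ({0<..<2 * pi} - {u \<in> {0..2 * pi}. dh u = 0})"
    using finite_dh_zeros by (intro Diff_infinite_finite) (auto simp: infinite_Ioo)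
  then have "{0<..<2 * pi} - {u \<in> {0..2 * pi}. dh u = 0} \<noteq> {}"
    using finite.emptyI by metis
  then obtain v where v: "v \<in> {0<..<2 * pi}" "dh v \<noteq> 0" by force
  have mono: "h a \<le> h b" if "0 \<le> a" "a \<le> b" "b \<le> 2 * pi" for a b
  proof (rule DERIV_nonneg_imp_increasing_open[OF that(2)])
    fix x assume "a < x" "x < b"
    then show "\<exists>y. (h has_real_derivative y) (at x) \<and> 0 \<le> y"
      using neg that by (intro exI[of _ "dh x"] conjI DERIV_h) (auto simp: not_less)
  next
    show "continuous_on {a..b} h" using DERIV_h by (meson DERIV_continuous_on has_field_derivative_at_within)
  qed
  have "h (2 * pi) = h 0" by (simp add: h_def harmonics_periodic)
  then have const: "h u = h 0" if "u \<in> {0..2 * pi}" for u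
    using mono[of 0 u] mono[of u "2 * pi"] that by auto
  have "dh v = 0"
  proof (rule DERIV_local_const[OF DERIV_h])
    show "0 < min v (2 * pi - v)" using v by auto
    show "\<forall>y. \<bar>v - y\<bar> < min v (2 * pi - v) \<longrightarrow> h v = h y"
    proof (intro allI impI)
      fix y assume "\<bar>v - y\<bar> < min v (2 * pi - v)"
      then have "y \<in> {0..2 * pi}" "v \<in> {0..2 * pi}" using v(1) by auto
      then show "h v = h y" using const[of v] const[of y] by metis
    qed
  qed
  with v show False by simp
qed

text \<open>Rolle's theorem for the periodic function \<open>e\<close>. At such a point the velocity
  is purely transverse to the line of sight.\<close>

lemma de_zero: "\<exists>u \<in> {0..2 * pi}. de u = 0"
proof -
  have "\<exists>z. 0 < z \<and> z < 2 * pi \<and> (e has_real_derivative 0) (at z)"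
  proof (rule Rolle)
    show "e 0 = e (2 * pi)" by (simp add: e_def harmonics_periodic)
    show "continuous_on {0..2 * pi} e" using DERIV_e by (meson DERIV_continuous_on has_field_derivative_at_within)
  qed (use DERIV_e in \<open>auto simp: real_differentiable_def\<close>)
  then show ?thesis using DERIV_e DERIV_unique by (metis atLeastAtMost_iff less_eq_real_def)
qed

text \<open>The deformation \<open>(\<zeta>1, \<zeta>2)\<close> of the velocity, corrected by the infinitesimal rotation \<open>y\<close>, is orthogonal
  to the two vectors \<open>(f1, f2)\<close> and \<open>(Y, - X)\<close>, which are independent wherever \<open>de\<close> does not vanish.\<close>

lemma rigidity:
  fixes z z' :: "real ^ 'q::{finite,linorder}"
  assumes inf: "infinite T" and T: "T \<subseteq> {0..2 * pi}"
    and range_eq: "\<And>u. u \<in> T \<Longrightarrow> x + h u * y + (f1 * (cos_vec u \<bullet> z) + f2 * (sin_vec u \<bullet> z')) = 0"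
    and aspect_eq: "\<And>u. u \<in> T \<Longrightarrow>
      de u * ((speed u)\<^sup>2 * y + Y u * (dcos_vec u \<bullet> z) - X u * (dsin_vec u \<bullet> z')) + \<kappa> * dh u * (speed u)\<^sup>2 = 0"
  shows "x = 0" "y = 0" "z = 0" "z' = 0"
proof -
  define \<zeta>1 \<zeta>2 where "\<zeta>1 u = dcos_vec u \<bullet> z" and "\<zeta>2 u = dsin_vec u \<bullet> z'" for u
  define R where "R u = x + h u * y + (f1 * (cos_vec u \<bullet> z) + f2 * (sin_vec u \<bullet> z'))" for u
  define G where "G u = (speed u)\<^sup>2 * y + Y u * \<zeta>1 u - X u * \<zeta>2 u" for u
  define S where "S u = de u * G u + \<kappa> * dh u * (speed u)\<^sup>2" for u
  \<comment> \<open>The hypotheses are known only on the infinite set \<open>T\<close>; the identity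
    theorem removes this restriction.\<close>
  have ext: "f u = 0" if "entire_real f" "\<And>u. u \<in> T \<Longrightarrow> f u = 0" for f u
  proof (rule entire_real_eq_0[OF that(1)])
    have "T \<subseteq> {u \<in> {0..2 * pi}. f u = 0}" using T that(2) by auto
    then show "infinite {u \<in> {0..2 * pi}. f u = 0}" using inf finite_subset by blast
  qed
  have R: "R u = 0" for u
    by (rule ext) (use range_eq in \<open>auto simp: R_def[abs_def] intro!: entire_real_intros\<close>)
  have S: "S u = 0" for u
    by (rule ext) (use aspect_eq in \<open>auto simp: S_def[abs_def] G_def \<zeta>1_def \<zeta>2_def intro!: entire_real_intros\<close>)
  have dR: "dh u * y + (f1 * \<zeta>1 u + f2 * \<zeta>2 u) = 0" for u
  proof (rule DERIV_unique)
    show "(R has_real_derivative (dh u * y + (f1 * \<zeta>1 u + f2 * \<zeta>2 u))) (at u)"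
      unfolding R_def[abs_def] \<zeta>1_def \<zeta>2_def by (auto intro!: derivative_eq_intros DERIV_h)
    have "R = (\<lambda>u. 0)" using R by auto
    then show "(R has_real_derivative 0) (at u)" by simp
  qed
  obtain u0 where u0: "u0 \<in> {0..2 * pi}" "de u0 = 0" using de_zero by blast
  \<comment> \<open>At \<open>u0\<close> the aspect identity loses its first term and
    \<open>(speed u0)\<^sup>2\<close> becomes \<open>(dh u0)\<^sup>2\<close>, which leaves \<kappa>
    times the cube of a nonzero number.\<close>
  have "\<kappa> * dh u0 * (dh u0)\<^sup>2 = 0"
    using S[of u0] u0(2) speed_sq'[of u0] by (simp add: S_def)
  moreover have "dh u0 \<noteq> 0" using speed_pos[OF u0(1)] speed_sq'[of u0] u0(2) by auto
  ultimately have \<kappa>: "\<kappa> = 0" by simp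
  have deG: "de u * G u = 0" for u using S[of u] \<kappa> by (simp add: S_def)
  have G: "G u = Y u * (\<zeta>1 u + y * Y u) - X u * (\<zeta>2 u - y * X u)" for u
    unfolding G_def speed_sq by algebra
  have dR': "f1 * (\<zeta>1 u + y * Y u) + f2 * (\<zeta>2 u - y * X u) = 0" for u
    using dR[of u] by (simp add: dh_def algebra_simps)
  \<comment> \<open>Cramer's rule: the vector
    \<open>(\<zeta>1 u + y * Y u, \<zeta>2 u - y * X u)\<close> has inner product 0 with
    \<open>(f1, f2)\<close> and \<open>G u\<close> with \<open>(Y u, - X u)\<close>, and these two
    vectors have determinant \<open>- de u\<close>.\<close>
  have "de u * (\<zeta>1 u + y * Y u) = X u * (f1 * (\<zeta>1 u + y * Y u) + f2 * (\<zeta>2 u - y * X u)) + f2 * G u" for u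
    unfolding G by (simp add: de_def algebra_simps)
  then have w1: "de u * (\<zeta>1 u + y * Y u) = f2 * G u" for u using dR'[of u] by simp
  have "de u * (\<zeta>2 u - y * X u) = Y u * (f1 * (\<zeta>1 u + y * Y u) + f2 * (\<zeta>2 u - y * X u)) - f1 * G u" for u
    unfolding G by (simp add: de_def algebra_simps)
  then have w2: "de u * (\<zeta>2 u - y * X u) = - f1 * G u" for u using dR'[of u] by simp
  obtain v where v: "de v \<noteq> 0" using de_nonzero by blast
  \<comment> \<open>A second factor \<open>de u\<close> brings in \<open>de u * G u = 0\<close>; it
    cancels afterwards because \<open>de\<close> is not identically zero.\<close>
  have 1: "\<zeta>1 u + y * Y u = 0" for u
  proof (rule entire_real_mult_eq_0[of "\<lambda>u. (de u)\<^sup>2" "\<lambda>u. \<zeta>1 u + y * Y u"])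
    show "entire_real (\<lambda>u. (de u)\<^sup>2)" "entire_real (\<lambda>u. \<zeta>1 u + y * Y u)"
      unfolding \<zeta>1_def power2_eq_square by (intro entire_real_intros)+
    show "(de u)\<^sup>2 * (\<zeta>1 u + y * Y u) = 0" for u
    proof -
      have "(de u)\<^sup>2 * (\<zeta>1 u + y * Y u) = de u * (de u * (\<zeta>1 u + y * Y u))"
        by (simp only: power2_eq_square mult.assoc)
      also have "\<dots> = f2 * (de u * G u)" unfolding w1 by (simp only: mult.left_commute)
      finally show ?thesis unfolding deG by simp
    qed
    show "(de v)\<^sup>2 \<noteq> 0" using v by simp
  qed
  have 2: "\<zeta>2 u - y * X u = 0" for u
  proof (rule entire_real_mult_eq_0[of "\<lambda>u. (de u)\<^sup>2" "\<lambda>u. \<zeta>2 u - y * X u"])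
    show "entire_real (\<lambda>u. (de u)\<^sup>2)" "entire_real (\<lambda>u. \<zeta>2 u - y * X u)"
      unfolding \<zeta>2_def power2_eq_square by (intro entire_real_intros)+
    show "(de u)\<^sup>2 * (\<zeta>2 u - y * X u) = 0" for u
    proof -
      have "(de u)\<^sup>2 * (\<zeta>2 u - y * X u) = de u * (de u * (\<zeta>2 u - y * X u))"
        by (simp only: power2_eq_square mult.assoc)
      also have "\<dots> = - f1 * (de u * G u)" unfolding w2 by (simp only: mult.left_commute)
      finally show ?thesis unfolding deG by simp
    qed
    show "(de v)\<^sup>2 \<noteq> 0" using v by simp
  qed
  \<comment> \<open>Here \<open>dcos_vec u\<close> consists of sines and \<open>dsin_vec u\<close>
    of cosines, so the two terms vanish separately.\<close>
  have "dcos_vec u \<bullet> z + dsin_vec u \<bullet> (y *\<^sub>R n) = 0" for u using 1[of u] by (simp add: \<zeta>1_def)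
  from dharmonics_independent[OF this] n_nonzero show y: "y = 0" and z: "z = 0" by auto
  have "dcos_vec u \<bullet> (0 :: (real,'q) vec) + dsin_vec u \<bullet> z' = 0" for u using 2[of u] y by (simp add: \<zeta>2_def)
  from dharmonics_independent(2)[OF this] show z': "z' = 0" .
  show "x = 0" using R[of 0] y z z' by (simp add: R_def)
qed

end

section \<open>Gradients\<close>

lemma linear_functional_axis:
  fixes A :: "real^'i \<Rightarrow> real"
  assumes "linear A"
  shows "A v = v \<bullet> (\<chi> i. A (axis i 1))"
proof -
  have "A v = A (\<Sum>i\<in>UNIV. v $ i *\<^sub>R axis i 1)" by (simp flip: vec_eq_sum_axis)
  also have "\<dots> = (\<Sum>i\<in>UNIV. v $ i * A (axis i 1))"
    by (simp add: linear_sum[OF assms] linear_cmul[OF assms])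
  finally show ?thesis by (simp add: inner_vec_def)
qed

lemma GDERIV_axis:
  fixes f :: "real^'i \<Rightarrow> real"
  assumes "(f has_derivative A) (at x)"
  shows "GDERIV f x :> (\<chi> i. A (axis i 1))"
  unfolding gderiv_def using assms linear_functional_axis[OF has_derivative_linear[OF assms]]
  by (metis (no_types, lifting) ext)

lemma gradient_eqI:
  fixes f :: "'v::real_inner \<Rightarrow> real"
  assumes "GDERIV f x :> D" shows "gradient f x = D"
  unfolding gradient_def
proof (rule the_equality)
  show "GDERIV f x :> D" by (rule assms)
  fix D' assume "GDERIV f x :> D'"
  then have "(\<lambda>v. v \<bullet> D') = (\<lambda>v. v \<bullet> D)"
    using assms unfolding gderiv_def by (rule has_derivative_unique)
  then have "(D' - D) \<bullet> D' = (D' - D) \<bullet> D" by meson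
  then have "(D' - D) \<bullet> (D' - D) = 0" by (simp add: inner_diff_right)
  then show "D' = D" by simp
qed

lemma norm_2: "norm (x :: real^2) = sqrt ((x $ 1)\<^sup>2 + (x $ 2)\<^sup>2)"
  by (simp add: norm_eq_sqrt_inner inner_vec_def sum_2 power2_eq_square)

lemma gradient_norm_nth:
  fixes f :: "real^'i \<Rightarrow> real^2"
  assumes A: "((\<lambda>y. f y $ 1) has_derivative A) (at x)" and B: "((\<lambda>y. f y $ 2) has_derivative B) (at x)"
    and nz: "f x \<noteq> 0"
  shows "gradient (\<lambda>y. norm (f y)) x $ i
    = (f x $ 1 * A (axis i 1) + f x $ 2 * B (axis i 1)) / norm (f x)"
proof -
  have pos: "0 < (f x $ 1)\<^sup>2 + (f x $ 2)\<^sup>2"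
    using nz by (auto simp: vec_eq_iff forall_2 sum_power2_gt_zero_iff)
  have cancel: "inverse s / 2 * (2 * q) = q / s" for s q :: real
    by (cases "s = 0") (auto simp: field_simps)
  define S where "S y = (f y $ 1)\<^sup>2 + (f y $ 2)\<^sup>2" for y
  have "(S has_derivative (\<lambda>v. 2 * (f x $ 1 * A v + f x $ 2 * B v))) (at x)"
    unfolding S_def[abs_def] by (auto intro!: derivative_eq_intros A B)
  moreover have "(sqrt has_derivative (*) (inverse (sqrt (S x)) / 2)) (at (S x))"
    using DERIV_real_sqrt[of "S x"] pos by (simp add: has_field_derivative_def S_def)
  ultimately have "((\<lambda>y. sqrt (S y)) has_derivative
      (\<lambda>v. inverse (sqrt (S x)) / 2 * (2 * (f x $ 1 * A v + f x $ 2 * B v)))) (at x)"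
    by (rule has_derivative_compose)
  then have "((\<lambda>y. norm (f y)) has_derivative
      (\<lambda>v. (f x $ 1 * A v + f x $ 2 * B v) / norm (f x))) (at x)"
    unfolding norm_2 S_def[symmetric] cancel .
  from gradient_eqI[OF GDERIV_axis[OF this]] show ?thesis by simp
qed

text \<open>Near \<open>x\<close>, the angle of \<open>f y\<close> relative to \<open>f x\<close> is the arctangent of the quotient of their
  cross and inner products.\<close>

lemma angle_gradient_nth:
  fixes f :: "real^'i \<Rightarrow> real^2"
  assumes A: "((\<lambda>y. f y $ 1) has_derivative A) (at x)" and B: "((\<lambda>y. f y $ 2) has_derivative B) (at x)"
    and nz: "f x \<noteq> 0"
  shows "angle_gradient f x $ i
    = (f x $ 1 * B (axis i 1) - f x $ 2 * A (axis i 1)) / (norm (f x))\<^sup>2"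
proof -
  define a b r where "a = f x $ 1" and "b = f x $ 2" and "r = norm (f x)"
  have r: "r > 0" "r\<^sup>2 = a\<^sup>2 + b\<^sup>2" using nz by (simp_all add: r_def a_def b_def) (simp add: norm_2)
  have "(a / r)\<^sup>2 + (b / r)\<^sup>2 = 1" 
    using r(1) unfolding power_divide add_divide_distrib[symmetric] r(2)[symmetric] by simp
  \<comment> \<open>\<theta>0 is an angle of \<open>f x\<close>. The branch adds to it the angle
    from \<open>f x\<close> to \<open>f y\<close>, whose cosine and sine are proportional to
    \<open>p y\<close> and \<open>q y\<close>.\<close>
  then obtain \<theta>0 where \<theta>0: "a / r = cos \<theta>0" "b / r = sin \<theta>0"
    using sincos_total_2pi by metis
  define p q where "p y = a * f y $ 1 + b * f y $ 2" and "q y = a * f y $ 2 - b * f y $ 1" for y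
  define \<theta> where "\<theta> y = \<theta>0 + arctan (q y / p y)" for y
  have px: "p x = r\<^sup>2" and qx: "q x = 0" by (simp_all add: p_def q_def a_def b_def r norm_2 r_def power2_eq_square)
  have dp: "(p has_derivative (\<lambda>v. a * A v + b * B v)) (at x)"
    and dq: "(q has_derivative (\<lambda>v. a * B v - b * A v)) (at x)"
    unfolding p_def[abs_def] q_def[abs_def] by (auto intro!: derivative_eq_intros A B)
  have "(p \<longlongrightarrow> p x) (nhds x)"
    using has_derivative_continuous[OF dp] by (simp add: isCont_def tendsto_at_iff_tendsto_nhds)
  \<comment> \<open>A positive inner product keeps the angle from \<open>f x\<close> to
    \<open>f y\<close> below a right angle, where the arctangent recovers it.\<close>
  then have ev: "\<forall>\<^sub>F y in nhds x. p y > 0"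
    by (rule order_tendstoD) (use r(1) in \<open>simp add: px\<close>)
  show ?thesis
  proof (subst angle_gradient_eqI)
    show "\<forall>\<^sub>F y in nhds x. f y \<noteq> 0" using ev by eventually_elim (auto simp: p_def)
    show "\<forall>\<^sub>F y in nhds x. f y = norm (f y) *\<^sub>R vector [cos (\<theta> y), sin (\<theta> y)]"
      using ev
    proof eventually_elim
      case (elim y)
      define t where "t = norm (f y)"
      have "t > 0" using elim by (auto simp: t_def p_def)
      have t2: "t\<^sup>2 = (f y $ 1)\<^sup>2 + (f y $ 2)\<^sup>2" by (simp add: t_def norm_2)
      have "(p y)\<^sup>2 + (q y)\<^sup>2 = (r * t)\<^sup>2"
        by (simp add: p_def q_def power_mult_distrib r t2) (simp add: power2_eq_square algebra_simps)
      then have "1 + (q y / p y)\<^sup>2 = (r * t / p y)\<^sup>2"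
        using elim by (simp add: field_simps)
      then have s: "sqrt (1 + (q y / p y)\<^sup>2) = r * t / p y"
        using elim r \<open>t > 0\<close> by (simp add: real_sqrt_unique)
      have c: "cos (arctan (q y / p y)) = p y / (r * t)" "sin (arctan (q y / p y)) = q y / (r * t)"
        unfolding cos_arctan sin_arctan s using elim r \<open>t > 0\<close> by simp_all
      have "t * cos (\<theta> y) = (a * p y - b * q y) / r\<^sup>2" "t * sin (\<theta> y) = (b * p y + a * q y) / r\<^sup>2"
        unfolding \<theta>_def cos_add sin_add c \<theta>0[symmetric] using r(1) \<open>t > 0\<close>
        by (simp_all add: power2_eq_square field_simps)
      moreover have "a * p y - b * q y = r\<^sup>2 * f y $ 1" "b * p y + a * q y = r\<^sup>2 * f y $ 2"
        unfolding r(2) p_def q_def by algebra+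
      ultimately have "t * cos (\<theta> y) = f y $ 1" "t * sin (\<theta> y) = f y $ 2" using r by auto
      then show ?case by (simp add: vec_eq_iff forall_2 t_def)
    qed
    \<comment> \<open>Since \<open>q x = 0\<close> and \<open>p x = r\<^sup>2\<close>, the
      derivative of \<open>p\<close> drops out and only that of \<open>q\<close>, divided by
      \<open>r\<^sup>2\<close>, remains.\<close>
    have "(\<theta> has_derivative (\<lambda>v. (a * B v - b * A v) / r\<^sup>2)) (at x)"
      unfolding \<theta>_def[abs_def]
      by (rule derivative_eq_intros dp dq refl)+ (use r in \<open>auto simp: px qx power2_eq_square\<close>)
    from GDERIV_axis[OF this] show "GDERIV \<theta> x :> (\<chi> i. (a * B (axis i 1) - b * A (axis i 1)) / r\<^sup>2)" .
  qed (simp add: a_def b_def r_def)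
qed

text \<open>One formula for position and velocity: \<open>t = 1\<close> with the harmonics gives the
  coordinates of \<open>pos\<close>, and \<open>t = 0\<close> with the differentiated harmonics
  those of its derivative in \<open>u\<close>, from which the centre has dropped out.\<close>

definition fam1 :: "real \<Rightarrow> real^'q::finite \<Rightarrow> real^'q::finite \<Rightarrow> 'q::finite param \<Rightarrow> real" where
  "fam1 t c s \<gamma> = t * (\<gamma> $ Inl 1 * cos (\<gamma> $ Inl 2)) + cos (\<gamma> $ Inl 3) * (c \<bullet> coef_m \<gamma>) - sin (\<gamma> $ Inl 3) * (s \<bullet> coef_n \<gamma>)"

definition fam2 :: "real \<Rightarrow> real^'q::finite \<Rightarrow> real^'q::finite \<Rightarrow> 'q::finite param \<Rightarrow> real" where
  "fam2 t c s \<gamma> = t * (\<gamma> $ Inl 1 * sin (\<gamma> $ Inl 2)) + sin (\<gamma> $ Inl 3) * (c \<bullet> coef_m \<gamma>) + cos (\<gamma> $ Inl 3) * (s \<bullet> coef_n \<gamma>)"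

lemma dot_harmonics: "dot cos_vec u = dcos_vec u" "dot sin_vec u = dsin_vec u"
  by (intro vector_derivative_at has_vector_derivative_cos_vec has_vector_derivative_sin_vec)+

lemma vector_2_eq: "(vector [a, b] :: real^2) = a *\<^sub>R axis 1 1 + b *\<^sub>R axis 2 1"
  by (simp add: vec_eq_iff forall_2 axis_def)

lemma has_vector_derivative_vector_2:
  assumes "(f has_real_derivative a) (at u)" "(g has_real_derivative b) (at u)"
  shows "((\<lambda>u. vector [f u, g u] :: real^2) has_vector_derivative vector [a, b]) (at u)"
  unfolding vector_2_eq using assms
  by (auto intro!: derivative_eq_intros simp: has_real_derivative_iff_has_vector_derivative)

lemma has_vector_derivative_contour:
  "(contour m n has_vector_derivative vector [dcos_vec u \<bullet> m, dsin_vec u \<bullet> n]) (at u)"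
  unfolding contour_def[abs_def] by (intro has_vector_derivative_vector_2 DERIV_inner_harmonics)

lemma pos_eq: "pos \<gamma> u = vector [fam1 1 (cos_vec u) (sin_vec u) \<gamma>, fam2 1 (cos_vec u) (sin_vec u) \<gamma>]"
  by (simp add: vec_eq_iff forall_2 pos_def centre_def R_mat_def rot_def rho_def contour_def
      matrix_vector_mult_def sum_2 fam1_def fam2_def)

lemma dot_pos_eq: "dot (pos \<gamma>) u = vector [fam1 0 (dcos_vec u) (dsin_vec u) \<gamma>, fam2 0 (dcos_vec u) (dsin_vec u) \<gamma>]"
proof (rule vector_derivative_at)
  show "(pos \<gamma> has_vector_derivative vector [fam1 0 (dcos_vec u) (dsin_vec u) \<gamma>, fam2 0 (dcos_vec u) (dsin_vec u) \<gamma>]) (at u)"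
    unfolding pos_eq[abs_def] fam1_def fam2_def
    by (intro has_vector_derivative_vector_2) (auto intro!: derivative_eq_intros)
qed

lemma coef_linear: "linear coef_m" "linear coef_n"
  by (auto intro!: linearI simp: coef_m_def coef_n_def vec_eq_iff)

lemma has_derivative_coef [derivative_intros]:
  "((\<lambda>\<gamma>. c \<bullet> coef_m \<gamma>) has_derivative (\<lambda>v. c \<bullet> coef_m v)) F"
  "((\<lambda>\<gamma>. c \<bullet> coef_n \<gamma>) has_derivative (\<lambda>v. c \<bullet> coef_n v)) F"
  by (intro has_derivative_inner_right bounded_linear_imp_has_derivative linear_conv_bounded_linear[THEN iffD1] coef_linear)+

lemma has_derivative_nth_trig:
  fixes \<gamma> :: "real^'n"
  shows
  "((\<lambda>\<gamma>. \<gamma> $ i) has_derivative (\<lambda>v. v $ i)) (at \<gamma>)"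
  "((\<lambda>\<gamma>. cos (\<gamma> $ i)) has_derivative (\<lambda>v. - sin (\<gamma> $ i) * v $ i)) (at \<gamma>)"
  "((\<lambda>\<gamma>. sin (\<gamma> $ i)) has_derivative (\<lambda>v. cos (\<gamma> $ i) * v $ i)) (at \<gamma>)"
proof -
  show N: "((\<lambda>\<gamma>. \<gamma> $ i) has_derivative (\<lambda>v. v $ i)) (at \<gamma>)"
    by (rule bounded_linear_imp_has_derivative[OF bounded_linear_vec_nth])
  show "((\<lambda>\<gamma>. cos (\<gamma> $ i)) has_derivative (\<lambda>v. - sin (\<gamma> $ i) * v $ i)) (at \<gamma>)"
    by (auto intro!: derivative_eq_intros N)
  show "((\<lambda>\<gamma>. sin (\<gamma> $ i)) has_derivative (\<lambda>v. cos (\<gamma> $ i) * v $ i)) (at \<gamma>)"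
    by (auto intro!: derivative_eq_intros N)
qed

lemma has_derivative_fam1:
  "(fam1 t c s has_derivative (\<lambda>v. t * (\<gamma> $ Inl 1 * (- sin (\<gamma> $ Inl 2) * v $ Inl 2) + v $ Inl 1 * cos (\<gamma> $ Inl 2))
     + (cos (\<gamma> $ Inl 3) * (c \<bullet> coef_m v) + - sin (\<gamma> $ Inl 3) * v $ Inl 3 * (c \<bullet> coef_m \<gamma>))
     - (sin (\<gamma> $ Inl 3) * (s \<bullet> coef_n v) + cos (\<gamma> $ Inl 3) * v $ Inl 3 * (s \<bullet> coef_n \<gamma>)))) (at \<gamma>)"
  unfolding fam1_def[abs_def]
  by (rule has_derivative_diff[OF has_derivative_add[OF
        has_derivative_mult_right[OF has_derivative_mult[OF has_derivative_nth_trig(1) has_derivative_nth_trig(2)]]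
        has_derivative_mult[OF has_derivative_nth_trig(2) has_derivative_coef(1)]]
        has_derivative_mult[OF has_derivative_nth_trig(3) has_derivative_coef(2)]])

lemma has_derivative_fam2:
  "(fam2 t c s has_derivative (\<lambda>v. t * (\<gamma> $ Inl 1 * (cos (\<gamma> $ Inl 2) * v $ Inl 2) + v $ Inl 1 * sin (\<gamma> $ Inl 2))
     + (sin (\<gamma> $ Inl 3) * (c \<bullet> coef_m v) + cos (\<gamma> $ Inl 3) * v $ Inl 3 * (c \<bullet> coef_m \<gamma>))
     + (cos (\<gamma> $ Inl 3) * (s \<bullet> coef_n v) + - sin (\<gamma> $ Inl 3) * v $ Inl 3 * (s \<bullet> coef_n \<gamma>)))) (at \<gamma>)"
  unfolding fam2_def[abs_def]
  by (rule has_derivative_add[OF has_derivative_add[OF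
        has_derivative_mult_right[OF has_derivative_mult[OF has_derivative_nth_trig(1) has_derivative_nth_trig(3)]]
        has_derivative_mult[OF has_derivative_nth_trig(3) has_derivative_coef(1)]]
        has_derivative_mult[OF has_derivative_nth_trig(2) has_derivative_coef(2)]])

lemma coef_axis [simp]:
  "coef_m (axis (Inl a) 1) = 0" "coef_n (axis (Inl a) 1) = 0"
  "coef_m (axis (Inr (Inl k)) 1) = axis k 1" "coef_n (axis (Inr (Inl k)) 1) = 0"
  "coef_m (axis (Inr (Inr k)) 1) = 0" "coef_n (axis (Inr (Inr k)) 1) = axis k 1"
  by (auto simp: coef_m_def coef_n_def axis_def vec_eq_iff)

lemma params_nth [simp]:
  "params d \<phi>0 \<psi> m n $ Inl 1 = d" "params d \<phi>0 \<psi> m n $ Inl 2 = \<phi>0" "params d \<phi>0 \<psi> m n $ Inl 3 = \<psi>"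
  "coef_m (params d \<phi>0 \<psi> m n) = m" "coef_n (params d \<phi>0 \<psi> m n) = n"
  by (simp_all add: params_def coef_m_def coef_n_def)

lemma polar_angle:
  "norm x * cos (polar_angle x) = x $ 1" "norm x * sin (polar_angle x) = x $ 2"
proof -
  let ?z = "Complex (x $ 1) (x $ 2)"
  have "norm x = cmod ?z" by (simp add: norm_2 cmod_def)
  moreover have "Re (rcis (cmod ?z) (Arg ?z)) = x $ 1" "Im (rcis (cmod ?z) (Arg ?z)) = x $ 2"
    by (simp_all only: rcis_cmod_Arg complex.sel)
  ultimately show "norm x * cos (polar_angle x) = x $ 1" "norm x * sin (polar_angle x) = x $ 2"
    by (simp_all add: polar_angle_def)
qed

section \<open>Gradients in the frame of the bearing\<close>

lemma exhaust_3_cases: "(a = 1 \<Longrightarrow> P) \<Longrightarrow> (a = 2 \<Longrightarrow> P) \<Longrightarrow> (a = 3 \<Longrightarrow> P) \<Longrightarrow> P" for a :: 3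
  using exhaust_3 by blast

locale target = contour_frame m n "cos (\<phi>0 - \<psi>)" "sin (\<phi>0 - \<psi>)"
  for m n :: "real ^ 'q::{finite,linorder}" and \<phi>0 \<psi> :: real
begin

abbreviation "f1 \<equiv> cos (\<phi>0 - \<psi>)"
abbreviation "f2 \<equiv> sin (\<phi>0 - \<psi>)"
abbreviation "\<gamma> d \<equiv> params d \<phi>0 \<psi> m n"

text \<open>The vector with coordinate \<open>x\<close> along the bearing and \<open>y\<close>
  across it, in the standard basis. The frame being orthonormal, inner and cross products can be
  computed from these coordinates.\<close>

definition frame :: "real \<Rightarrow> real \<Rightarrow> real^2" where
  "frame x y = vector [x * cos \<phi>0 - y * sin \<phi>0, x * sin \<phi>0 + y * cos \<phi>0]"

lemma cs: "cos \<phi>0 * cos \<phi>0 + sin \<phi>0 * sin \<phi>0 = 1"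
  using sin_cos_squared_add[of \<phi>0] by (simp add: power2_eq_square)

lemma frame_inner: "frame x y $ 1 * frame x' y' $ 1 + frame x y $ 2 * frame x' y' $ 2 = x * x' + y * y'"
  unfolding frame_def vector_2 using cs by algebra

lemma frame_cross: "frame x y $ 1 * frame x' y' $ 2 - frame x y $ 2 * frame x' y' $ 1 = x * y' - y * x'"
  unfolding frame_def vector_2 using cs by algebra

lemma norm_frame: "norm (frame x y) = sqrt (x\<^sup>2 + y\<^sup>2)"
  using frame_inner[of x y x y] by (simp add: norm_2 power2_eq_square)

definition "coord1 t c s = t + f1 * (c \<bullet> m) + f2 * (s \<bullet> n)"
definition "coord2 c s = - f2 * (c \<bullet> m) + f1 * (s \<bullet> n)"

text \<open>\<open>dcoord1\<close> and \<open>dcoord2\<close> are the partial derivatives with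
  respect to parameter \<open>i\<close>, resolved along and across the bearing with the frame held
  fixed. The bearing moves the centre across by \<open>t * d\<close>; the orientation contributes
  the contour turned by a right angle.\<close>

definition dcoord1 :: "real \<Rightarrow> (real, 'q) vec \<Rightarrow> (real, 'q) vec \<Rightarrow> 3 + 'q + 'q \<Rightarrow> real" where
  "dcoord1 t c s i = (case i of Inl j \<Rightarrow> if j = 1 then t else if j = 2 then 0 else - coord2 c s
     | Inr (Inl k) \<Rightarrow> f1 * c $ k | Inr (Inr k) \<Rightarrow> f2 * s $ k)"

definition dcoord2 :: "real \<Rightarrow> real \<Rightarrow> (real, 'q) vec \<Rightarrow> (real, 'q) vec \<Rightarrow> 3 + 'q + 'q \<Rightarrow> real" where
  "dcoord2 t d c s i = (case i of Inl j \<Rightarrow> if j = 1 then 0 else if j = 2 then t * d else coord1 0 c s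
     | Inr (Inl k) \<Rightarrow> - f2 * c $ k | Inr (Inr k) \<Rightarrow> f1 * s $ k)"

lemma cos_psi: "cos \<psi> = cos \<phi>0 * f1 + sin \<phi>0 * f2" and sin_psi: "sin \<psi> = sin \<phi>0 * f1 - cos \<phi>0 * f2"
  using cos_diff[of \<phi>0 "\<phi>0 - \<psi>"] sin_diff[of \<phi>0 "\<phi>0 - \<psi>"] by simp_all

lemma fam_frame: "vector [fam1 t c s (\<gamma> d), fam2 t c s (\<gamma> d)] = frame (coord1 (t * d) c s) (coord2 c s)"
  by (simp add: fam1_def fam2_def frame_def vec_eq_iff forall_2 coord1_def coord2_def)
    (simp add: cos_psi sin_psi algebra_simps)

lemma has_derivative_fam:
  obtains A B where "(fam1 t c s has_derivative A) (at (\<gamma> d))" "(fam2 t c s has_derivative B) (at (\<gamma> d))"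
    "\<And>i. A (axis i 1) = frame (dcoord1 t c s i) (dcoord2 t d c s i) $ 1"
    "\<And>i. B (axis i 1) = frame (dcoord1 t c s i) (dcoord2 t d c s i) $ 2"
proof -
  have inl: "axis (Inl a :: 3 + 'q + 'q) (1::real) $ Inl b = (if a = b then 1 else 0)"
    "axis (Inr k :: 3 + 'q + 'q) (1::real) $ Inl b = 0" for a b k
    by (auto simp: axis_def)
  have ax: "c \<bullet> axis k (1::real) = c $ k" for c :: "(real, 'q) vec" and k
    by (simp add: inner_axis)
  show thesis
  proof (rule that[OF has_derivative_fam1 has_derivative_fam2])
    fix i :: "3 + 'q + 'q"
    show "t * (\<gamma> d $ Inl 1 * (- sin (\<gamma> d $ Inl 2) * axis i 1 $ Inl 2) + axis i 1 $ Inl 1 * cos (\<gamma> d $ Inl 2))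
     + (cos (\<gamma> d $ Inl 3) * (c \<bullet> coef_m (axis i 1)) + - sin (\<gamma> d $ Inl 3) * axis i 1 $ Inl 3 * (c \<bullet> coef_m (\<gamma> d)))
     - (sin (\<gamma> d $ Inl 3) * (s \<bullet> coef_n (axis i 1)) + cos (\<gamma> d $ Inl 3) * axis i 1 $ Inl 3 * (s \<bullet> coef_n (\<gamma> d)))
     = frame (dcoord1 t c s i) (dcoord2 t d c s i) $ 1"
    proof (cases i)
      case (Inl a)
      then show ?thesis 
        by (cases a rule: exhaust_3_cases)
          (simp_all add: inl frame_def dcoord1_def dcoord2_def coord1_def coord2_def cos_psi sin_psi algebra_simps)
    next
      case (Inr b)
      then show ?thesis
        by (cases b) (simp_all add: inl ax frame_def dcoord1_def dcoord2_def cos_psi sin_psi algebra_simps)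
    qed
    show "t * (\<gamma> d $ Inl 1 * (cos (\<gamma> d $ Inl 2) * axis i 1 $ Inl 2) + axis i 1 $ Inl 1 * sin (\<gamma> d $ Inl 2))
     + (sin (\<gamma> d $ Inl 3) * (c \<bullet> coef_m (axis i 1)) + cos (\<gamma> d $ Inl 3) * axis i 1 $ Inl 3 * (c \<bullet> coef_m (\<gamma> d)))
     + (cos (\<gamma> d $ Inl 3) * (s \<bullet> coef_n (axis i 1)) + - sin (\<gamma> d $ Inl 3) * axis i 1 $ Inl 3 * (s \<bullet> coef_n (\<gamma> d)))
     = frame (dcoord1 t c s i) (dcoord2 t d c s i) $ 2"
    proof (cases i)
      case (Inl a)
      then show ?thesis 
        by (cases a rule: exhaust_3_cases)
          (simp_all add: inl frame_def dcoord1_def dcoord2_def coord1_def coord2_def cos_psi sin_psi algebra_simps)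
    next
      case (Inr b)
      then show ?thesis
        by (cases b) (simp_all add: inl ax frame_def dcoord1_def dcoord2_def cos_psi sin_psi algebra_simps)
    qed
  qed
qed

lemma pos_frame: "pos (\<gamma> d) u = frame (d + e u) (h u)"
  unfolding pos_eq fam_frame by (simp add: coord1_def coord2_def e_def h_def add.assoc)

lemma dot_pos_frame: "dot (pos (\<gamma> d)) u = frame (de u) (dh u)"
  unfolding dot_pos_eq fam_frame by (simp add: coord1_def coord2_def de_def dh_def)

definition "R d u = sqrt ((d + e u)\<^sup>2 + (h u)\<^sup>2)"

lemma norm_pos: "norm (pos (\<gamma> d) u) = R d u"
  by (simp add: pos_frame norm_frame R_def)

lemma norm_dot_pos: "norm (dot (pos (\<gamma> d)) u) = speed u"
  by (simp add: dot_pos_frame norm_frame speed_sq'[symmetric]) (simp add: speed_def)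

lemma norm_dot_rho: "norm (dot (rho (\<gamma> d)) u) = speed u"
proof -
  have "dot (rho (\<gamma> d)) u = vector [X u, Y u]"
    unfolding rho_def params_nth by (rule vector_derivative_at[OF has_vector_derivative_contour])
  then show ?thesis by (simp add: norm_2 speed_def)
qed

abbreviation "d1 u \<equiv> dcoord1 1 (cos_vec u) (sin_vec u)"
abbreviation "d2 d u \<equiv> dcoord2 1 d (cos_vec u) (sin_vec u)"
abbreviation "dd1 u \<equiv> dcoord1 0 (dcos_vec u) (dsin_vec u)"
abbreviation "dd2 u \<equiv> dcoord2 0 0 (dcos_vec u) (dsin_vec u)"

lemma grad_dist_nth:
  assumes "R d u \<noteq> 0"
  shows "grad_dist (\<gamma> d) u $ i = ((d + e u) * d1 u i + h u * d2 d u i) / R d u"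
proof -
  obtain A B where AB: "(fam1 1 (cos_vec u) (sin_vec u) has_derivative A) (at (\<gamma> d))"
    "(fam2 1 (cos_vec u) (sin_vec u) has_derivative B) (at (\<gamma> d))"
    "\<And>i. A (axis i 1) = frame (d1 u i) (d2 d u i) $ 1"
    "\<And>i. B (axis i 1) = frame (d1 u i) (d2 d u i) $ 2"
    using has_derivative_fam[of 1 "cos_vec u" "sin_vec u" d] by blast
  have "grad_dist (\<gamma> d) u $ i = (pos (\<gamma> d) u $ 1 * A (axis i 1) + pos (\<gamma> d) u $ 2 * B (axis i 1)) / norm (pos (\<gamma> d) u)"
    unfolding grad_dist_def dist_at_def
    by (rule gradient_norm_nth) (use AB assms in \<open>auto simp: pos_eq simp flip: norm_pos\<close>)
  then show ?thesis unfolding AB norm_pos unfolding pos_frame frame_inner .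
qed

lemma grad_phi_nth:
  assumes "R d u \<noteq> 0"
  shows "grad_phi (\<gamma> d) u $ i = ((d + e u) * d2 d u i - h u * d1 u i) / (R d u)\<^sup>2"
proof -
  obtain A B where AB: "(fam1 1 (cos_vec u) (sin_vec u) has_derivative A) (at (\<gamma> d))"
    "(fam2 1 (cos_vec u) (sin_vec u) has_derivative B) (at (\<gamma> d))"
    "\<And>i. A (axis i 1) = frame (d1 u i) (d2 d u i) $ 1"
    "\<And>i. B (axis i 1) = frame (d1 u i) (d2 d u i) $ 2"
    using has_derivative_fam[of 1 "cos_vec u" "sin_vec u" d] by blast
  have "grad_phi (\<gamma> d) u $ i = (pos (\<gamma> d) u $ 1 * B (axis i 1) - pos (\<gamma> d) u $ 2 * A (axis i 1)) / (norm (pos (\<gamma> d) u))\<^sup>2"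
    unfolding grad_phi_def
    by (rule angle_gradient_nth) (use AB assms in \<open>auto simp: pos_eq simp flip: norm_pos\<close>)
  then show ?thesis unfolding AB norm_pos unfolding pos_frame frame_cross .
qed

lemma grad_beta_nth:
  assumes "u \<in> {0..2 * pi}"
  shows "grad_beta (\<gamma> d) u $ i = (de u * dd2 u i - dh u * dd1 u i) / (speed u)\<^sup>2"
proof -
  obtain A B where AB: "(fam1 0 (dcos_vec u) (dsin_vec u) has_derivative A) (at (\<gamma> d))"
    "(fam2 0 (dcos_vec u) (dsin_vec u) has_derivative B) (at (\<gamma> d))"
    "\<And>i. A (axis i 1) = frame (dd1 u i) (dcoord2 0 d (dcos_vec u) (dsin_vec u) i) $ 1"
    "\<And>i. B (axis i 1) = frame (dd1 u i) (dcoord2 0 d (dcos_vec u) (dsin_vec u) i) $ 2"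
    using has_derivative_fam[of 0 "dcos_vec u" "dsin_vec u" d] by blast
  \<comment> \<open>With \<open>t = 0\<close> the distance is multiplied by zero, so the gradient of
    the velocity angle does not depend on \<open>d\<close>.\<close>
  have d: "dcoord2 0 d (dcos_vec u) (dsin_vec u) i = dd2 u i" by (simp only: dcoord2_def mult_zero_left)
  have "grad_beta (\<gamma> d) u $ i = (dot (pos (\<gamma> d)) u $ 1 * B (axis i 1) - dot (pos (\<gamma> d)) u $ 2 * A (axis i 1)) / (norm (dot (pos (\<gamma> d)) u))\<^sup>2"
    unfolding grad_beta_def
    by (rule angle_gradient_nth) (use AB speed_pos[OF assms] in \<open>auto simp: dot_pos_eq simp flip: norm_dot_pos[of d]\<close>)
  then show ?thesis unfolding AB norm_dot_pos unfolding dot_pos_frame frame_cross d .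
qed

lemma cos_phi:
  assumes "R d u \<noteq> 0"
  shows "cos (phi (\<gamma> d) u) = ((d + e u) * cos \<phi>0 - h u * sin \<phi>0) / R d u"
  using polar_angle(1)[of "pos (\<gamma> d) u"] assms
  unfolding norm_pos phi_def by (simp add: pos_frame frame_def field_simps)

text \<open>Inner and cross product of position and velocity, divided by the lengths, are cosine and
  sine of the angle between them. The cross product measures the angle from position to velocity,
  hence the change of sign.\<close>

lemma cos_sin_aspect:
  assumes "R d u \<noteq> 0" "u \<in> {0..2 * pi}"
  shows "cos (phi (\<gamma> d) u - beta (\<gamma> d) u) = ((d + e u) * de u + h u * dh u) / (R d u * speed u)"
    "sin (phi (\<gamma> d) u - beta (\<gamma> d) u) = (h u * de u - (d + e u) * dh u) / (R d u * speed u)"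
proof -
  let ?a = "phi (\<gamma> d) u" and ?b = "beta (\<gamma> d) u"
  have 1: "R d u * cos ?a = frame (d + e u) (h u) $ 1" "R d u * sin ?a = frame (d + e u) (h u) $ 2"
    using polar_angle[of "pos (\<gamma> d) u"] by (simp_all add: phi_def norm_pos) (simp_all add: pos_frame)
  have 2: "speed u * cos ?b = frame (de u) (dh u) $ 1" "speed u * sin ?b = frame (de u) (dh u) $ 2"
    using polar_angle[of "dot (pos (\<gamma> d)) u"] by (simp_all add: beta_def norm_dot_pos) (simp_all add: dot_pos_frame)
  have nz: "R d u * speed u \<noteq> 0" using assms speed_pos[of u] by auto
  have "(R d u * speed u) * cos (?a - ?b) = (R d u * cos ?a) * (speed u * cos ?b) + (R d u * sin ?a) * (speed u * sin ?b)"
    by (simp add: cos_diff algebra_simps)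
  then show "cos (?a - ?b) = ((d + e u) * de u + h u * dh u) / (R d u * speed u)"
    unfolding 1 2 frame_inner using nz by (simp add: eq_divide_eq mult.commute)
  have "(R d u * speed u) * sin (?a - ?b) = - ((R d u * cos ?a) * (speed u * sin ?b) - (R d u * sin ?a) * (speed u * cos ?b))"
    by (simp add: sin_diff algebra_simps)
  then show "sin (?a - ?b) = (h u * de u - (d + e u) * dh u) / (R d u * speed u)"
    unfolding 1 2 frame_cross using nz by (simp add: eq_divide_eq mult.commute)
qed

end

section \<open>Weighted inner product and bounded convergence\<close>

locale weighted =
  fixes a b :: real and \<omega> :: "real \<Rightarrow> real"
  assumes weight_cont: "continuous_on {a..b} \<omega>" and weight_pos: "\<And>u. u \<in> {a..b} \<Longrightarrow> \<omega> u > 0"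
begin

definition ip :: "(real \<Rightarrow> real) \<Rightarrow> (real \<Rightarrow> real) \<Rightarrow> real" where
  "ip f g = integral {a..b} (\<lambda>u. f u * g u * \<omega> u)"

text \<open>Mere measurability instead of continuity, because the weight \<open>wt_v\<close> jumps
  for \<alpha> = 0. On a compact interval this class is a ring of integrable functions.\<close>

definition bdd :: "(real \<Rightarrow> real) \<Rightarrow> bool" where
  "bdd f \<longleftrightarrow> f \<in> borel_measurable (lebesgue_on {a..b}) \<and> (\<exists>C. \<forall>u\<in>{a..b}. \<bar>f u\<bar> \<le> C)"

lemma bdd_continuous: "continuous_on {a..b} f \<Longrightarrow> bdd f"
proof -
  assume f: "continuous_on {a..b} f"
  have "bounded (f ` {a..b})" by (intro compact_imp_bounded compact_continuous_image f) simp
  then show "bdd f" using f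
    by (auto simp: bdd_def bounded_iff intro: continuous_imp_measurable_on_sets_lebesgue)
qed

lemma bdd_const [simp]: "bdd (\<lambda>u. c)"
  by (rule bdd_continuous) auto

lemma bdd_weight [simp]: "bdd \<omega>"
  by (rule bdd_continuous[OF weight_cont])

lemma bdd_add: assumes "bdd f" "bdd g" shows "bdd (\<lambda>u. f u + g u)"
proof -
  obtain C D where "\<And>u. u \<in> {a..b} \<Longrightarrow> \<bar>f u\<bar> \<le> C" "\<And>u. u \<in> {a..b} \<Longrightarrow> \<bar>g u\<bar> \<le> D"
    using assms unfolding bdd_def by blast
  then have "\<forall>u\<in>{a..b}. \<bar>f u + g u\<bar> \<le> C + D"
    by (meson abs_triangle_ineq add_mono order_trans)
  then show ?thesis using assms unfolding bdd_def by auto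
qed

lemma bdd_mult: assumes "bdd f" "bdd g" shows "bdd (\<lambda>u. f u * g u)"
proof -
  obtain C D where "\<And>u. u \<in> {a..b} \<Longrightarrow> \<bar>f u\<bar> \<le> C" "\<And>u. u \<in> {a..b} \<Longrightarrow> \<bar>g u\<bar> \<le> D"
    using assms unfolding bdd_def by blast
  then have "\<bar>f u\<bar> * \<bar>g u\<bar> \<le> C * D" if "u \<in> {a..b}" for u
    by (meson abs_ge_zero mult_mono order_trans that)
  then have "\<forall>u\<in>{a..b}. \<bar>f u * g u\<bar> \<le> C * D" by (simp add: abs_mult)
  then show ?thesis using assms unfolding bdd_def by auto
qed

lemma bdd_minus: "bdd f \<Longrightarrow> bdd (\<lambda>u. - f u)"
  using bdd_mult[of "\<lambda>u. -1" f] by simp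

lemma bdd_diff: "bdd f \<Longrightarrow> bdd g \<Longrightarrow> bdd (\<lambda>u. f u - g u)"
  using bdd_add[of f "\<lambda>u. - g u"] by (simp add: bdd_minus)

lemma bdd_sum: "(\<And>i. i \<in> S \<Longrightarrow> bdd (f i)) \<Longrightarrow> bdd (\<lambda>u. \<Sum>i\<in>S. f i u)"
  by (induction S rule: infinite_finite_induct) (auto intro: bdd_add)

lemmas bdd_intros = bdd_const bdd_weight bdd_add bdd_mult bdd_minus bdd_diff bdd_sum

lemma bdd_integrable: assumes "bdd f" shows "integrable (lebesgue_on {a..b}) f"
proof -
  obtain C where C: "\<And>u. u \<in> {a..b} \<Longrightarrow> \<bar>f u\<bar> \<le> C" "f \<in> borel_measurable (lebesgue_on {a..b})"
    using assms unfolding bdd_def by blast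
  interpret finite_measure "lebesgue_on {a..b}"
    by (rule finite_measure_lebesgue_on) simp
  show ?thesis by (rule integrable_const_bound[of _ C]) (use C in \<open>auto intro!: AE_I2\<close>)
qed

lemma ip_lebesgue:
  assumes "bdd f" "bdd g"
  shows "integrable (lebesgue_on {a..b}) (\<lambda>u. f u * g u * \<omega> u)"
    "ip f g = (LINT u|lebesgue_on {a..b}. f u * g u * \<omega> u)"
proof -
  show 1: "integrable (lebesgue_on {a..b}) (\<lambda>u. f u * g u * \<omega> u)"
    by (intro bdd_integrable bdd_intros assms)
  show "ip f g = (LINT u|lebesgue_on {a..b}. f u * g u * \<omega> u)"
    unfolding ip_def by (rule lebesgue_integral_eq_integral[OF 1, symmetric]) simp
qed

lemma ip_commute: "ip f g = ip g f"
  by (simp add: ip_def mult.commute)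

lemma ip_cong: "(\<And>u. u \<in> {a..b} \<Longrightarrow> f u = f' u) \<Longrightarrow> (\<And>u. u \<in> {a..b} \<Longrightarrow> g u = g' u) \<Longrightarrow> ip f g = ip f' g'"
  unfolding ip_def by (intro integral_cong) simp

lemma ip_add: "bdd f \<Longrightarrow> bdd g \<Longrightarrow> bdd h \<Longrightarrow> ip (\<lambda>u. f u + g u) h = ip f h + ip g h"
  by (simp add: ip_lebesgue bdd_intros distrib_right Bochner_Integration.integral_add)

lemma ip_scale: "ip (\<lambda>u. c * f u) h = c * ip f h"
  by (simp add: ip_def mult.assoc)

lemma ip_sum:
  "finite S \<Longrightarrow> (\<And>i. i \<in> S \<Longrightarrow> bdd (f i)) \<Longrightarrow> bdd h \<Longrightarrow> ip (\<lambda>u. \<Sum>i\<in>S. c i * f i u) h = (\<Sum>i\<in>S. c i * ip (f i) h)"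
  by (induction S rule: finite_induct) (simp_all add: ip_add ip_scale bdd_intros ip_def[of "\<lambda>u. 0"])

lemma ip_nonneg: "ip f f \<ge> 0"
proof (cases "(\<lambda>u. f u * f u * \<omega> u) integrable_on {a..b}")
  case True
  then show ?thesis unfolding ip_def
    by (rule integral_nonneg) (simp add: weight_pos less_imp_le)
qed (simp add: ip_def not_integrable_integral)

lemma ip_eq_0D:
  assumes f: "bdd f" and 0: "ip f f = 0"
  shows "negligible {u \<in> {a..b}. f u \<noteq> 0}"
proof -
  have "AE u in lebesgue_on {a..b}. f u * f u * \<omega> u = 0"
    using 0 ip_lebesgue[OF f f]
    by (subst integral_nonneg_eq_0_iff_AE[symmetric]) (auto simp: weight_pos less_imp_le)
  then have "AE u in lebesgue. u \<in> {a..b} \<longrightarrow> f u = 0"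
    using less_imp_neq[OF weight_pos, symmetric]
    by (subst (asm) AE_restrict_space_iff) (auto elim!: eventually_mono)
  then have "AE u in lebesgue. u \<notin> {u \<in> {a..b}. f u \<noteq> 0}" by (rule eventually_mono) auto
  then show ?thesis
    by (simp add: completion.AE_iff_null_sets negligible_iff_null_sets null_sets_completion_subset conj_ac)
qed

definition proj :: "(real \<Rightarrow> real) \<Rightarrow> (real \<Rightarrow> real) \<Rightarrow> real \<Rightarrow> real" where
  "proj w f u = f u - ip f w / ip w w * w u"

lemma bdd_proj: "bdd w \<Longrightarrow> bdd f \<Longrightarrow> bdd (proj w f)"
  unfolding proj_def[abs_def] by (intro bdd_intros)

lemma proj_sum:
  "bdd w \<Longrightarrow> finite S \<Longrightarrow> (\<And>i. i \<in> S \<Longrightarrow> bdd (f i)) \<Longrightarrow>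
   proj w (\<lambda>u. \<Sum>i\<in>S. c i * f i u) u = (\<Sum>i\<in>S. c i * proj w (f i) u)"
  by (simp add: proj_def ip_sum right_diff_distrib sum_subtractf sum_divide_distrib sum_distrib_right mult.assoc)

text \<open>This turns a null vector of the information matrix into an identity between functions:
  the form of a Gram matrix at \<open>x\<close> is the squared norm of the combination with
  coefficients \<open>x\<close>.\<close>

lemma gram_form:
  fixes f :: "'i::finite \<Rightarrow> real \<Rightarrow> real" and x :: "real^'i"
  assumes "\<And>i. bdd (f i)"
  shows "x \<bullet> ((\<chi> i j. ip (f i) (f j)) *v x) = ip (\<lambda>u. \<Sum>i\<in>UNIV. x $ i * f i u) (\<lambda>u. \<Sum>i\<in>UNIV. x $ i * f i u)"
proof -
  let ?F = "\<lambda>u. \<Sum>i\<in>UNIV. x $ i * f i u"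
  have "ip ?F ?F = (\<Sum>i\<in>UNIV. x $ i * ip ?F (f i))"
    by (subst ip_sum) (auto intro!: bdd_intros assms simp: ip_commute)
  also have "\<dots> = (\<Sum>i\<in>UNIV. x $ i * (\<Sum>j\<in>UNIV. x $ j * ip (f j) (f i)))"
    by (subst ip_sum) (auto intro!: assms)
  also have "\<dots> = x \<bullet> ((\<chi> i j. ip (f i) (f j)) *v x)"
    by (simp add: inner_vec_def matrix_vector_mult_def mult.commute ip_commute[of "f i" "f j" for i j])
  finally show ?thesis ..
qed

text \<open>A mode of convergence fit for dominated convergence and closed under sums, products and
  projections. The bound is uniform in \<open>u\<close> but holds only for large \<open>d\<close>,
  and finitely many points are exempt because of the jump of \<open>wt_v\<close>.\<close>

definition conv :: "(real \<Rightarrow> real \<Rightarrow> real) \<Rightarrow> (real \<Rightarrow> real) \<Rightarrow> bool" where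
  "conv F f \<longleftrightarrow> bdd f \<and> (\<forall>\<^sub>F d in at_top. F d \<in> borel_measurable (lebesgue_on {a..b})) \<and>
     (\<exists>C. \<forall>\<^sub>F d in at_top. \<forall>u\<in>{a..b}. \<bar>F d u\<bar> \<le> C) \<and>
     (\<exists>X. finite X \<and> (\<forall>u\<in>{a..b} - X. ((\<lambda>d. F d u) \<longlongrightarrow> f u) at_top))"

lemma convI:
  assumes "bdd f" "\<forall>\<^sub>F d in at_top. F d \<in> borel_measurable (lebesgue_on {a..b})"
    "\<forall>\<^sub>F d in at_top. \<forall>u\<in>{a..b}. \<bar>F d u\<bar> \<le> C" "finite X"
    "\<And>u. u \<in> {a..b} \<Longrightarrow> u \<notin> X \<Longrightarrow> ((\<lambda>d. F d u) \<longlongrightarrow> f u) at_top"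
  shows "conv F f"
  using assms unfolding conv_def by blast

lemma conv_bdd: "conv F f \<Longrightarrow> bdd f"
  by (simp add: conv_def)

lemma convE:
  assumes "conv F f"
  obtains C X where "\<forall>\<^sub>F d in at_top. F d \<in> borel_measurable (lebesgue_on {a..b})"
    "\<forall>\<^sub>F d in at_top. \<forall>u\<in>{a..b}. \<bar>F d u\<bar> \<le> C" "finite X"
    "\<And>u. u \<in> {a..b} \<Longrightarrow> u \<notin> X \<Longrightarrow> ((\<lambda>d. F d u) \<longlongrightarrow> f u) at_top"
  using assms unfolding conv_def by blast

lemma conv_eventually_bdd:
  assumes "conv F f" shows "\<forall>\<^sub>F d in at_top. bdd (F d)"
proof -
  obtain C X where C: "\<forall>\<^sub>F d in at_top. F d \<in> borel_measurable (lebesgue_on {a..b})"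
    "\<forall>\<^sub>F d in at_top. \<forall>u\<in>{a..b}. \<bar>F d u\<bar> \<le> C"
    using assms by (rule convE)
  from C show ?thesis by eventually_elim (auto simp: bdd_def)
qed

lemma conv_const: "bdd f \<Longrightarrow> conv (\<lambda>d. f) f"
  by (auto simp: conv_def bdd_def)

lemma conv_scalar:
  fixes c :: "real \<Rightarrow> real"
  assumes "(c \<longlongrightarrow> c0) at_top" shows "conv (\<lambda>d u. c d) (\<lambda>u. c0)"
proof (rule convI)
  have "\<forall>\<^sub>F d in at_top. dist (c d) c0 < 1" by (rule tendstoD[OF assms]) simp
  then show "\<forall>\<^sub>F d in at_top. \<forall>u\<in>{a..b}. \<bar>c d\<bar> \<le> \<bar>c0\<bar> + 1"
    by eventually_elim (auto simp: dist_real_def)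
qed (use assms in auto)

lemma conv_add:
  assumes "conv F f" "conv G g" shows "conv (\<lambda>d u. F d u + G d u) (\<lambda>u. f u + g u)"
proof -
  obtain C X where F: "\<forall>\<^sub>F d in at_top. F d \<in> borel_measurable (lebesgue_on {a..b})"
    "\<forall>\<^sub>F d in at_top. \<forall>u\<in>{a..b}. \<bar>F d u\<bar> \<le> C" "finite X"
    "\<And>u. u \<in> {a..b} \<Longrightarrow> u \<notin> X \<Longrightarrow> ((\<lambda>d. F d u) \<longlongrightarrow> f u) at_top"
    using assms(1) by (rule convE) blast
  obtain D Y where G: "\<forall>\<^sub>F d in at_top. G d \<in> borel_measurable (lebesgue_on {a..b})"
    "\<forall>\<^sub>F d in at_top. \<forall>u\<in>{a..b}. \<bar>G d u\<bar> \<le> D" "finite Y"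
    "\<And>u. u \<in> {a..b} \<Longrightarrow> u \<notin> Y \<Longrightarrow> ((\<lambda>d. G d u) \<longlongrightarrow> g u) at_top"
    using assms(2) by (rule convE) blast
  show ?thesis
  proof (rule convI)
    show "bdd (\<lambda>u. f u + g u)" using assms by (intro bdd_add conv_bdd)
    show "\<forall>\<^sub>F d in at_top. (\<lambda>u. F d u + G d u) \<in> borel_measurable (lebesgue_on {a..b})"
      using F(1) G(1) by eventually_elim auto
    show "\<forall>\<^sub>F d in at_top. \<forall>u\<in>{a..b}. \<bar>F d u + G d u\<bar> \<le> C + D"
      using F(2) G(2) by eventually_elim (meson abs_triangle_ineq add_mono order_trans)
    show "finite (X \<union> Y)" using F(3) G(3) by simp
  qed (auto intro!: tendsto_add F(4) G(4))
qed

lemma conv_mult: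
  assumes "conv F f" "conv G g" shows "conv (\<lambda>d u. F d u * G d u) (\<lambda>u. f u * g u)"
proof -
  obtain C X where F: "\<forall>\<^sub>F d in at_top. F d \<in> borel_measurable (lebesgue_on {a..b})"
    "\<forall>\<^sub>F d in at_top. \<forall>u\<in>{a..b}. \<bar>F d u\<bar> \<le> C" "finite X"
    "\<And>u. u \<in> {a..b} \<Longrightarrow> u \<notin> X \<Longrightarrow> ((\<lambda>d. F d u) \<longlongrightarrow> f u) at_top"
    using assms(1) by (rule convE) blast
  obtain D Y where G: "\<forall>\<^sub>F d in at_top. G d \<in> borel_measurable (lebesgue_on {a..b})"
    "\<forall>\<^sub>F d in at_top. \<forall>u\<in>{a..b}. \<bar>G d u\<bar> \<le> D" "finite Y"
    "\<And>u. u \<in> {a..b} \<Longrightarrow> u \<notin> Y \<Longrightarrow> ((\<lambda>d. G d u) \<longlongrightarrow> g u) at_top"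
    using assms(2) by (rule convE) blast
  show ?thesis
  proof (rule convI)
    show "bdd (\<lambda>u. f u * g u)" using assms by (intro bdd_mult conv_bdd)
    show "\<forall>\<^sub>F d in at_top. (\<lambda>u. F d u * G d u) \<in> borel_measurable (lebesgue_on {a..b})"
      using F(1) G(1) by eventually_elim auto
    show "\<forall>\<^sub>F d in at_top. \<forall>u\<in>{a..b}. \<bar>F d u * G d u\<bar> \<le> C * D"
      using F(2) G(2)
    proof eventually_elim
      case (elim d)
      show ?case
      proof
        fix u assume u: "u \<in> {a..b}"
        have "\<bar>F d u\<bar> \<le> C" "\<bar>G d u\<bar> \<le> D" using elim u by auto
        then have "\<bar>F d u\<bar> * \<bar>G d u\<bar> \<le> C * D" by (intro mult_mono) auto
        then show "\<bar>F d u * G d u\<bar> \<le> C * D" by (simp add: abs_mult)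
      qed
    qed
    show "finite (X \<union> Y)" using F(3) G(3) by simp
  qed (auto intro!: tendsto_mult F(4) G(4))
qed

lemma conv_minus: "conv F f \<Longrightarrow> conv (\<lambda>d u. - F d u) (\<lambda>u. - f u)"
  using conv_mult[OF conv_const[OF bdd_const[of "-1"]], of F f] by simp

lemma conv_diff: "conv F f \<Longrightarrow> conv G g \<Longrightarrow> conv (\<lambda>d u. F d u - G d u) (\<lambda>u. f u - g u)"
  using conv_add[of F f "\<lambda>d u. - G d u" "\<lambda>u. - g u"] by (simp add: conv_minus)

text \<open>Lets explicit formulas stand for gradients and angles, with which they agree only once
  the distance is large enough for the contour to avoid the origin.\<close>

lemma conv_cong:
  assumes conv: "conv F f" and eq: "\<forall>\<^sub>F d in at_top. \<forall>u\<in>{a..b}. F d u = G d u"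
    and fg: "\<And>u. u \<in> {a..b} \<Longrightarrow> f u = g u"
  shows "conv G g"
proof -
  obtain C X where F: "\<forall>\<^sub>F d in at_top. F d \<in> borel_measurable (lebesgue_on {a..b})"
    "\<forall>\<^sub>F d in at_top. \<forall>u\<in>{a..b}. \<bar>F d u\<bar> \<le> C" "finite X"
    "\<And>u. u \<in> {a..b} \<Longrightarrow> u \<notin> X \<Longrightarrow> ((\<lambda>d. F d u) \<longlongrightarrow> f u) at_top"
    using conv by (rule convE) blast
  show ?thesis
  proof (rule convI[OF _ _ _ F(3)])
    have "f \<in> borel_measurable (lebesgue_on {a..b}) \<longleftrightarrow> g \<in> borel_measurable (lebesgue_on {a..b})"
      using fg by (rule measurable_cong) simp
    then show "bdd g" using conv_bdd[OF conv] fg by (auto simp: bdd_def)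
    show "\<forall>\<^sub>F d in at_top. G d \<in> borel_measurable (lebesgue_on {a..b})"
      using F(1) eq
    proof eventually_elim
      case (elim d)
      then show ?case using measurable_cong[of "lebesgue_on {a..b}" "F d" "G d"] by simp
    qed
    show "\<forall>\<^sub>F d in at_top. \<forall>u\<in>{a..b}. \<bar>G d u\<bar> \<le> C"
      using F(2) eq by eventually_elim simp
    fix u assume u: "u \<in> {a..b}" "u \<notin> X"
    have "\<forall>\<^sub>F d in at_top. F d u = G d u" using eq by eventually_elim (use u in auto)
    with F(4)[OF u] show "((\<lambda>d. G d u) \<longlongrightarrow> g u) at_top"
      using fg[OF u(1)] by (simp add: tendsto_cong)
  qed
qed

lemma conv_ip:
  assumes "conv F f" "conv G g" shows "((\<lambda>d. ip (F d) (G d)) \<longlongrightarrow> ip f g) at_top"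
proof -
  define H where "H d u = F d u * G d u * \<omega> u" for d u
  have H: "conv H (\<lambda>u. f u * g u * \<omega> u)"
    unfolding H_def[abs_def] by (intro conv_mult assms conv_const bdd_weight)
  obtain C X where C: "\<forall>\<^sub>F d in at_top. H d \<in> borel_measurable (lebesgue_on {a..b})"
    "\<forall>\<^sub>F d in at_top. \<forall>u\<in>{a..b}. \<bar>H d u\<bar> \<le> C" "finite X"
    "\<And>u. u \<in> {a..b} \<Longrightarrow> u \<notin> X \<Longrightarrow> ((\<lambda>d. H d u) \<longlongrightarrow> f u * g u * \<omega> u) at_top"
    using H by (rule convE) blast
  have bF: "\<forall>\<^sub>F d in at_top. bdd (F d)" and bG: "\<forall>\<^sub>F d in at_top. bdd (G d)"
    using assms conv_eventually_bdd by auto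
  have "\<forall>\<^sub>F d in at_top. H d \<in> borel_measurable (lebesgue_on {a..b}) \<and>
      (\<forall>u\<in>{a..b}. \<bar>H d u\<bar> \<le> C) \<and> bdd (F d) \<and> bdd (G d)"
    by (intro eventually_conj C bF bG)
  then obtain d0 where d0: "\<And>d. d \<ge> d0 \<Longrightarrow> H d \<in> borel_measurable (lebesgue_on {a..b}) \<and>
      (\<forall>u\<in>{a..b}. \<bar>H d u\<bar> \<le> C) \<and> bdd (F d) \<and> bdd (G d)"
    by (auto simp: eventually_at_top_linorder)
  \<comment> \<open>The convergence theorem asks for measurability at every \<open>d\<close>, which
    is known from \<open>d0\<close> on. Replacing \<open>d\<close> by \<open>max d d0\<close>
    bridges this without affecting the limit.\<close>
  have ev: "\<forall>\<^sub>F d in at_top. max d d0 = d" using eventually_ge_at_top[of d0] by eventually_elim auto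
  have "((\<lambda>d. integral\<^sup>L (lebesgue_on {a..b}) (H (max d d0))) \<longlongrightarrow> (LINT u|lebesgue_on {a..b}. f u * g u * \<omega> u)) at_top"
  proof (rule integral_dominated_convergence_at_top[where w="\<lambda>u. C"])
    show "(\<lambda>u. f u * g u * \<omega> u) \<in> borel_measurable (lebesgue_on {a..b})"
      using conv_bdd[OF H] by (simp add: bdd_def)
    show "H (max d d0) \<in> borel_measurable (lebesgue_on {a..b})" for d using d0 by simp
    show "integrable (lebesgue_on {a..b}) (\<lambda>u. C)" by (rule bdd_integrable) simp
    show "\<forall>\<^sub>F d in at_top. AE u in lebesgue_on {a..b}. norm (H (max d d0) u) \<le> C"
      using d0 by (intro always_eventually allI AE_I2) simp
    have "AE u in lebesgue. u \<notin> X"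
      using negligible_finite[OF C(3)] by (simp add: negligible_iff_null_sets AE_not_in)
    then have "AE u in lebesgue_on {a..b}. u \<notin> X"
      by (subst AE_restrict_space_iff) (auto elim: eventually_mono)
    then show "AE u in lebesgue_on {a..b}. ((\<lambda>d. H (max d d0) u) \<longlongrightarrow> f u * g u * \<omega> u) at_top"
    proof (rule AE_mp, intro AE_I2 impI)
      fix u assume "u \<in> space (lebesgue_on {a..b})" "u \<notin> X"
      then have "((\<lambda>d. H d u) \<longlongrightarrow> f u * g u * \<omega> u) at_top" using C(4) by simp
      then show "((\<lambda>d. H (max d d0) u) \<longlongrightarrow> f u * g u * \<omega> u) at_top"
        by (rule Lim_transform_eventually) (use ev in eventually_elim, simp)
    qed
  qed
  then have "((\<lambda>d. integral\<^sup>L (lebesgue_on {a..b}) (H (max d d0))) \<longlongrightarrow> ip f g) at_top"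
    using assms by (simp add: ip_lebesgue conv_bdd)
  then show ?thesis
  proof (rule Lim_transform_eventually)
    show "\<forall>\<^sub>F d in at_top. integral\<^sup>L (lebesgue_on {a..b}) (H (max d d0)) = ip (F d) (G d)"
      using ev bF bG by eventually_elim (simp add: ip_lebesgue H_def[abs_def])
  qed
qed

lemma conv_proj:
  assumes "conv W w" "conv F f" "ip w w \<noteq> 0"
  shows "conv (\<lambda>d. proj (W d) (F d)) (proj w f)"
  unfolding proj_def[abs_def]
  by (intro conv_diff conv_mult conv_scalar tendsto_divide conv_ip assms)

end

lemma infinite_Ioo_diff_negligible:
  fixes c d :: real
  assumes "c < d" "negligible N"
  shows "infinite ({c<..<d} - N)"
proof
  assume "finite ({c<..<d} - N)"
  then have "negligible (({c<..<d} - N) \<union> N)" using assms(2)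
    by (rule negligible_Un[OF negligible_finite])
  then have "negligible {c<..<d}" by (rule negligible_subset) auto
  then show False using open_not_negligible[of "{c<..<d}"] assms(1) by auto
qed

section \<open>Limits of the gradients and weights\<close>

lemma continuous_on_harmonics [continuous_intros]:
  "continuous_on S (\<lambda>u. cos_vec u \<bullet> a)" "continuous_on S (\<lambda>u. sin_vec u \<bullet> a)"
  "continuous_on S (\<lambda>u. dcos_vec u \<bullet> a)" "continuous_on S (\<lambda>u. dsin_vec u \<bullet> a)"
  "continuous_on S (\<lambda>u. cos_vec u $ k)" "continuous_on S (\<lambda>u. sin_vec u $ k)"
  "continuous_on S (\<lambda>u. dcos_vec u $ k)" "continuous_on S (\<lambda>u. dsin_vec u $ k)"
  by (auto simp: inner_vec_def cos_vec_def sin_vec_def dcos_vec_def dsin_vec_def intro!: continuous_intros)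

lemma (in contour_frame) continuous_on_frame [continuous_intros]:
  "continuous_on S e" "continuous_on S h" "continuous_on S de" "continuous_on S dh" "continuous_on S speed"
  unfolding e_def[abs_def] h_def[abs_def] de_def[abs_def] dh_def[abs_def] speed_def[abs_def]
  by (intro continuous_intros)+

lemma (in weighted) bdd_powr:
  assumes f: "bdd f" and p: "p \<ge> 0"
  shows "bdd (\<lambda>u. (max (f u) 0) powr p)"
proof -
  obtain C where C: "\<And>u. u \<in> {a..b} \<Longrightarrow> \<bar>f u\<bar> \<le> C" using f unfolding bdd_def by blast
  have "\<bar>max (f u) 0 powr p\<bar> \<le> max C 0 powr p" if "u \<in> {a..b}" for u
    using C[OF that] p by (auto intro!: powr_mono2)
  then have "\<exists>C. \<forall>u\<in>{a..b}. \<bar>max (f u) 0 powr p\<bar> \<le> C" by blast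
  moreover have "(\<lambda>u. max (f u) 0 powr p) \<in> borel_measurable (lebesgue_on {a..b})"
    using f unfolding bdd_def by auto
  ultimately show ?thesis unfolding bdd_def by blast
qed

text \<open>For \<open>p = 0\<close>, convergence can fail where \<open>f\<close> vanishes.\<close>

lemma (in weighted) conv_powr:
  assumes F: "conv F f" and p: "p \<ge> 0" and fin: "finite {u \<in> {a..b}. f u = 0}"
  shows "conv (\<lambda>d u. (max (F d u) 0) powr p) (\<lambda>u. (max (f u) 0) powr p)"
proof -
  obtain C X where C: "\<forall>\<^sub>F d in at_top. F d \<in> borel_measurable (lebesgue_on {a..b})"
    "\<forall>\<^sub>F d in at_top. \<forall>u\<in>{a..b}. \<bar>F d u\<bar> \<le> C" "finite X"
    "\<And>u. u \<in> {a..b} \<Longrightarrow> u \<notin> X \<Longrightarrow> ((\<lambda>d. F d u) \<longlongrightarrow> f u) at_top"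
    using F by (rule convE) blast
  show ?thesis
  proof (rule convI)
    show "bdd (\<lambda>u. (max (f u) 0) powr p)" by (intro bdd_powr conv_bdd[OF F] p)
    show "\<forall>\<^sub>F d in at_top. (\<lambda>u. (max (F d u) 0) powr p) \<in> borel_measurable (lebesgue_on {a..b})"
      using C(1) by eventually_elim auto
    show "\<forall>\<^sub>F d in at_top. \<forall>u\<in>{a..b}. \<bar>(max (F d u) 0) powr p\<bar> \<le> max C 0 powr p"
      using C(2)
    proof eventually_elim
      case (elim d)
      show ?case
      proof
        fix u assume "u \<in> {a..b}"
        then have "\<bar>F d u\<bar> \<le> C" using elim by blast
        then show "\<bar>max (F d u) 0 powr p\<bar> \<le> max C 0 powr p"
          using p by (auto intro!: powr_mono2)
      qed
    qed
    show "finite (X \<union> {u \<in> {a..b}. f u = 0})" using C(3) fin by simp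
    fix u assume u: "u \<in> {a..b}" "u \<notin> X \<union> {u \<in> {a..b}. f u = 0}"
    then have lim: "((\<lambda>d. F d u) \<longlongrightarrow> f u) at_top" using C(4) by simp
    show "((\<lambda>d. (max (F d u) 0) powr p) \<longlongrightarrow> (max (f u) 0) powr p) at_top"
    proof (cases "f u > 0")
      case True
      then show ?thesis by (intro tendsto_powr tendsto_max lim tendsto_const) auto
    next
      case False
      then have "f u < 0" using u by auto
      \<comment> \<open>Once the sign is settled, both sides are \<open>0 powr p\<close>, so
        continuity of the power at 0 does not come in.\<close>
      then have "\<forall>\<^sub>F d in at_top. F d u < 0" by (rule order_tendstoD(2)[OF lim])
      then have "\<forall>\<^sub>F d in at_top. (max (f u) 0) powr p = (max (F d u) 0) powr p"
        by eventually_elim (use \<open>f u < 0\<close> in \<open>simp add: max_def\<close>)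
      then show ?thesis by (rule Lim_transform_eventually[OF tendsto_const])
    qed
  qed
qed

lemma index_cases:
  fixes i :: "3 + 'a + 'b"
  obtains "i = Inl 1" | "i = Inl 2" | "i = Inl 3" | k where "i = Inr (Inl k)" | k where "i = Inr (Inr k)"
proof (cases i)
  case (Inl j)
  then show thesis using exhaust_3[of j] that(1-3) by blast
next
  case (Inr r)
  then show thesis using that(4,5) by (cases r) blast+
qed

locale asymptotics = target m n \<phi>0 \<psi>
  for m n :: "real ^ 'q::{finite,linorder}" and \<phi>0 \<psi> :: real +
  fixes \<alpha> :: real
  assumes \<alpha>: "\<alpha> \<ge> 0"
begin

sublocale weighted 0 "2 * pi" speed
  by unfold_locales (auto intro: continuous_on_frame speed_pos)

text \<open>The rotation preserves the speed and the centre is constant along the contour, so the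
  star product is the same for all distances.\<close>

lemma star_eq: "star (\<gamma> d) f g = ip f g"
  by (simp add: star_def ip_def norm_dot_pos)

lemma star_norm_sq: "(star_norm (\<gamma> d) f)\<^sup>2 = ip f f"
  by (simp add: star_norm_def star_eq ip_nonneg)

lemma proj_perp_eq: "proj_perp (\<gamma> d) w f = proj w f"
  by (rule ext) (simp add: proj_perp_def proj_def star_eq star_norm_sq)

lemma proj_perp_vec_nth: "proj_perp_vec (\<gamma> d) w f u $ i = proj w (\<lambda>u. f u $ i) u"
  by (simp add: proj_perp_vec_def proj_def star_eq star_norm_sq star_vec_def)

section \<open>Growth of the distance to the contour points\<close>

lemma bdd_R:
  obtains b where "b > 0" "\<And>u. u \<in> {0..2*pi} \<Longrightarrow> \<bar>e u\<bar> \<le> b"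
proof -
  obtain C where "\<And>u. u \<in> {0..2*pi} \<Longrightarrow> \<bar>e u\<bar> \<le> C"
    using bdd_continuous[OF continuous_on_frame(1)] unfolding bdd_def by blast
  then show thesis using that[of "\<bar>C\<bar> + 1"] by fastforce
qed

lemma R_large: "\<forall>\<^sub>F d in at_top. \<forall>u\<in>{0..2*pi}. d \<ge> 1 \<and> R d u \<ge> d / 2"
proof -
  obtain b where b: "b > 0" "\<And>u. u \<in> {0..2*pi} \<Longrightarrow> \<bar>e u\<bar> \<le> b" by (rule bdd_R) blast
  show ?thesis
    \<comment> \<open>From here on \<open>b\<close> is at most half of \<open>d\<close>, so
      \<open>d + e u\<close> keeps at least half of \<open>d\<close>.\<close>
    using eventually_ge_at_top[of "2 * b + 1"]
  proof eventually_elim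
    case (elim d)
    show ?case
    proof
      fix u assume "u \<in> {0..2*pi}"
      then have "\<bar>e u\<bar> \<le> b" using b by simp
      then have "d / 2 \<le> \<bar>d + e u\<bar>" using elim by linarith
      also have "\<dots> \<le> R d u" unfolding R_def by (rule real_le_rsqrt) simp
      finally show "d \<ge> 1 \<and> R d u \<ge> d / 2" using elim b by linarith
    qed
  qed
qed

lemma R_nonzero: "\<forall>\<^sub>F d in at_top. \<forall>u\<in>{0..2*pi}. R d u \<noteq> 0"
  using R_large by eventually_elim force

lemma continuous_on_R: "continuous_on S (R d)"
  unfolding R_def[abs_def] by (intro continuous_intros)

lemma conv_inverse_R: "conv (\<lambda>d u. 1 / R d u) (\<lambda>u. 0)"
proof (rule convI)
  show "\<forall>\<^sub>F d in at_top. (\<lambda>u. 1 / R d u) \<in> borel_measurable (lebesgue_on {0..2*pi})"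
    using R_nonzero by eventually_elim
     (intro continuous_imp_measurable_on_sets_lebesgue continuous_intros continuous_on_R; auto)
  show "\<forall>\<^sub>F d in at_top. \<forall>u\<in>{0..2*pi}. \<bar>1 / R d u\<bar> \<le> 2"
    using R_large
  proof eventually_elim
    case (elim d)
    show ?case
    proof
      fix u assume "u \<in> {0..2 * pi}"
      with elim have "d \<ge> 1" "R d u \<ge> d / 2" by auto
      then have "R d u > 0" "1 \<le> 2 * R d u" by linarith+
      then show "\<bar>1 / R d u\<bar> \<le> 2" using \<open>d \<ge> 1\<close> by (simp add: divide_le_eq)
    qed
  qed
  show "((\<lambda>d. 1 / R d u) \<longlongrightarrow> 0) at_top" for u
    unfolding R_def by real_asymp
qed auto

lemma conv_d_R: "conv (\<lambda>d u. d / R d u) (\<lambda>u. 1)"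
proof (rule convI)
  show "\<forall>\<^sub>F d in at_top. (\<lambda>u. d / R d u) \<in> borel_measurable (lebesgue_on {0..2*pi})"
    using R_nonzero by eventually_elim
     (intro continuous_imp_measurable_on_sets_lebesgue continuous_intros continuous_on_R; auto)
  show "\<forall>\<^sub>F d in at_top. \<forall>u\<in>{0..2*pi}. \<bar>d / R d u\<bar> \<le> 2"
    using R_large
  proof eventually_elim
    case (elim d)
    show ?case
    proof
      fix u assume "u \<in> {0..2 * pi}"
      with elim have "d \<ge> 1" "R d u \<ge> d / 2" by auto
      then have "R d u > 0" "d \<le> 2 * R d u" by linarith+
      then show "\<bar>d / R d u\<bar> \<le> 2" using \<open>d \<ge> 1\<close> by (simp add: divide_le_eq)
    qed
  qed
  show "((\<lambda>d. d / R d u) \<longlongrightarrow> 1) at_top" for u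
    unfolding R_def by real_asymp
qed auto

lemma bdd_frame: "bdd e" "bdd h" "bdd de" "bdd dh"
  by (intro bdd_continuous continuous_on_frame)+

lemma bdd_inverse_speed: "bdd (\<lambda>u. 1 / speed u)"
  by (intro bdd_continuous continuous_intros continuous_on_frame) (use speed_pos in force)

lemma continuous_on_dcoord:
  "continuous_on S (\<lambda>u. d1 u i)" "continuous_on S (\<lambda>u. dd1 u i)"
  "continuous_on S (\<lambda>u. d2 d u i)" "continuous_on S (\<lambda>u. dd2 u i)"
proof -
  have "continuous_on S (\<lambda>u. d1 u i) \<and> continuous_on S (\<lambda>u. dd1 u i) \<and>
    continuous_on S (\<lambda>u. d2 d u i) \<and> continuous_on S (\<lambda>u. dd2 u i)"
    by (cases i rule: index_cases) (auto simp: dcoord1_def dcoord2_def coord1_def coord2_def intro!: continuous_intros)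
  then show "continuous_on S (\<lambda>u. d1 u i)" "continuous_on S (\<lambda>u. dd1 u i)"
    "continuous_on S (\<lambda>u. d2 d u i)" "continuous_on S (\<lambda>u. dd2 u i)" by auto
qed

lemma bdd_dcoord: "bdd (\<lambda>u. d1 u i)" "bdd (\<lambda>u. d2 d u i)" "bdd (\<lambda>u. dd1 u i)" "bdd (\<lambda>u. dd2 u i)"
  by (intro bdd_continuous continuous_on_dcoord)+

text \<open>The limit of \<open>d2 d u i / R d u\<close>: the bearing is the only parameter whose
  change displaces a point by an amount growing with the distance.\<close>

definition sel :: "3 + 'q + 'q \<Rightarrow> real" where
  "sel i = (if i = Inl 2 then 1 else 0)"

lemma d2_eq: "d2 d u i = d2 0 u i + d * sel i"
  by (auto simp: dcoord2_def sel_def split: sum.splits)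

lemma conv_Q: "conv (\<lambda>d u. d / R d u + e u * (1 / R d u)) (\<lambda>u. 1)"
  by (rule conv_cong[OF conv_add[OF conv_d_R conv_mult[OF conv_const[OF bdd_frame(1)] conv_inverse_R]]]) auto

lemma conv_hT: "conv (\<lambda>d u. h u * (1 / R d u)) (\<lambda>u. 0)"
  by (rule conv_cong[OF conv_mult[OF conv_const[OF bdd_frame(2)] conv_inverse_R]]) auto

lemma conv_d2_R: "conv (\<lambda>d u. d2 d u i * (1 / R d u)) (\<lambda>u. sel i)"
proof (rule conv_cong)
  show "conv (\<lambda>d u. d2 0 u i * (1 / R d u) + sel i * (d / R d u)) (\<lambda>u. d2 0 u i * 0 + sel i * 1)"
    by (intro conv_add conv_mult conv_inverse_R conv_d_R conv_const bdd_dcoord bdd_const)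
  show "\<forall>\<^sub>F d in at_top. \<forall>u\<in>{0..2 * pi}. d2 0 u i * (1 / R d u) + sel i * (d / R d u) = d2 d u i * (1 / R d u)"
  proof (intro always_eventually allI ballI)
    show "d2 0 u i * (1 / R d u) + sel i * (d / R d u) = d2 d u i * (1 / R d u)" for d u
      using d2_eq[of d u i] by (simp add: add_divide_distrib mult.commute)
  qed
qed simp

text \<open>A displacement across the bearing enters the range with the factor
  \<open>h u / R d u\<close>. This suppresses all of them except the one due to the bearing, which
  grows like \<open>d\<close> and leaves \<open>h u\<close>.\<close>

lemma conv_grad_dist: "conv (\<lambda>d u. grad_dist (\<gamma> d) u $ i) (\<lambda>u. d1 u i + h u * sel i)"
proof (rule conv_cong)
  show "conv (\<lambda>d u. (d / R d u + e u * (1 / R d u)) * d1 u i + h u * (d2 d u i * (1 / R d u))) (\<lambda>u. 1 * d1 u i + h u * sel i)"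
    by (intro conv_add conv_mult conv_Q conv_d2_R conv_const bdd_dcoord bdd_frame)
  show "\<forall>\<^sub>F d in at_top. \<forall>u\<in>{0..2 * pi}. (d / R d u + e u * (1 / R d u)) * d1 u i + h u * (d2 d u i * (1 / R d u))
      = grad_dist (\<gamma> d) u $ i"
    using R_nonzero by eventually_elim (auto simp: grad_dist_nth field_simps)
qed simp

lemma conv_grad_phi: "conv (\<lambda>d u. grad_phi (\<gamma> d) u $ i) (\<lambda>u. sel i)"
proof (rule conv_cong)
  show "conv (\<lambda>d u. (d / R d u + e u * (1 / R d u)) * (d2 d u i * (1 / R d u)) - h u * (1 / R d u) * (d1 u i * (1 / R d u)))
      (\<lambda>u. 1 * sel i - 0 * (d1 u i * 0))"
    by (intro conv_diff conv_mult[OF conv_Q] conv_mult[OF conv_hT] conv_d2_R conv_mult[OF conv_const conv_inverse_R] bdd_dcoord)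
  show "\<forall>\<^sub>F d in at_top. \<forall>u\<in>{0..2 * pi}. (d / R d u + e u * (1 / R d u)) * (d2 d u i * (1 / R d u)) - h u * (1 / R d u) * (d1 u i * (1 / R d u))
      = grad_phi (\<gamma> d) u $ i"
    using R_nonzero by eventually_elim (auto simp: grad_phi_nth field_simps power2_eq_square)
qed simp

lemma conv_cos_phi: "conv (\<lambda>d u. cos (phi (\<gamma> d) u)) (\<lambda>u. cos \<phi>0)"
proof (rule conv_cong)
  show "conv (\<lambda>d u. (d / R d u + e u * (1 / R d u)) * cos \<phi>0 - h u * (1 / R d u) * sin \<phi>0) (\<lambda>u. 1 * cos \<phi>0 - 0 * sin \<phi>0)"
    by (intro conv_diff conv_mult[OF conv_Q] conv_mult[OF conv_hT] conv_const bdd_const)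
  show "\<forall>\<^sub>F d in at_top. \<forall>u\<in>{0..2 * pi}. (d / R d u + e u * (1 / R d u)) * cos \<phi>0 - h u * (1 / R d u) * sin \<phi>0 = cos (phi (\<gamma> d) u)"
    using R_nonzero by eventually_elim (auto simp: cos_phi field_simps)
qed simp

lemma conv_cos_aspect: "conv (\<lambda>d u. cos (phi (\<gamma> d) u - beta (\<gamma> d) u)) (\<lambda>u. de u / speed u)"
proof (rule conv_cong)
  show "conv (\<lambda>d u. ((d / R d u + e u * (1 / R d u)) * de u + h u * (1 / R d u) * dh u) * (1 / speed u)) (\<lambda>u. (1 * de u + 0 * dh u) * (1 / speed u))"
    by (intro conv_add conv_mult conv_Q conv_hT conv_const bdd_frame bdd_inverse_speed)
  show "\<forall>\<^sub>F d in at_top. \<forall>u\<in>{0..2 * pi}. ((d / R d u + e u * (1 / R d u)) * de u + h u * (1 / R d u) * dh u) * (1 / speed u)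
      = cos (phi (\<gamma> d) u - beta (\<gamma> d) u)"
    using R_nonzero by eventually_elim (auto simp: cos_sin_aspect add_divide_distrib distrib_right)
qed simp

lemma conv_sin_aspect: "conv (\<lambda>d u. sin (phi (\<gamma> d) u - beta (\<gamma> d) u)) (\<lambda>u. - dh u / speed u)"
proof (rule conv_cong)
  show "conv (\<lambda>d u. (h u * (1 / R d u) * de u - (d / R d u + e u * (1 / R d u)) * dh u) * (1 / speed u)) (\<lambda>u. (0 * de u - 1 * dh u) * (1 / speed u))"
    by (intro conv_diff conv_mult conv_Q conv_hT conv_const bdd_frame bdd_inverse_speed)
  show "\<forall>\<^sub>F d in at_top. \<forall>u\<in>{0..2 * pi}. (h u * (1 / R d u) * de u - (d / R d u + e u * (1 / R d u)) * dh u) * (1 / speed u)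
      = sin (phi (\<gamma> d) u - beta (\<gamma> d) u)"
    using R_nonzero by eventually_elim (auto simp: cos_sin_aspect add_divide_distrib diff_divide_distrib distrib_right)
qed simp

section \<open>Limits of the weights and of the gradient of the aspect angle\<close>

definition "w u = (max (- dh u / speed u) 0) powr (\<alpha> + 1)"
definition "v u = (max (- dh u / speed u) 0) powr \<alpha> * (de u / speed u)"

lemma finite_sin_zeros: "finite {u \<in> {0..2*pi}. - dh u / speed u = 0}"
  by (rule finite_subset[OF _ finite_dh_zeros]) (use less_imp_neq[OF speed_pos, symmetric] in auto)

lemma conv_w: "conv (wt_w \<alpha> \<circ> \<gamma>) w"
  unfolding wt_w_def[abs_def] w_def[abs_def] sin_pos_def comp_def
  by (rule conv_powr[OF conv_sin_aspect _ finite_sin_zeros]) (use \<alpha> in simp)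

lemma conv_v: "conv (wt_v \<alpha> \<circ> \<gamma>) v"
  unfolding wt_v_def[abs_def] v_def[abs_def] sin_pos_def comp_def
  by (intro conv_mult conv_cos_aspect conv_powr[OF conv_sin_aspect \<alpha> finite_sin_zeros])

definition "\<beta> i u = (de u * dd2 u i - dh u * dd1 u i) / (speed u)\<^sup>2"

lemma bdd_\<beta>: "bdd (\<beta> i)"
  unfolding \<beta>_def[abs_def]
  by (intro bdd_continuous continuous_intros continuous_on_frame continuous_on_dcoord)
    (use speed_pos in force)

lemma conv_grad_aspect: "conv (\<lambda>d u. grad_aspect (\<gamma> d) u $ i) (\<lambda>u. sel i - \<beta> i u)"
proof (rule conv_cong)
  show "conv (\<lambda>d u. grad_phi (\<gamma> d) u $ i - \<beta> i u) (\<lambda>u. sel i - \<beta> i u)"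
    by (intro conv_diff conv_grad_phi conv_const bdd_\<beta>)
qed (simp_all add: grad_aspect_def grad_beta_nth \<beta>_def)

lemma de_dh_combination:
  "f2 * de u + f1 * dh u = Y u" "f1 * de u - f2 * dh u = X u"
proof -
  have 1: "f1 * f1 + f2 * f2 = 1" using unit by (simp only: power2_eq_square)
  have "f2 * de u + f1 * dh u = (f1 * f1 + f2 * f2) * Y u" "f1 * de u - f2 * dh u = (f1 * f1 + f2 * f2) * X u"
    unfolding de_def dh_def by algebra+
  then show "f2 * de u + f1 * dh u = Y u" "f1 * de u - f2 * dh u = X u" by (simp_all only: 1 mult_1_left)
qed

text \<open>The velocity does not depend on the centre, and turning the target turns it by the same
  angle. For the coefficients, \<open>de_dh_combination\<close> undoes the frame and exposes the
  velocity components \<open>X\<close> and \<open>Y\<close>.\<close>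

lemma \<beta>_nth:
  "\<beta> (Inl 1) u = 0" "\<beta> (Inl 2) u = 0" "u \<in> {0..2*pi} \<Longrightarrow> \<beta> (Inl 3) u = 1"
  "\<beta> (Inr (Inl k)) u = - (Y u * dcos_vec u $ k) / (speed u)\<^sup>2"
  "\<beta> (Inr (Inr k)) u = X u * dsin_vec u $ k / (speed u)\<^sup>2"
proof -
  show "\<beta> (Inl 1) u = 0" "\<beta> (Inl 2) u = 0" by (simp_all add: \<beta>_def dcoord1_def dcoord2_def)
  have "dd2 u (Inl 3) = de u" "dd1 u (Inl 3) = - dh u"
    by (simp_all add: dcoord1_def dcoord2_def coord1_def coord2_def de_def dh_def)
  then show "u \<in> {0..2*pi} \<Longrightarrow> \<beta> (Inl 3) u = 1"
  proof -
    assume d: "dd2 u (Inl 3) = de u" "dd1 u (Inl 3) = - dh u" and that: "u \<in> {0..2*pi}"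
    have "(speed u)\<^sup>2 \<noteq> 0" using speed_pos[OF that] by simp
    moreover have "de u * de u - dh u * - dh u = (speed u)\<^sup>2"
      unfolding speed_sq' by (simp add: power2_eq_square)
    ultimately show ?thesis unfolding \<beta>_def d by (metis divide_self)
  qed
  have "de u * dd2 u (Inr (Inl k)) - dh u * dd1 u (Inr (Inl k)) = - ((f2 * de u + f1 * dh u) * dcos_vec u $ k)"
    by (simp add: dcoord1_def dcoord2_def algebra_simps)
  then show "\<beta> (Inr (Inl k)) u = - (Y u * dcos_vec u $ k) / (speed u)\<^sup>2"
    by (simp only: \<beta>_def de_dh_combination)
  have "de u * dd2 u (Inr (Inr k)) - dh u * dd1 u (Inr (Inr k)) = (f1 * de u - f2 * dh u) * dsin_vec u $ k"
    by (simp add: dcoord1_def dcoord2_def algebra_simps)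
  then show "\<beta> (Inr (Inr k)) u = X u * dsin_vec u $ k / (speed u)\<^sup>2"
    by (simp only: \<beta>_def de_dh_combination)
qed

lemma d1_nth: "d1 u (Inl 1) = 1" "d1 u (Inl 2) = 0" "d1 u (Inl 3) = - h u"
  "d1 u (Inr (Inl k)) = f1 * cos_vec u $ k" "d1 u (Inr (Inr k)) = f2 * sin_vec u $ k"
  by (simp_all add: dcoord1_def coord2_def h_def)

end

section \<open>The limiting information matrix\<close>

lemma (in contour_frame) dh_negative_interval:
  obtains c d where "c < d" "{c<..<d} \<subseteq> {0..2 * pi}" "\<And>u. u \<in> {c<..<d} \<Longrightarrow> dh u < 0"
proof -
  obtain u0 where u0: "u0 \<in> {0<..<2 * pi}" "dh u0 < 0" using dh_negative by blast
  have "open ({0<..<2 * pi} \<inter> dh -` {..<0})"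
    by (intro open_Int open_vimage continuous_on_frame) auto
  then obtain r where r: "r > 0" "ball u0 r \<subseteq> {0<..<2 * pi} \<inter> dh -` {..<0}"
    using u0 by (meson IntI lessThan_iff openE vimageI2)
  have "ball u0 r = {u0 - r<..<u0 + r}" by (auto simp: dist_real_def)
  with r show thesis by (intro that[of "u0 - r" "u0 + r"]) auto
qed

lemma sum_Plus_UNIV:
  fixes f :: "'a::finite + 'b::finite \<Rightarrow> 'c::comm_monoid_add"
  shows "(\<Sum>i\<in>UNIV. f i) = (\<Sum>k\<in>UNIV. f (Inl k)) + (\<Sum>k\<in>UNIV. f (Inr k))"
  by (simp add: UNIV_Plus_UNIV[symmetric] sum.Plus o_def del: UNIV_Plus_UNIV)

lemma (in weighted) ip_minus: "ip (\<lambda>u. - f u) g = - ip f g" "ip f (\<lambda>u. - g u) = - ip f g"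
  by (simp_all add: ip_def)

lemma (in weighted) ip_scale_scale: "ip (\<lambda>u. c * f u) (\<lambda>u. c * g u) = c\<^sup>2 * ip f g"
  by (simp add: ip_scale ip_commute[of f] power2_eq_square)

context asymptotics
begin

lemma conv_wt: "conv (\<lambda>d u. wt_w \<alpha> (\<gamma> d) u) w" "conv (\<lambda>d u. wt_v \<alpha> (\<gamma> d) u) v"
  using conv_w conv_v by (simp_all add: comp_def)

lemma bdd_wv: "bdd w" "bdd v"
  using conv_wt by (auto intro: conv_bdd)

lemma w_pos:
  assumes "u \<in> {0..2 * pi}" "dh u < 0" shows "w u > 0"
  using assms speed_pos[of u] by (simp add: w_def max_def divide_less_0_iff field_simps)

definition "nw = ip w w"

lemma nw_pos: "nw > 0"
proof (rule ccontr)
  assume "\<not> nw > 0"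
  then have "ip w w = 0" using ip_nonneg[of w] by (simp add: nw_def)
  then have neg: "negligible {u \<in> {0..2*pi}. w u \<noteq> 0}" by (rule ip_eq_0D[OF bdd_wv(1)])
  obtain c d where cd: "c < d" "{c<..<d} \<subseteq> {0..2 * pi}" "\<And>u. u \<in> {c<..<d} \<Longrightarrow> dh u < 0"
    by (rule dh_negative_interval) blast
  have "{c<..<d} - {u \<in> {0..2*pi}. w u \<noteq> 0} \<noteq> {}"
    using infinite_Ioo_diff_negligible[OF cd(1) neg] finite.emptyI by metis
  then obtain u where "u \<in> {c<..<d}" "u \<notin> {u \<in> {0..2*pi}. w u \<noteq> 0}" by blast
  then show False using cd(2) cd(3)[of u] w_pos[of u] by auto
qed

definition "mu i u = w u * (d1 u i + h u * sel i)"
definition "et i u = w u * cos \<phi>0 * sel i"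
definition "xi i = proj w (\<lambda>u. v u * (sel i - \<beta> i u))"

definition fim_limit :: "real \<Rightarrow> real \<Rightarrow> real^(3 + 'q + 'q)^(3 + 'q + 'q)" where
  "fim_limit L M = (\<chi> i j. (L * ip (mu i) (mu j) + M * ip (et i) (et j) + (\<alpha> + 1)\<^sup>2 * ip (xi i) (xi j)) / nw)"

text \<open>The factor \<open>2 * E / N\<^sub>0\<close> is taken out because it decays with the
  distance: the full matrix tends to 0 and could not be inverted in the limit.\<close>

definition fim_normalized :: "real \<Rightarrow> real \<Rightarrow> real \<Rightarrow> real^(3 + 'q + 'q)^(3 + 'q + 'q)" where
  "fim_normalized L M d = (\<chi> i j.
     (L * ip (\<lambda>u. wt_w \<alpha> (\<gamma> d) u * grad_dist (\<gamma> d) u $ i) (\<lambda>u. wt_w \<alpha> (\<gamma> d) u * grad_dist (\<gamma> d) u $ j)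
    + M * ip (\<lambda>u. wt_w \<alpha> (\<gamma> d) u * cos (phi (\<gamma> d) u) * grad_phi (\<gamma> d) u $ i)
             (\<lambda>u. wt_w \<alpha> (\<gamma> d) u * cos (phi (\<gamma> d) u) * grad_phi (\<gamma> d) u $ j)
    + (\<alpha> + 1)\<^sup>2 * ip (proj (wt_w \<alpha> (\<gamma> d)) (\<lambda>u. wt_v \<alpha> (\<gamma> d) u * grad_aspect (\<gamma> d) u $ i))
             (proj (wt_w \<alpha> (\<gamma> d)) (\<lambda>u. wt_v \<alpha> (\<gamma> d) u * grad_aspect (\<gamma> d) u $ j)))
     / ip (wt_w \<alpha> (\<gamma> d)) (wt_w \<alpha> (\<gamma> d)))"

lemma fim_eq: "fim L M E N\<^sub>0 \<alpha> (\<gamma> d) = (2 * E / N\<^sub>0) *\<^sub>R fim_normalized L M d"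
  by (simp add: vec_eq_iff fim_def Let_def star_mat_def star_eq star_norm_sq proj_perp_vec_nth fim_normalized_def)

lemma tendsto_nw: "((\<lambda>d. ip (wt_w \<alpha> (\<gamma> d)) (wt_w \<alpha> (\<gamma> d))) \<longlongrightarrow> nw) at_top"
  unfolding nw_def by (intro conv_ip conv_wt)

lemma tendsto_fim: "((\<lambda>d. fim_normalized L M d $ i $ j) \<longlongrightarrow> fim_limit L M $ i $ j) at_top"
proof -
  have nz: "nw \<noteq> 0" "ip w w \<noteq> 0" using nw_pos by (auto simp: nw_def)
  have "conv (\<lambda>d u. wt_w \<alpha> (\<gamma> d) u * grad_dist (\<gamma> d) u $ i) (mu i)" for i
    unfolding mu_def[abs_def] by (intro conv_mult conv_wt conv_grad_dist)
  moreover have "conv (\<lambda>d u. wt_w \<alpha> (\<gamma> d) u * cos (phi (\<gamma> d) u) * grad_phi (\<gamma> d) u $ i) (et i)" for i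
    unfolding et_def[abs_def] by (intro conv_mult conv_wt conv_grad_phi conv_cos_phi)
  moreover have "conv (\<lambda>d. proj (wt_w \<alpha> (\<gamma> d)) (\<lambda>u. wt_v \<alpha> (\<gamma> d) u * grad_aspect (\<gamma> d) u $ i)) (xi i)" for i
    unfolding xi_def by (intro conv_proj conv_mult conv_wt conv_grad_aspect nz)
  ultimately show ?thesis
    unfolding fim_normalized_def fim_limit_def vec_lambda_beta
    by (intro tendsto_intros conv_ip tendsto_nw nz)
qed

lemma bdd_profiles: "bdd (mu i)" "bdd (et i)" "bdd (xi i)"
  unfolding mu_def[abs_def] et_def[abs_def] xi_def
  by (intro bdd_proj bdd_intros bdd_wv bdd_frame bdd_dcoord bdd_\<beta>)+

lemma fim_limit_form:
  fixes x :: "real^(3 + 'q + 'q)"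
  shows "x \<bullet> (fim_limit L M *v x) =
    (L * ip (\<lambda>u. \<Sum>i\<in>UNIV. x $ i * mu i u) (\<lambda>u. \<Sum>i\<in>UNIV. x $ i * mu i u)
     + M * ip (\<lambda>u. \<Sum>i\<in>UNIV. x $ i * et i u) (\<lambda>u. \<Sum>i\<in>UNIV. x $ i * et i u)
     + (\<alpha> + 1)\<^sup>2 * ip (\<lambda>u. \<Sum>i\<in>UNIV. x $ i * xi i u) (\<lambda>u. \<Sum>i\<in>UNIV. x $ i * xi i u)) / nw"
proof -
  have "fim_limit L M = (1 / nw) *\<^sub>R (L *\<^sub>R (\<chi> i j. ip (mu i) (mu j)) + M *\<^sub>R (\<chi> i j. ip (et i) (et j))
     + (\<alpha> + 1)\<^sup>2 *\<^sub>R (\<chi> i j. ip (xi i) (xi j)))"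
    by (simp add: vec_eq_iff fim_limit_def)
  then show ?thesis
    by (simp add: matrix_vector_mult_add_rdistrib scaleR_matrix_vector_assoc[symmetric] inner_add_right
       gram_form bdd_profiles)
qed

text \<open>If the form is not positive, its three nonnegative terms vanish. \<open>F2\<close> gives
  the bearing component, \<open>F1\<close> says that the range is unchanged, and \<open>F3\<close>
  that the weighted change of aspect is a multiple of the weight; \<open>rigidity\<close> applies to
  the last two.\<close>

lemma fim_limit_pos_def:
  fixes x :: "real^(3 + 'q + 'q)"
  assumes L: "L > 0" and M: "M > 0" and c: "cos \<phi>0 \<noteq> 0" and x: "x \<noteq> 0"
  shows "x \<bullet> (fim_limit L M *v x) > 0"
proof (rule ccontr)
  define F1 F2 F3 where "F1 u = (\<Sum>i\<in>UNIV. x $ i * mu i u)" and "F2 u = (\<Sum>i\<in>UNIV. x $ i * et i u)"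
    and "F3 u = (\<Sum>i\<in>UNIV. x $ i * xi i u)" for u
  assume "\<not> x \<bullet> (fim_limit L M *v x) > 0"
  then have "L * ip F1 F1 + M * ip F2 F2 + (\<alpha> + 1)\<^sup>2 * ip F3 F3 \<le> 0"
    unfolding fim_limit_form F1_def[symmetric] F2_def[symmetric] F3_def[symmetric]
    using nw_pos by (simp add: zero_less_divide_iff not_less)
  moreover have "L * ip F1 F1 \<ge> 0" "M * ip F2 F2 \<ge> 0" "(\<alpha> + 1)\<^sup>2 * ip F3 F3 \<ge> 0"
    using L M ip_nonneg by auto
  ultimately have "L * ip F1 F1 = 0" "M * ip F2 F2 = 0" "(\<alpha> + 1)\<^sup>2 * ip F3 F3 = 0" by linarith+
  then have zero: "ip F1 F1 = 0" "ip F2 F2 = 0" "ip F3 F3 = 0" using L M \<alpha> by auto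
  have bdd: "bdd F1" "bdd F3"
    unfolding F1_def[abs_def] F3_def[abs_def] by (intro bdd_intros bdd_profiles)+
  define S where "S u = (\<Sum>i\<in>UNIV. x $ i * (v u * (sel i - \<beta> i u)))" for u
  have F3: "F3 u = proj w S u" for u
    unfolding F3_def S_def xi_def
    by (rule proj_sum[symmetric]) (auto intro!: bdd_intros bdd_wv bdd_\<beta>)
  have "F2 = (\<lambda>u. (x $ Inl 2 * cos \<phi>0) * w u)"
    by (simp add: F2_def[abs_def] et_def sel_def sum_3_Plus fun_eq_iff)
  then have "(x $ Inl 2 * cos \<phi>0)\<^sup>2 * nw = 0"
    using zero(2) by (simp add: ip_scale_scale nw_def)
  then have x2: "x $ Inl 2 = 0" using nw_pos c by simp
  define z z' where "z = (\<chi> k. x $ Inr (Inl k))" and "z' = (\<chi> k. x $ Inr (Inr k))"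
  \<comment> \<open>The change of bearing relative to the orientation, the only combination of the
    two that range and aspect see.\<close>
  define y where "y = x $ Inl 2 - x $ Inl 3"
  obtain c d where cd: "c < d" "{c<..<d} \<subseteq> {0..2 * pi}" "\<And>u. u \<in> {c<..<d} \<Longrightarrow> dh u < 0"
    by (rule dh_negative_interval) blast
  \<comment> \<open>\<open>F1\<close> and \<open>F3\<close> vanish only almost everywhere; removing
    two null sets from an illuminated interval leaves infinitely many points.\<close>
  define T where "T = {c<..<d} - ({u \<in> {0..2*pi}. F1 u \<noteq> 0} \<union> {u \<in> {0..2*pi}. F3 u \<noteq> 0})"
  have inf: "infinite T"
    unfolding T_def by (intro infinite_Ioo_diff_negligible cd negligible_Un ip_eq_0D bdd zero)
  \<comment> \<open>The coefficient of the projection: \<open>F3 u = 0\<close> reads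
    \<open>S u = \<kappa> * w u\<close>.\<close>
  define \<kappa> where "\<kappa> = ip S w / ip w w"
  have T: "u \<in> {0..2*pi}" "dh u < 0" "F1 u = 0" "F3 u = 0" if "u \<in> T" for u
    using that cd by (auto simp: T_def)
  have range_eq: "x $ Inl 1 + h u * y + (f1 * (cos_vec u \<bullet> z) + f2 * (sin_vec u \<bullet> z')) = 0" if "u \<in> T" for u
  proof -
    have "F1 u = w u * (x $ Inl 1 + h u * y + (f1 * (cos_vec u \<bullet> z) + f2 * (sin_vec u \<bullet> z')))"
      by (simp add: F1_def mu_def sum_3_Plus sum_Plus_UNIV sel_def d1_nth y_def z_def z'_def inner_vec_def
          sum_distrib_left algebra_simps)
    then show ?thesis using T(3)[OF that] w_pos[OF T(1,2)[OF that]] by simp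
  qed
  have aspect_eq: "de u * ((speed u)\<^sup>2 * y + Y u * (dcos_vec u \<bullet> z) - X u * (dsin_vec u \<bullet> z')) + \<kappa> * dh u * (speed u)\<^sup>2 = 0"
    if "u \<in> T" for u
  proof -
    note u = T[OF that]
    define s where "s = - dh u / speed u"
    have s: "s > 0" "speed u > 0" using u speed_pos[of u] by (simp_all add: s_def field_simps)
    define Q where "Q = y + (Y u * (dcos_vec u \<bullet> z) - X u * (dsin_vec u \<bullet> z')) / (speed u)\<^sup>2"
    have "S u = v u * Q"
      using u(1) by (simp add: S_def sum_3_Plus sum_Plus_UNIV sel_def \<beta>_nth y_def z_def z'_def inner_vec_def Q_def
          sum_distrib_left sum_divide_distrib sum_negf algebra_simps diff_divide_distrib add_divide_distrib)
    moreover have "S u = \<kappa> * w u" using u(4) unfolding F3 proj_def \<kappa>_def by simp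
    moreover have "v u = s powr \<alpha> * (de u / speed u)" "w u = s powr \<alpha> * s"
      unfolding v_def w_def s_def[symmetric] using s by (simp_all add: powr_add)
    \<comment> \<open>On the illuminated part \<open>s\<close> is positive, so the common power
      cancels, also for \<alpha> = 0, and an identity between trigonometric polynomials results
      after clearing the speed.\<close>
    ultimately have "s powr \<alpha> * (de u / speed u * Q) = s powr \<alpha> * (\<kappa> * s)" by (simp add: mult_ac)
    moreover have "s powr \<alpha> \<noteq> 0" using s by simp
    ultimately have "de u / speed u * Q = \<kappa> * s" by (metis mult_left_cancel)
    then have "de u * Q = - \<kappa> * dh u" using s by (simp add: s_def field_simps)
    then have "de u * (Q * (speed u)\<^sup>2) = - \<kappa> * dh u * (speed u)\<^sup>2" by (simp add: mult.assoc[symmetric])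
    moreover have "Q * (speed u)\<^sup>2 = (speed u)\<^sup>2 * y + Y u * (dcos_vec u \<bullet> z) - X u * (dsin_vec u \<bullet> z')"
      unfolding Q_def distrib_right using s by simp
    ultimately show ?thesis by simp
  qed
  have "T \<subseteq> {0..2*pi}" using T(1) by blast
  note rig = rigidity[OF inf this range_eq aspect_eq]
  \<comment> \<open>\<open>rigidity\<close> yields only the difference \<open>y = 0\<close>;
    together with \<open>x2\<close> it gives the orientation component.\<close>
  have "x $ Inl 1 = 0" "x $ Inl 3 = 0" "\<And>k. x $ Inr (Inl k) = 0" "\<And>k. x $ Inr (Inr k) = 0"
    using rig x2 by (simp_all add: y_def z_def z'_def vec_eq_iff)
  then have "x $ i = 0" for i by (cases i rule: index_cases) (simp_all add: x2)
  then show False using x by (simp add: vec_eq_iff)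
qed


section \<open>Blocks of the limiting matrix and their counterparts at finite distance\<close>

definition "A_lim L = L * ip w (\<lambda>u. w u * h u) / nw"
definition "B_lim L = (L * ip (\<lambda>u. w u * h u) (\<lambda>u. w u * h u) + (\<alpha> + 1)\<^sup>2 * ip (proj w v) (proj w v)) / nw"

definition c_lim :: "real \<Rightarrow> (real, 'q + 'q) vec" where
  "c_lim L = (\<chi> k. L * ip (\<lambda>u. w u * d1 u (Inr k)) w / nw)"

definition q_lim :: "real \<Rightarrow> (real, 'q + 'q) vec" where
  "q_lim L = (\<chi> k. (L * ip (\<lambda>u. w u * d1 u (Inr k)) (\<lambda>u. w u * h u)
     + (\<alpha> + 1)\<^sup>2 * ip (proj w (\<lambda>u. v u * - \<beta> (Inr k) u)) (proj w v)) / nw)"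

definition T_lim :: "real \<Rightarrow> ((real, 'q + 'q) vec, 'q + 'q) vec" where
  "T_lim L = (\<chi> k l. (L * ip (\<lambda>u. w u * d1 u (Inr k)) (\<lambda>u. w u * d1 u (Inr l))
     + (\<alpha> + 1)\<^sup>2 * ip (proj w (\<lambda>u. v u * - \<beta> (Inr k) u)) (proj w (\<lambda>u. v u * - \<beta> (Inr l) u))) / nw)"

lemma mu_nth: "mu (Inl 1) = w" "mu (Inl 2) = (\<lambda>u. w u * h u)" "mu (Inl 3) = (\<lambda>u. - (w u * h u))"
  "mu (Inr k) = (\<lambda>u. w u * d1 u (Inr k))"
  by (simp_all add: mu_def fun_eq_iff d1_nth sel_def)

lemma et_nth: "et (Inl 1) = (\<lambda>u. 0)" "et (Inl 2) = (\<lambda>u. cos \<phi>0 * w u)" "et (Inl 3) = (\<lambda>u. 0)"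
  "et (Inr k) = (\<lambda>u. 0)"
  by (simp_all add: et_def fun_eq_iff sel_def)

lemma ip_0: "ip (\<lambda>u. 0) f = 0" "ip f (\<lambda>u. 0) = 0"
  by (simp_all add: ip_def)

text \<open>Bearing and orientation shift the aspect angle by opposite unit amounts. For the
  orientation this is claimed on the interval only, where the speed is known to be positive.\<close>

lemma xi_nth: "xi (Inl 1) = (\<lambda>u. 0)" "xi (Inl 2) = proj w v"
  "u \<in> {0..2 * pi} \<Longrightarrow> xi (Inl 3) u = - proj w v u"
  "xi (Inr k) = proj w (\<lambda>u. v u * - \<beta> (Inr k) u)"
proof -
  assume u: "u \<in> {0..2 * pi}"
  have "ip (\<lambda>u. v u * (sel (Inl 3) - \<beta> (Inl 3) u)) w = ip (\<lambda>u. - v u) w"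
    by (rule ip_cong) (simp_all add: sel_def \<beta>_nth)
  then show "xi (Inl 3) u = - proj w v u"
    using u by (simp add: xi_def proj_def sel_def \<beta>_nth ip_minus)
qed (simp_all add: xi_def fun_eq_iff sel_def \<beta>_nth proj_def ip_0)

lemma ip_xi_3: "ip (xi (Inl 3)) f = - ip (proj w v) f" "ip f (xi (Inl 3)) = - ip f (proj w v)"
proof -
  show "ip (xi (Inl 3)) f = - ip (proj w v) f"
    unfolding ip_minus[symmetric] by (rule ip_cong) (simp_all add: xi_nth)
  then show "ip f (xi (Inl 3)) = - ip f (proj w v)" by (simp add: ip_commute[of f])
qed

text \<open>In range and aspect the orientation acts as the negative of the bearing, which explains
  the signs of its row and column. The antenna term contributes only at
  \<open>(Inl 2, Inl 2)\<close>, where it gives \<open>Z\<close>.\<close>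

lemma block_matrix_fim_limit:
  assumes L: "L > 0" and M: "M > 0" and c: "cos \<phi>0 \<noteq> 0"
  shows "block_matrix (fim_limit L M) L (A_lim L) (B_lim L) (M * (cos \<phi>0)\<^sup>2) (c_lim L) (q_lim L) (T_lim L)"
proof
  have nw: "ip w w = nw" "nw \<noteq> 0" using nw_pos by (auto simp: nw_def)
  have ets: "ip (\<lambda>u. cos \<phi>0 * w u) (\<lambda>u. cos \<phi>0 * w u) = (cos \<phi>0)\<^sup>2 * nw"
    by (simp add: ip_scale_scale nw)
  note K = fim_limit_def mu_nth et_nth xi_nth(1,2,4) ip_xi_3 ip_0 ip_minus A_lim_def B_lim_def c_lim_def q_lim_def ets nw
  show "x \<bullet> (fim_limit L M *v x) > 0" if "x \<noteq> 0" for x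
    using fim_limit_pos_def[OF L M c that] .
  show "fim_limit L M $ Inl 1 $ Inl 1 = L" "fim_limit L M $ Inl 1 $ Inl 2 = A_lim L"
    "fim_limit L M $ Inl 1 $ Inl 3 = - A_lim L" "(\<chi> k. fim_limit L M $ Inl 1 $ Inr k) = c_lim L"
    by (simp_all add: K vec_eq_iff) (simp_all add: ip_commute)
  show "fim_limit L M $ Inl 2 $ Inl 1 = A_lim L" "fim_limit L M $ Inl 2 $ Inl 2 = B_lim L + M * (cos \<phi>0)\<^sup>2"
    "fim_limit L M $ Inl 2 $ Inl 3 = - B_lim L" "(\<chi> k. fim_limit L M $ Inl 2 $ Inr k) = q_lim L"
    by (simp_all add: K vec_eq_iff add_divide_distrib ip_commute)
  show "fim_limit L M $ Inl 3 $ Inl 1 = - A_lim L" "fim_limit L M $ Inl 3 $ Inl 2 = - B_lim L"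
    "fim_limit L M $ Inl 3 $ Inl 3 = B_lim L" "(\<chi> k. fim_limit L M $ Inl 3 $ Inr k) = - q_lim L"
    by (simp_all add: K vec_eq_iff add_divide_distrib diff_divide_distrib ip_commute)
  show "fim_limit L M $ Inr k $ Inl 1 = c_lim L $ k" "fim_limit L M $ Inr k $ Inl 2 = q_lim L $ k"
    "fim_limit L M $ Inr k $ Inl 3 = - q_lim L $ k" for k
    by (simp_all add: K vec_eq_iff add_divide_distrib diff_divide_distrib)
  show "(\<chi> k l. fim_limit L M $ Inr k $ Inr l) = T_lim L"
    by (simp add: K T_lim_def vec_eq_iff)
  show "transpose (T_lim L) = T_lim L"
    by (simp add: transpose_def T_lim_def vec_eq_iff ip_commute)
  show "M * (cos \<phi>0)\<^sup>2 > 0" using M c by simp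
qed

lemma w_bar_eq: "w_bar \<alpha> (\<gamma> d) u = 1 / sqrt (ip (wt_w \<alpha> (\<gamma> d)) (wt_w \<alpha> (\<gamma> d))) * wt_w \<alpha> (\<gamma> d) u"
  by (simp add: w_bar_def star_norm_def star_eq)

lemma ip_w_bar:
  "ip (\<lambda>u. w_bar \<alpha> (\<gamma> d) u * f u) (\<lambda>u. w_bar \<alpha> (\<gamma> d) u * g u)
    = ip (\<lambda>u. wt_w \<alpha> (\<gamma> d) u * f u) (\<lambda>u. wt_w \<alpha> (\<gamma> d) u * g u) / ip (wt_w \<alpha> (\<gamma> d)) (wt_w \<alpha> (\<gamma> d))"
  unfolding w_bar_eq mult.assoc ip_scale_scale by (simp add: power_divide ip_nonneg)

lemma frame_vectors:
  assumes "d > 0"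
  shows "p_bar_perp (\<gamma> d) \<bullet> (R_mat (\<gamma> d) *v rho (\<gamma> d) u) = h u"
    "(transpose (R_mat (\<gamma> d)) *v p_bar (\<gamma> d)) $ 1 = f1" "(transpose (R_mat (\<gamma> d)) *v p_bar (\<gamma> d)) $ 2 = f2"
proof -
  have c: "centre (\<gamma> d) = d *\<^sub>R vector [cos \<phi>0, sin \<phi>0]" by (simp add: centre_def)
  have n: "norm (vector [cos \<phi>0, sin \<phi>0] :: real^2) = 1" "norm (vector [- sin \<phi>0, cos \<phi>0] :: real^2) = 1"
    by (simp_all add: norm_2)
  have "perp (centre (\<gamma> d)) = d *\<^sub>R vector [- sin \<phi>0, cos \<phi>0]"
    by (simp add: c perp_def vec_eq_iff forall_2 matrix_vector_mult_def sum_2)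
  then have pp: "p_bar_perp (\<gamma> d) = vector [- sin \<phi>0, cos \<phi>0]" and p: "p_bar (\<gamma> d) = vector [cos \<phi>0, sin \<phi>0]"
    using assms by (simp_all add: p_bar_perp_def p_bar_def c n)
  show "p_bar_perp (\<gamma> d) \<bullet> (R_mat (\<gamma> d) *v rho (\<gamma> d) u) = h u"
    unfolding h_def unfolding cos_diff sin_diff
    by (simp add: pp R_mat_def rot_def rho_def contour_def inner_vec_def[where 'b=2] sum_2 matrix_vector_mult_def
        algebra_simps)
  show "(transpose (R_mat (\<gamma> d)) *v p_bar (\<gamma> d)) $ 1 = f1" "(transpose (R_mat (\<gamma> d)) *v p_bar (\<gamma> d)) $ 2 = f2"
    by (simp_all add: p R_mat_def rot_def transpose_def matrix_vector_mult_def sum_2 cos_diff sin_diff mult.commute)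
qed

lemma wpR_rho_eq: "d > 0 \<Longrightarrow> wpR_rho \<alpha> (\<gamma> d) = (\<lambda>u. w_bar \<alpha> (\<gamma> d) u * h u)"
  by (simp add: wpR_rho_def fun_eq_iff frame_vectors)

lemma ws_vec_nth:
  assumes "d > 0"
  shows "ws_vec \<alpha> (\<gamma> d) u $ k = w_bar \<alpha> (\<gamma> d) u * d1 u (Inr k)"
  unfolding ws_vec_def s_vec_def frame_vectors(2,3)[OF assms] by (cases k) (simp_all add: d1_nth)

text \<open>The bearing of a contour point has limiting gradient 0 in the coefficients, so the
  aspect gradient reduces to minus that of the velocity angle; \<open>t_vec\<close> is built from
  it.\<close>

lemma t_vec_nth: "t_vec \<alpha> (\<gamma> d) u $ k = proj (wt_w \<alpha> (\<gamma> d)) (\<lambda>u. wt_v \<alpha> (\<gamma> d) u * - \<beta> (Inr k) u) u"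
  by (cases k) (simp_all add: t_vec_def proj_perp_vec_nth norm_dot_rho dot_harmonics \<beta>_nth mult_ac)

text \<open>Like the blocks below, this combines weights at distance \<open>d\<close> with gradients
  already in their limiting form, so only the weights remain to converge.\<close>

lemma A_qty_eq:
  assumes "d > 0"
  shows "A_qty L \<alpha> (\<gamma> d) = L * ip (wt_w \<alpha> (\<gamma> d)) (\<lambda>u. wt_w \<alpha> (\<gamma> d) u * h u) / ip (wt_w \<alpha> (\<gamma> d)) (wt_w \<alpha> (\<gamma> d))"
  using ip_w_bar[of d "\<lambda>u. 1" h] by (simp add: A_qty_def star_eq wpR_rho_eq assms)

lemma B_qty_eq:
  assumes "d > 0"
  shows "B_qty L \<alpha> (\<gamma> d) = (L * ip (\<lambda>u. wt_w \<alpha> (\<gamma> d) u * h u) (\<lambda>u. wt_w \<alpha> (\<gamma> d) u * h u)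
    + (\<alpha> + 1)\<^sup>2 * ip (proj (wt_w \<alpha> (\<gamma> d)) (wt_v \<alpha> (\<gamma> d))) (proj (wt_w \<alpha> (\<gamma> d)) (wt_v \<alpha> (\<gamma> d))))
    / ip (wt_w \<alpha> (\<gamma> d)) (wt_w \<alpha> (\<gamma> d))"
  by (simp add: B_qty_def star_norm_sq wpR_rho_eq assms ip_w_bar proj_perp_eq add_divide_distrib)

lemma c_vec_nth:
  assumes "d > 0"
  shows "c_vec L \<alpha> (\<gamma> d) $ k = L * ip (\<lambda>u. wt_w \<alpha> (\<gamma> d) u * d1 u (Inr k)) (wt_w \<alpha> (\<gamma> d)) / ip (wt_w \<alpha> (\<gamma> d)) (wt_w \<alpha> (\<gamma> d))"
  using ip_w_bar[of d "\<lambda>u. d1 u (Inr k)" "\<lambda>u. 1"]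
  by (simp add: c_vec_def star_vec_def star_eq ws_vec_nth assms)

lemma q_vec_nth:
  assumes "d > 0"
  shows "q_vec L \<alpha> (\<gamma> d) $ k = (L * ip (\<lambda>u. wt_w \<alpha> (\<gamma> d) u * d1 u (Inr k)) (\<lambda>u. wt_w \<alpha> (\<gamma> d) u * h u)
    + (\<alpha> + 1)\<^sup>2 * ip (proj (wt_w \<alpha> (\<gamma> d)) (\<lambda>u. wt_v \<alpha> (\<gamma> d) u * - \<beta> (Inr k) u)) (proj (wt_w \<alpha> (\<gamma> d)) (wt_v \<alpha> (\<gamma> d))))
    / ip (wt_w \<alpha> (\<gamma> d)) (wt_w \<alpha> (\<gamma> d))"
  using ip_w_bar[of d "\<lambda>u. d1 u (Inr k)" h]
  by (simp add: q_vec_def star_vec_def star_eq ws_vec_nth t_vec_nth wpR_rho_eq assms star_norm_sq proj_perp_eq add_divide_distrib)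

lemma T22_nth:
  assumes "d > 0"
  shows "T22 L \<alpha> (\<gamma> d) $ k $ l = (L * ip (\<lambda>u. wt_w \<alpha> (\<gamma> d) u * d1 u (Inr k)) (\<lambda>u. wt_w \<alpha> (\<gamma> d) u * d1 u (Inr l))
    + (\<alpha> + 1)\<^sup>2 * ip (proj (wt_w \<alpha> (\<gamma> d)) (\<lambda>u. wt_v \<alpha> (\<gamma> d) u * - \<beta> (Inr k) u))
        (proj (wt_w \<alpha> (\<gamma> d)) (\<lambda>u. wt_v \<alpha> (\<gamma> d) u * - \<beta> (Inr l) u)))
    / ip (wt_w \<alpha> (\<gamma> d)) (wt_w \<alpha> (\<gamma> d))"
  using ip_w_bar[of d "\<lambda>u. d1 u (Inr k)" "\<lambda>u. d1 u (Inr l)"]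
  by (simp add: T22_def star_mat_def star_eq ws_vec_nth t_vec_nth assms star_norm_sq add_divide_distrib)

lemma tendsto_eventually_eq:
  fixes f g :: "real \<Rightarrow> real"
  assumes "(g \<longlongrightarrow> l) at_top" "\<And>d. d > 0 \<Longrightarrow> f d = g d"
  shows "(f \<longlongrightarrow> l) at_top"
  by (rule Lim_transform_eventually[OF assms(1)])
    (use eventually_gt_at_top[of 0] in eventually_elim, simp add: assms(2))

lemma tendsto_blocks:
  "((\<lambda>d. A_qty L \<alpha> (\<gamma> d)) \<longlongrightarrow> A_lim L) at_top"
  "((\<lambda>d. B_qty L \<alpha> (\<gamma> d)) \<longlongrightarrow> B_lim L) at_top"
  "((\<lambda>d. c_vec L \<alpha> (\<gamma> d) $ k) \<longlongrightarrow> c_lim L $ k) at_top"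
  "((\<lambda>d. q_vec L \<alpha> (\<gamma> d) $ k) \<longlongrightarrow> q_lim L $ k) at_top"
  "((\<lambda>d. T22 L \<alpha> (\<gamma> d) $ k $ l) \<longlongrightarrow> T_lim L $ k $ l) at_top"
proof -
  have nz: "nw \<noteq> 0" "ip w w \<noteq> 0" using nw_pos by (auto simp: nw_def)
  have h: "conv (\<lambda>d u. wt_w \<alpha> (\<gamma> d) u * h u) (\<lambda>u. w u * h u)"
    by (intro conv_mult conv_wt conv_const bdd_frame)
  have s: "conv (\<lambda>d u. wt_w \<alpha> (\<gamma> d) u * d1 u (Inr k)) (\<lambda>u. w u * d1 u (Inr k))" for k
    by (intro conv_mult conv_wt conv_const bdd_dcoord)
  have v: "conv (\<lambda>d. proj (wt_w \<alpha> (\<gamma> d)) (wt_v \<alpha> (\<gamma> d))) (proj w v)"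
    by (intro conv_proj conv_wt nz)
  have t: "conv (\<lambda>d. proj (wt_w \<alpha> (\<gamma> d)) (\<lambda>u. wt_v \<alpha> (\<gamma> d) u * - \<beta> (Inr k) u)) (proj w (\<lambda>u. v u * - \<beta> (Inr k) u))" for k
    by (intro conv_proj conv_mult conv_minus conv_const conv_wt nz bdd_\<beta>)
  note intros = tendsto_divide tendsto_add tendsto_mult tendsto_const conv_ip h s v t conv_wt tendsto_nw nz
  show "((\<lambda>d. A_qty L \<alpha> (\<gamma> d)) \<longlongrightarrow> A_lim L) at_top"
    by (rule tendsto_eventually_eq[OF _ A_qty_eq]) (unfold A_lim_def, intro intros)
  show "((\<lambda>d. B_qty L \<alpha> (\<gamma> d)) \<longlongrightarrow> B_lim L) at_top"
    by (rule tendsto_eventually_eq[OF _ B_qty_eq]) (unfold B_lim_def, intro intros)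
  show "((\<lambda>d. c_vec L \<alpha> (\<gamma> d) $ k) \<longlongrightarrow> c_lim L $ k) at_top"
    by (rule tendsto_eventually_eq[OF _ c_vec_nth]) (unfold c_lim_def vec_lambda_beta, intro intros)
  show "((\<lambda>d. q_vec L \<alpha> (\<gamma> d) $ k) \<longlongrightarrow> q_lim L $ k) at_top"
    by (rule tendsto_eventually_eq[OF _ q_vec_nth]) (unfold q_lim_def vec_lambda_beta, intro intros)
  show "((\<lambda>d. T22 L \<alpha> (\<gamma> d) $ k $ l) \<longlongrightarrow> T_lim L $ k $ l) at_top"
    by (rule tendsto_eventually_eq[OF _ T22_nth]) (unfold T_lim_def vec_lambda_beta, intro intros)
qed

end

section \<open>The bound\<close>

lemma tendsto_inner_matrix:
  fixes x y :: "'a \<Rightarrow> real^'n" and A :: "'a \<Rightarrow> real^'n^'n"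
  assumes "\<And>k. ((\<lambda>d. x d $ k) \<longlongrightarrow> x0 $ k) F" "\<And>k. ((\<lambda>d. y d $ k) \<longlongrightarrow> y0 $ k) F"
    "\<And>k l. ((\<lambda>d. A d $ k $ l) \<longlongrightarrow> A0 $ k $ l) F"
  shows "((\<lambda>d. x d \<bullet> (A d *v y d)) \<longlongrightarrow> x0 \<bullet> (A0 *v y0)) F"
  unfolding inner_vec_def matrix_vector_mult_def inner_real_def vec_lambda_beta
  by (intro tendsto_intros assms)

text \<open>The scalars share the numerator \<Delta>: \<open>C_qty\<close> is
  \<open>\<Delta> / r\<close>, \<open>F_qty\<close> is \<open>\<Delta> / p\<close> and, for nonzero
  \<open>x\<close>, \<open>D_qty\<close> is \<open>- \<Delta> / x\<close>. Thus
  \<open>- D_inv\<close> is \<open>x / \<Delta>\<close> in all cases, which explains its value 0 at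
  \<open>x = 0\<close>.\<close>

lemma U_mat_nth:
  assumes "L - H_qty L \<alpha> \<gamma> \<noteq> 0" "B_qty L \<alpha> \<gamma> - I_qty L \<alpha> \<gamma> \<noteq> 0"
    and \<Delta>: "\<Delta> = (L - H_qty L \<alpha> \<gamma>) * (B_qty L \<alpha> \<gamma> - I_qty L \<alpha> \<gamma>) - (A_qty L \<alpha> \<gamma> - J_qty L \<alpha> \<gamma>)\<^sup>2" "\<Delta> \<noteq> 0"
  shows "C_qty L \<alpha> \<gamma> \<noteq> 0" "F_qty L \<alpha> \<gamma> \<noteq> 0"
    "U_mat L Z \<alpha> \<gamma> = vector
     [vector [(B_qty L \<alpha> \<gamma> - I_qty L \<alpha> \<gamma>) / \<Delta>, 0, (A_qty L \<alpha> \<gamma> - J_qty L \<alpha> \<gamma>) / \<Delta>],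
      vector [0, inverse Z, inverse Z],
      vector [(A_qty L \<alpha> \<gamma> - J_qty L \<alpha> \<gamma>) / \<Delta>, inverse Z, inverse Z + (L - H_qty L \<alpha> \<gamma>) / \<Delta>]]"
proof -
  define p r x where "p = L - H_qty L \<alpha> \<gamma>" and "r = B_qty L \<alpha> \<gamma> - I_qty L \<alpha> \<gamma>" and "x = A_qty L \<alpha> \<gamma> - J_qty L \<alpha> \<gamma>"
  have nz: "p \<noteq> 0" "r \<noteq> 0" and D: "\<Delta> = p * r - x\<^sup>2" using assms by (simp_all add: p_def r_def x_def)
  have C: "C_qty L \<alpha> \<gamma> = \<Delta> / r" and F: "F_qty L \<alpha> \<gamma> = \<Delta> / p"
    using nz by (simp_all add: C_qty_def F_qty_def flip: p_def r_def x_def) (simp_all add: D field_simps)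
  show "C_qty L \<alpha> \<gamma> \<noteq> 0" "F_qty L \<alpha> \<gamma> \<noteq> 0" using nz \<Delta> by (simp_all add: C F)
  have Di: "- D_inv L \<alpha> \<gamma> = x / \<Delta>"
  proof (cases "x = 0")
    case False
    then have "D_qty L \<alpha> \<gamma> = - \<Delta> / x"
      by (simp add: D_qty_def flip: p_def r_def x_def) (simp add: D field_simps power2_eq_square)
    then show ?thesis using False by (simp add: D_inv_def flip: x_def)
  qed (simp add: D_inv_def flip: x_def)
  show "U_mat L Z \<alpha> \<gamma> = vector
     [vector [(B_qty L \<alpha> \<gamma> - I_qty L \<alpha> \<gamma>) / \<Delta>, 0, (A_qty L \<alpha> \<gamma> - J_qty L \<alpha> \<gamma>) / \<Delta>],
      vector [0, inverse Z, inverse Z],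
      vector [(A_qty L \<alpha> \<gamma> - J_qty L \<alpha> \<gamma>) / \<Delta>, inverse Z, inverse Z + (L - H_qty L \<alpha> \<gamma>) / \<Delta>]]"
    unfolding U_mat_def C F Di by (simp flip: p_def r_def x_def)
qed

context asymptotics
begin

text \<open>With the energy factor taken out, both matrices have the pose block of
  \<open>matrix_inv (fim_limit L M)\<close> as limit. The inverse of that factor is
  \<open>d ^ 4\<close> times a convergent function, so the error is \<open>d ^ 4\<close> times a
  function tending to 0.\<close>

lemma hcrb_asymptotics:
  fixes E :: "real \<Rightarrow> real"
  assumes L: "L > 0" and M: "M > 0" and c: "cos \<phi>0 \<noteq> 0" and N: "N \<ge> 1" and N0: "N\<^sub>0 > 0" and G: "G > 0"
    and Z: "Z = M * (cos \<phi>0)\<^sup>2"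
    and E: "E = (\<lambda>d. energy G N \<alpha> (\<gamma> d))"
    and J: "J = (\<lambda>d. fim L M (E d) N\<^sub>0 \<alpha> (\<gamma> d))"
  shows "\<forall>\<^sub>F d in at_top.
            invertible (J d) \<and> invertible (T22 L \<alpha> (\<gamma> d)) \<and>
            B_qty L \<alpha> (\<gamma> d) - I_qty L \<alpha> (\<gamma> d) \<noteq> 0 \<and> L - H_qty L \<alpha> (\<gamma> d) \<noteq> 0 \<and>
            C_qty L \<alpha> (\<gamma> d) \<noteq> 0 \<and> F_qty L \<alpha> (\<gamma> d) \<noteq> 0"
    and "(\<lambda>d. (hcrb (J d) - inverse (2 * E d / N\<^sub>0) *\<^sub>R U_mat L Z \<alpha> (\<gamma> d)) $ i $ j) \<in> o[at_top](\<lambda>d. d ^ 4)"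
proof -
  interpret K: block_matrix "fim_limit L M" L "A_lim L" "B_lim L" "M * (cos \<phi>0)\<^sup>2" "c_lim L" "q_lim L" "T_lim L"
    by (rule block_matrix_fim_limit[OF L M c])
  note K_pos = K.schur_nonzero
  have T: "\<forall>\<^sub>F d in at_top. invertible (T22 L \<alpha> (\<gamma> d))"
    "((\<lambda>d. matrix_inv (T22 L \<alpha> (\<gamma> d)) $ k $ l) \<longlongrightarrow> matrix_inv (T_lim L) $ k $ l) at_top" for k l
    by (rule tendsto_matrix_inv[OF tendsto_blocks(5) K.T_inv])+
  have H: "((\<lambda>d. H_qty L \<alpha> (\<gamma> d)) \<longlongrightarrow> K.cTc) at_top"
    and I: "((\<lambda>d. I_qty L \<alpha> (\<gamma> d)) \<longlongrightarrow> K.qTq) at_top"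
    and Jq: "((\<lambda>d. J_qty L \<alpha> (\<gamma> d)) \<longlongrightarrow> K.cTq) at_top"
    unfolding H_qty_def I_qty_def J_qty_def K.cTc_def K.qTq_def K.cTq_def
    by (intro tendsto_inner_matrix T tendsto_blocks)+
  define \<Delta> where "\<Delta> d = (L - H_qty L \<alpha> (\<gamma> d)) * (B_qty L \<alpha> (\<gamma> d) - I_qty L \<alpha> (\<gamma> d))
     - (A_qty L \<alpha> (\<gamma> d) - J_qty L \<alpha> (\<gamma> d))\<^sup>2" for d
  have \<Delta>: "(\<Delta> \<longlongrightarrow> K.schur_det) at_top"
    unfolding \<Delta>_def[abs_def] K.schur_det_def by (intro tendsto_intros H I Jq tendsto_blocks)
  have \<Delta>_nz: "K.schur_det \<noteq> 0" using K_pos by (simp add: K.schur_det_def)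
  have LH: "((\<lambda>d. L - H_qty L \<alpha> (\<gamma> d)) \<longlongrightarrow> L - K.cTc) at_top"
    and BI: "((\<lambda>d. B_qty L \<alpha> (\<gamma> d) - I_qty L \<alpha> (\<gamma> d)) \<longlongrightarrow> B_lim L - K.qTq) at_top"
    and AJ: "((\<lambda>d. A_qty L \<alpha> (\<gamma> d) - J_qty L \<alpha> (\<gamma> d)) \<longlongrightarrow> A_lim L - K.cTq) at_top"
    by (intro tendsto_intros H I Jq tendsto_blocks)+
  \<comment> \<open>Positive definiteness of the limiting Schur complement keeps all denominators in
    \<open>U_mat\<close> away from 0 for large distances.\<close>
  have nz: "L - K.cTc \<noteq> 0" "B_lim L - K.qTq \<noteq> 0" "nw \<noteq> 0" using K_pos nw_pos by auto
  have ev: "\<forall>\<^sub>F d in at_top. L - H_qty L \<alpha> (\<gamma> d) \<noteq> 0" "\<forall>\<^sub>F d in at_top. B_qty L \<alpha> (\<gamma> d) - I_qty L \<alpha> (\<gamma> d) \<noteq> 0"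
    "\<forall>\<^sub>F d in at_top. \<Delta> d \<noteq> 0" "\<forall>\<^sub>F d in at_top. ip (wt_w \<alpha> (\<gamma> d)) (wt_w \<alpha> (\<gamma> d)) \<noteq> 0"
    using tendsto_imp_eventually_ne[OF LH nz(1)] tendsto_imp_eventually_ne[OF BI nz(2)]
      tendsto_imp_eventually_ne[OF \<Delta> \<Delta>_nz] tendsto_imp_eventually_ne[OF tendsto_nw nz(3)]
    by simp_all
  have fim_ev: "\<forall>\<^sub>F d in at_top. invertible (fim_normalized L M d)"
    and fim_inv: "((\<lambda>d. matrix_inv (fim_normalized L M d) $ k $ l) \<longlongrightarrow> matrix_inv (fim_limit L M) $ k $ l) at_top" for k l
    by (rule tendsto_matrix_inv[OF tendsto_fim K.K_inv])+
  \<comment> \<open>The squared gain is the only source of the fourth power, since the norm of the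
    weight converges.\<close>
  have E_eq: "2 * E d / N\<^sub>0 = 2 * G * real N * ip (wt_w \<alpha> (\<gamma> d)) (wt_w \<alpha> (\<gamma> d)) / (N\<^sub>0 * d ^ 4)" if "d > 0" for d
  proof -
    have "(gain G (\<gamma> d))\<^sup>2 = G / d ^ 4"
      using G by (simp add: gain_def power_divide flip: power_mult)
    then show ?thesis by (simp add: E energy_def star_norm_sq mult_ac)
  qed
  have J_ev: "\<forall>\<^sub>F d in at_top. d > 0 \<and> 2 * E d / N\<^sub>0 \<noteq> 0 \<and> invertible (J d) \<and>
      matrix_inv (J d) = inverse (2 * E d / N\<^sub>0) *\<^sub>R matrix_inv (fim_normalized L M d)"
    using eventually_gt_at_top[of 0] fim_ev ev(4)
  proof eventually_elim
    case (elim d)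
    then have nz: "2 * E d / N\<^sub>0 \<noteq> 0" using G N N0 unfolding E_eq[OF elim(1)] by simp
    then show ?case using matrix_inv_scaleR[OF elim(2) nz] elim(1) unfolding J fim_eq by simp
  qed
  show "\<forall>\<^sub>F d in at_top.
            invertible (J d) \<and> invertible (T22 L \<alpha> (\<gamma> d)) \<and>
            B_qty L \<alpha> (\<gamma> d) - I_qty L \<alpha> (\<gamma> d) \<noteq> 0 \<and> L - H_qty L \<alpha> (\<gamma> d) \<noteq> 0 \<and>
            C_qty L \<alpha> (\<gamma> d) \<noteq> 0 \<and> F_qty L \<alpha> (\<gamma> d) \<noteq> 0"
    using J_ev T(1) ev(1-3)
    by eventually_elim (simp add: U_mat_nth(1,2)[OF _ _ \<Delta>_def])
  have "((\<lambda>d. (vector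
     [vector [(B_qty L \<alpha> (\<gamma> d) - I_qty L \<alpha> (\<gamma> d)) / \<Delta> d, 0, (A_qty L \<alpha> (\<gamma> d) - J_qty L \<alpha> (\<gamma> d)) / \<Delta> d],
      vector [0, inverse Z, inverse Z],
      vector [(A_qty L \<alpha> (\<gamma> d) - J_qty L \<alpha> (\<gamma> d)) / \<Delta> d, inverse Z, inverse Z + (L - H_qty L \<alpha> (\<gamma> d)) / \<Delta> d]] :: real^3^3) $ i $ j)
     \<longlongrightarrow> matrix_inv (fim_limit L M) $ Inl i $ Inl j) at_top"
    unfolding K.inverse_block Z
    using exhaust_3[of i] exhaust_3[of j]
    by (elim disjE; simp only: vector_3; intro LH BI AJ \<Delta> \<Delta>_nz tendsto_divide tendsto_add tendsto_const)
  then have U: "((\<lambda>d. U_mat L Z \<alpha> (\<gamma> d) $ i $ j) \<longlongrightarrow> matrix_inv (fim_limit L M) $ Inl i $ Inl j) at_top"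
  proof (rule Lim_transform_eventually)
    show "\<forall>\<^sub>F d in at_top. (vector
     [vector [(B_qty L \<alpha> (\<gamma> d) - I_qty L \<alpha> (\<gamma> d)) / \<Delta> d, 0, (A_qty L \<alpha> (\<gamma> d) - J_qty L \<alpha> (\<gamma> d)) / \<Delta> d],
      vector [0, inverse Z, inverse Z],
      vector [(A_qty L \<alpha> (\<gamma> d) - J_qty L \<alpha> (\<gamma> d)) / \<Delta> d, inverse Z, inverse Z + (L - H_qty L \<alpha> (\<gamma> d)) / \<Delta> d]] :: real^3^3) $ i $ j
      = U_mat L Z \<alpha> (\<gamma> d) $ i $ j"
      using ev(1-3) by eventually_elim (simp add: U_mat_nth(3)[OF _ _ \<Delta>_def])
  qed
  show "(\<lambda>d. (hcrb (J d) - inverse (2 * E d / N\<^sub>0) *\<^sub>R U_mat L Z \<alpha> (\<gamma> d)) $ i $ j) \<in> o[at_top](\<lambda>d. d ^ 4)"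
  proof (rule smalloI_tendsto)
    show "\<forall>\<^sub>F d :: real in at_top. d ^ 4 \<noteq> 0"
      using eventually_gt_at_top[of 0] by eventually_elim simp
    have "((\<lambda>d. N\<^sub>0 / (2 * G * real N * ip (wt_w \<alpha> (\<gamma> d)) (wt_w \<alpha> (\<gamma> d)))
        * (matrix_inv (fim_normalized L M d) $ Inl i $ Inl j - U_mat L Z \<alpha> (\<gamma> d) $ i $ j))
      \<longlongrightarrow> N\<^sub>0 / (2 * G * real N * nw) * (matrix_inv (fim_limit L M) $ Inl i $ Inl j - matrix_inv (fim_limit L M) $ Inl i $ Inl j)) at_top"
      using G N nw_pos by (intro tendsto_intros tendsto_nw fim_inv U) auto
    then have "((\<lambda>d. N\<^sub>0 / (2 * G * real N * ip (wt_w \<alpha> (\<gamma> d)) (wt_w \<alpha> (\<gamma> d)))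
        * (matrix_inv (fim_normalized L M d) $ Inl i $ Inl j - U_mat L Z \<alpha> (\<gamma> d) $ i $ j)) \<longlongrightarrow> 0) at_top"
      by simp
    then show "((\<lambda>d. (hcrb (J d) - inverse (2 * E d / N\<^sub>0) *\<^sub>R U_mat L Z \<alpha> (\<gamma> d)) $ i $ j / d ^ 4) \<longlongrightarrow> 0) at_top"
    proof (rule Lim_transform_eventually)
      show "\<forall>\<^sub>F d in at_top. N\<^sub>0 / (2 * G * real N * ip (wt_w \<alpha> (\<gamma> d)) (wt_w \<alpha> (\<gamma> d)))
        * (matrix_inv (fim_normalized L M d) $ Inl i $ Inl j - U_mat L Z \<alpha> (\<gamma> d) $ i $ j)
        = (hcrb (J d) - inverse (2 * E d / N\<^sub>0) *\<^sub>R U_mat L Z \<alpha> (\<gamma> d)) $ i $ j / d ^ 4"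
        using J_ev
      proof eventually_elim
        case (elim d)
        have 1: "(hcrb (J d) - inverse (2 * E d / N\<^sub>0) *\<^sub>R U_mat L Z \<alpha> (\<gamma> d)) $ i $ j
          = inverse (2 * E d / N\<^sub>0) * (matrix_inv (fim_normalized L M d) $ Inl i $ Inl j - U_mat L Z \<alpha> (\<gamma> d) $ i $ j)"
          using elim by (simp add: hcrb_def right_diff_distrib)
        have 2: "inverse (2 * E d / N\<^sub>0) = N\<^sub>0 / (2 * G * real N * ip (wt_w \<alpha> (\<gamma> d)) (wt_w \<alpha> (\<gamma> d))) * d ^ 4"
          unfolding E_eq[OF conjunct1[OF elim]] by simp
        show ?case unfolding 1 unfolding 2 using elim by simp
      qed
    qed
  qed
qed

end

text \<open>The eventual invertibility and nonvanishing ensure that the asymptotic formula speaks of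
  genuine inverses: \<open>matrix_inv\<close> and division have default values at singular
  arguments.\<close>

theorem proposition3:
  fixes m n :: "real ^ 'q::{finite,linorder}"
    and \<phi>0 \<psi> \<alpha> N\<^sub>0 B\<^sub>R\<^sub>M\<^sub>S c G :: real
    and N :: nat
    and \<gamma> :: "real \<Rightarrow> 'q param"
    and L M Z :: real
    and E :: "real \<Rightarrow> real"
    and J :: "real \<Rightarrow> real ^ (3 + 'q + 'q) ^ (3 + 'q + 'q)"
  defines "\<gamma> \<equiv> (\<lambda>d. params d \<phi>0 \<psi> m n)"
    and "L \<equiv> L_const B\<^sub>R\<^sub>M\<^sub>S c"
    and "M \<equiv> M_const N"
    and "Z \<equiv> M * (cos \<phi>0)\<^sup>2"
    and "E \<equiv> (\<lambda>d. energy G N \<alpha> (\<gamma> d))"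
    and "J \<equiv> (\<lambda>d. fim L M (E d) N\<^sub>0 \<alpha> (\<gamma> d))"
  assumes "m $ Min UNIV > 0" and "n $ Min UNIV > 0"
    and "\<forall>u\<in>{0..2 * pi}. dot (contour m n) u \<noteq> 0"
    and "\<alpha> \<ge> 0" and "N \<ge> 1" and "N\<^sub>0 > 0" and "B\<^sub>R\<^sub>M\<^sub>S > 0" and "c > 0" and "G > 0"
    and "Z > 0"
  shows "(\<forall>\<^sub>F d in at_top.
            invertible (J d) \<and> invertible (T22 L \<alpha> (\<gamma> d)) \<and>
            B_qty L \<alpha> (\<gamma> d) - I_qty L \<alpha> (\<gamma> d) \<noteq> 0 \<and> L - H_qty L \<alpha> (\<gamma> d) \<noteq> 0 \<and>
            C_qty L \<alpha> (\<gamma> d) \<noteq> 0 \<and> F_qty L \<alpha> (\<gamma> d) \<noteq> 0) \<and>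
         (\<forall>i j. (\<lambda>d. (hcrb (J d) - inverse (2 * E d / N\<^sub>0) *\<^sub>R U_mat L Z \<alpha> (\<gamma> d)) $ i $ j)
                  \<in> o[at_top](\<lambda>d. d ^ 4))"
proof -
  have "dcos_vec u \<bullet> m \<noteq> 0 \<or> dsin_vec u \<bullet> n \<noteq> 0" if "u \<in> {0..2 * pi}" for u
  proof -
    have "(vector [dcos_vec u \<bullet> m, dsin_vec u \<bullet> n] :: real^2) \<noteq> 0"
      using assms(9) that vector_derivative_at[OF has_vector_derivative_contour[of m n u]] by auto
    then show ?thesis by (auto simp: vec_eq_iff forall_2)
  qed
  then interpret asymptotics m n \<phi>0 \<psi> \<alpha>
    by unfold_locales (use assms in auto)
  have "L > 0" using assms by (simp add: L_def L_const_def)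
  \<comment> \<open>The square of the cosine is not negative, so a positive product forces both
    factors to be positive.\<close>
  moreover have "M > 0" "cos \<phi>0 \<noteq> 0"
    using \<open>Z > 0\<close> by (auto simp: Z_def zero_less_mult_iff)
  ultimately show ?thesis
    using hcrb_asymptotics[of L M N N\<^sub>0 G Z E J] assms(11,12,15)
    by (simp add: \<gamma>_def Z_def E_def J_def)
qed

end
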